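(* Let $p$ be a prime, $\mathbf{k}$ a field of characteristic $p$, and $G$ a finite group. If $M$ is a (finite dimensional) trivial source $\mathbf{k}G$-module, then $\gamma_G(M)$ is an integer.
   Context: A trivial source module of $G$ is a $\mathbf{k}G$-module isomorphic to a direct summand of a finite dimensional permutation $\mathbf{k}G$-module. For a finite group $G$ and a finite dimensional $\mathbf{k}G$-module $M$, write $M=M'\oplus(\text{proj})$ where $M'$ has no nonzero projective direct summand; $M'$ is called the core of $M$, denoted $core_G(M)$. Put $c^G_m(M)=\dim core_G(M^{\otimes m})$. The Benson--Symonds invariant is $\gamma_G(M)=\lim_{m\to\infty}\sqrt[m]{c_m^G(M)}$; this limit is known to exist (Benson--Symonds). *)

theory Defs
  imports Complex_Main "HOL-Library.Function_Algebras" "HOL-Computational_Algebra.Primes"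
    "HOL-Algebra.Group_Action"
begin

section \<open>Modules over a group algebra\<close>

text \<open>
  A module over the group algebra of \<open>G\<close> over the field \<open>'k\<close> is a \<open>'k\<close>-vector space with a linear
  action of \<open>G\<close>.  The underlying vector space is a subspace \<open>vspace M\<close> of an ambient vector space
  on the type \<open>'v\<close>; the action is only meaningful on \<open>carrier G\<close> and \<open>vspace M\<close>.
\<close>

record ('g, 'k, 'v) kG_module =
  vspace :: "'v set"
  scal :: "'k \<Rightarrow> 'v \<Rightarrow> 'v"
  act :: "'g \<Rightarrow> 'v \<Rightarrow> 'v"

locale kG_module = group G + vs: vector_space "scal M"
  for G :: "('g, 'b) monoid_scheme" (structure)
    and M :: "('g, 'k::field, 'v::ab_group_add) kG_module" +
  assumes subspace: "vs.subspace (vspace M)"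
    and act_closed: "\<lbrakk>g \<in> carrier G; v \<in> vspace M\<rbrakk> \<Longrightarrow> act M g v \<in> vspace M"
    and act_add: "\<lbrakk>g \<in> carrier G; v \<in> vspace M; w \<in> vspace M\<rbrakk>
      \<Longrightarrow> act M g (v + w) = act M g v + act M g w"
    and act_scal: "\<lbrakk>g \<in> carrier G; v \<in> vspace M\<rbrakk> \<Longrightarrow> act M g (scal M c v) = scal M c (act M g v)"
    and act_one: "v \<in> vspace M \<Longrightarrow> act M \<one> v = v"
    and act_mult: "\<lbrakk>g \<in> carrier G; h \<in> carrier G; v \<in> vspace M\<rbrakk>
      \<Longrightarrow> act M (g \<otimes> h) v = act M g (act M h v)"

definition fin_dim :: "('g, 'k::field, 'v::ab_group_add) kG_module \<Rightarrow> bool" where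
  "fin_dim M \<longleftrightarrow> (\<exists>B. finite B \<and> vspace M \<subseteq> module.span (scal M) B)"

definition kG_dim :: "('g, 'k::field, 'v::ab_group_add) kG_module \<Rightarrow> nat" where
  "kG_dim M = vector_space.dim (scal M) (vspace M)"

definition kG_iso :: "('g, 'b) monoid_scheme \<Rightarrow> ('g, 'k::field, 'v::ab_group_add) kG_module \<Rightarrow>
    ('g, 'k, 'w::ab_group_add) kG_module \<Rightarrow> bool" where
  "kG_iso G M N \<longleftrightarrow> (\<exists>f. bij_betw f (vspace M) (vspace N) \<and>
     (\<forall>v\<in>vspace M. \<forall>w\<in>vspace M. f (v + w) = f v + f w) \<and>
     (\<forall>c. \<forall>v\<in>vspace M. f (scal M c v) = scal N c (f v)) \<and>
     (\<forall>g\<in>carrier G. \<forall>v\<in>vspace M. f (act M g v) = act N g (f v)))"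

definition kG_submodule :: "('g, 'b) monoid_scheme \<Rightarrow> ('g, 'k::field, 'v::ab_group_add) kG_module \<Rightarrow>
    ('g, 'k, 'v) kG_module \<Rightarrow> bool" where
  "kG_submodule G W M \<longleftrightarrow> (\<exists>S. W = M\<lparr>vspace := S\<rparr> \<and> S \<subseteq> vspace M \<and>
     module.subspace (scal M) S \<and> (\<forall>g\<in>carrier G. \<forall>v\<in>S. act M g v \<in> S))"

definition direct_sum :: "('g, 'b) monoid_scheme \<Rightarrow> ('g, 'k::field, 'v::ab_group_add) kG_module \<Rightarrow>
    ('g, 'k, 'v) kG_module \<Rightarrow> ('g, 'k, 'v) kG_module \<Rightarrow> bool" where
  "direct_sum G M W U \<longleftrightarrow> kG_submodule G W M \<and> kG_submodule G U M \<and>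
     vspace W \<inter> vspace U = {0} \<and> vspace M = {w + u | w u. w \<in> vspace W \<and> u \<in> vspace U}"

definition direct_summand :: "('g, 'b) monoid_scheme \<Rightarrow> ('g, 'k::field, 'v::ab_group_add) kG_module \<Rightarrow>
    ('g, 'k, 'v) kG_module \<Rightarrow> bool" where
  "direct_summand G W M \<longleftrightarrow> (\<exists>U. direct_sum G M W U)"


section \<open>Permutation modules, free modules, projective modules\<close>

text \<open>
  The permutation module on a finite \<open>G\<close>-set \<open>X\<close>: the formal sum of the \<open>f x \<cdot> x\<close> over \<open>x \<in> X\<close> is
  represented by its coefficient function \<open>f\<close> (zero outside \<open>X\<close>).  The coefficient of \<open>x\<close> in
  \<open>g \<cdot> f\<close> is then the coefficient of \<open>g\<inverse> x\<close> in \<open>f\<close>.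
\<close>

definition perm_module :: "('g, 'b) monoid_scheme \<Rightarrow> 'x set \<Rightarrow> ('g \<Rightarrow> 'x \<Rightarrow> 'x) \<Rightarrow>
    ('g, 'k::field, 'x \<Rightarrow> 'k) kG_module" where
  "perm_module G X \<phi> = \<lparr>
     vspace = {f. \<forall>x. x \<notin> X \<longrightarrow> f x = 0},
     scal = (\<lambda>c f x. c * f x),
     act = (\<lambda>g f x. if x \<in> X then f (\<phi> (inv\<^bsub>G\<^esub> g) x) else 0)\<rparr>"

text \<open>
  The free module of rank \<open>n\<close>, i.e. the sum of \<open>n\<close> copies of the group algebra, with basis
  \<open>{..<n} \<times> carrier G\<close>.
\<close>

definition free_module :: "('g, 'b) monoid_scheme \<Rightarrow> nat \<Rightarrow>
    ('g, 'k::field, nat \<times> 'g \<Rightarrow> 'k) kG_module" where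
  "free_module G n = perm_module G ({..<n} \<times> carrier G) (\<lambda>g (i, h). (i, g \<otimes>\<^bsub>G\<^esub> h))"

text \<open>Only used for finite-dimensional modules, for which free modules of finite rank suffice.\<close>

definition projective :: "('g, 'b) monoid_scheme \<Rightarrow> ('g, 'k::field, 'v::ab_group_add) kG_module \<Rightarrow> bool"
  where
  "projective G M \<longleftrightarrow> kG_module G M \<and>
     (\<exists>n W. direct_summand G W (free_module G n) \<and> kG_iso G M W)"

text \<open>Every finite \<open>G\<close>-set is isomorphic to one whose underlying set consists of natural numbers.\<close>

definition trivial_source :: "('g, 'b) monoid_scheme \<Rightarrow> ('g, 'k::field, 'v::ab_group_add) kG_module \<Rightarrow>
    bool" where
  "trivial_source G M \<longleftrightarrow> kG_module G M \<and>
     (\<exists>(X :: nat set) \<phi> W. finite X \<and> group_action G X \<phi> \<and>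
        direct_summand G W (perm_module G X \<phi>) \<and> kG_iso G M W)"


section \<open>Tensor powers\<close>

definition linear_forms :: "('g, 'k::field, 'v::ab_group_add) kG_module \<Rightarrow> ('v \<Rightarrow> 'k) set" where
  "linear_forms M = {\<phi>. (\<forall>v\<in>vspace M. \<forall>w\<in>vspace M. \<phi> (v + w) = \<phi> v + \<phi> w) \<and>
     (\<forall>c. \<forall>v\<in>vspace M. \<phi> (scal M c v) = c * \<phi> v)}"

text \<open>
  The \<open>m\<close>-fold tensor power over \<open>'k\<close> is realised inside the space of multilinear forms on the dual
  space: the pure tensor \<open>v\<^sub>1 \<otimes> \<dots> \<otimes> v\<^sub>m\<close> maps linear forms \<open>\<phi>\<^sub>1, \<dots>, \<phi>\<^sub>m\<close> to
  \<open>\<phi>\<^sub>1 v\<^sub>1 \<cdot> \<dots> \<cdot> \<phi>\<^sub>m v\<^sub>m\<close>, and the tensor power is the span of the pure tensors.  The action below is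
  the diagonal one, see \<open>tensor_power_act_pure\<close>.
\<close>

definition pure_tensor :: "('g, 'k::field, 'v::ab_group_add) kG_module \<Rightarrow> 'v list \<Rightarrow>
    ('v \<Rightarrow> 'k) list \<Rightarrow> 'k" where
  "pure_tensor M vs = (\<lambda>\<phi>s. if length \<phi>s = length vs \<and> set \<phi>s \<subseteq> linear_forms M
     then \<Prod>i<length vs. (\<phi>s ! i) (vs ! i) else 0)"

definition tensor_power :: "('g, 'k::field, 'v::ab_group_add) kG_module \<Rightarrow> nat \<Rightarrow>
    ('g, 'k, ('v \<Rightarrow> 'k) list \<Rightarrow> 'k) kG_module" where
  "tensor_power M m = \<lparr>
     vspace = module.span (\<lambda>c t \<phi>s. c * t \<phi>s)
       (pure_tensor M ` {vs. length vs = m \<and> set vs \<subseteq> vspace M}),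
     scal = (\<lambda>c t \<phi>s. c * t \<phi>s),
     act = (\<lambda>g t \<phi>s. t (map (\<lambda>\<phi>. \<phi> \<circ> act M g) \<phi>s))\<rparr>"

context kG_module
begin

lemma linear_form_comp_act:
  assumes "g \<in> carrier G"
  shows "\<phi> \<circ> act M g \<in> linear_forms M \<longleftrightarrow> \<phi> \<in> linear_forms M"
proof
  show "\<phi> \<circ> act M g \<in> linear_forms M" if "\<phi> \<in> linear_forms M"
    using that assms by (auto simp: linear_forms_def act_add act_scal act_closed)
next
  assume *: "\<phi> \<circ> act M g \<in> linear_forms M"
  have inv: "act M g (act M (inv g) v) = v" if "v \<in> vspace M" for v
    using act_mult[of g "inv g" v] that assms by (simp add: act_one)
  have "\<phi> (v + w) = \<phi> v + \<phi> w" if "v \<in> vspace M" "w \<in> vspace M" for v w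
  proof -
    have "\<phi> (act M g (act M (inv g) v + act M (inv g) w)) =
        \<phi> (act M g (act M (inv g) v)) + \<phi> (act M g (act M (inv g) w))"
      using * that assms by (auto simp: linear_forms_def act_closed)
    then show ?thesis
      using that assms by (simp add: act_add act_closed inv)
  qed
  moreover have "\<phi> (scal M c v) = c * \<phi> v" if "v \<in> vspace M" for c v
  proof -
    have "\<phi> (act M g (scal M c (act M (inv g) v))) = c * \<phi> (act M g (act M (inv g) v))"
      using * that assms by (auto simp: linear_forms_def act_closed)
    then show ?thesis
      using that assms by (simp add: act_scal act_closed inv)
  qed
  ultimately show "\<phi> \<in> linear_forms M"
    by (auto simp: linear_forms_def)
qed

lemma tensor_power_act_pure:
  assumes "g \<in> carrier G"
  shows "act (tensor_power M m) g (pure_tensor M vs) = pure_tensor M (map (act M g) vs)"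
proof
  fix \<phi>s
  have "set (map (\<lambda>\<phi>. \<phi> \<circ> act M g) \<phi>s) \<subseteq> linear_forms M \<longleftrightarrow> set \<phi>s \<subseteq> linear_forms M"
    using assms by (auto simp: linear_form_comp_act)
  then show "act (tensor_power M m) g (pure_tensor M vs) \<phi>s = pure_tensor M (map (act M g) vs) \<phi>s"
    by (auto simp: tensor_power_def pure_tensor_def)
qed

end


section \<open>The core and the Benson--Symonds invariant\<close>

definition is_core :: "('g, 'b) monoid_scheme \<Rightarrow> ('g, 'k::field, 'v::ab_group_add) kG_module \<Rightarrow>
    ('g, 'k, 'v) kG_module \<Rightarrow> bool" where
  "is_core G M M' \<longleftrightarrow> (\<exists>P. direct_sum G M M' P \<and> projective G P) \<and>
     (\<forall>Q. direct_summand G Q M' \<and> projective G Q \<longrightarrow> vspace Q = {0})"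

text \<open>The core exists, and by Krull--Schmidt is unique up to isomorphism, if \<open>M\<close> is
  finite-dimensional and \<open>G\<close> is finite.\<close>

definition core :: "('g, 'b) monoid_scheme \<Rightarrow> ('g, 'k::field, 'v::ab_group_add) kG_module \<Rightarrow>
    ('g, 'k, 'v) kG_module" where
  "core G M = (SOME M'. is_core G M M')"

definition core_dim :: "('g, 'b) monoid_scheme \<Rightarrow> ('g, 'k::field, 'v::ab_group_add) kG_module \<Rightarrow>
    nat \<Rightarrow> nat" where
  "core_dim G M m = kG_dim (core G (tensor_power M m))"

definition benson_symonds :: "('g, 'b) monoid_scheme \<Rightarrow> ('g, 'k::field, 'v::ab_group_add) kG_module \<Rightarrow>
    real" where
  "benson_symonds G M = lim (\<lambda>m. root m (real (core_dim G M m)))"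

end

theory Submission
  imports Defs "HOL-Algebra.Sylow" "HOL-Algebra.Elementary_Groups"
begin

text \<open>
  A direct summand of a permutation module is a module with an equivariant resolution of the identity
  \<open>v = (\<Sum>x\<in>X. l\<^sub>x(v) m\<^sub>x)\<close> indexed by a finite \<open>G\<close>-set \<open>X\<close> (a frame), and frames are multiplicative
  under tensor powers.  For a subgroup \<open>Q\<close> of order \<open>p\<close>, a \<open>Q\<close>-frame of \<open>M\<close> can be modified until it is
  biorthogonal on its fixed points; let \<open>a\<^sub>Q\<close> be their number, the dimension of the Brauer quotient
  \<open>M(Q)\<close>.  The \<open>m\<close>-th tensor power then has \<open>a\<^sub>Q\<^sup>m\<close> fixed points.  Linear forms that are fixed by \<open>Q\<close>
  vanish on the \<open>Q\<close>-invariants of a projective module, so the core has dimension at least \<open>a\<^sub>Q\<^sup>m\<close>.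

  Conversely, let \<open>K\<close> be the core and \<open>P\<close> a Sylow subgroup.  The identity of \<open>K\<close> is a relative trace
  from the trivial subgroup to \<open>P\<close> plus a \<open>P\<close>-map \<open>f\<close> whose image is generated by vectors fixed by
  subgroups of order \<open>p\<close>; since a \<open>p\<close>-group has nonzero fixed points in characteristic \<open>p\<close>, that image
  is generated by \<open>\<Sum>\<^sub>Q a\<^sub>Q\<^sup>m\<close> vectors.  Averaging over \<open>G/P\<close> and using that traces from the trivial
  subgroup to \<open>G\<close> are nilpotent on a module without projective summands bounds \<open>dim K\<close> by
  \<open>|G| \<Sum>\<^sub>Q a\<^sub>Q\<^sup>m\<close>.  Hence the limit is the maximum of the \<open>a\<^sub>Q\<close>.
\<close>

section \<open>Group actions\<close>

text \<open>The vectors of a frame need not be independent, since a summand inherits them only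
  through a projection. The raw number of fixed points may therefore be too large, and counting it
  would falsify the lower bound. Removing the excess once, before any tensor power is taken, is what
  lets the same number of fixed points appear in both bounds, up to a factor that does not depend on
  the exponent. Subgroups of order p suffice for two reasons: each of their orbits is a fixed point
  or free, and every nontrivial stabilizer in a p-group contains one of them. Projectivity is
  handled through Higman's criterion: a module is projective iff its identity is a trace from the
  trivial subgroup. It gives at once the vanishing of invertible traces on a core and the
  projectivity of sums of projective summands. The factor |G| counts the translates that turn a set
  of vectors, each fixed only by a small subgroup, into a generating set stable under the
  group.\<close>

definition acts_on :: "('h, 'c) monoid_scheme \<Rightarrow> 'x set \<Rightarrow> ('h \<Rightarrow> 'x \<Rightarrow> 'x) \<Rightarrow> bool" where
  "acts_on H X \<pi> \<longleftrightarrow> (\<forall>h\<in>carrier H. \<forall>x\<in>X. \<pi> h x \<in> X) \<and> (\<forall>x\<in>X. \<pi> \<one>\<^bsub>H\<^esub> x = x) \<and>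
     (\<forall>g\<in>carrier H. \<forall>h\<in>carrier H. \<forall>x\<in>X. \<pi> (g \<otimes>\<^bsub>H\<^esub> h) x = \<pi> g (\<pi> h x))"

lemma acts_on_closed: "acts_on H X \<pi> \<Longrightarrow> h \<in> carrier H \<Longrightarrow> x \<in> X \<Longrightarrow> \<pi> h x \<in> X"
  and acts_on_one: "acts_on H X \<pi> \<Longrightarrow> x \<in> X \<Longrightarrow> \<pi> \<one>\<^bsub>H\<^esub> x = x"
  and acts_on_mult: "acts_on H X \<pi> \<Longrightarrow> g \<in> carrier H \<Longrightarrow> h \<in> carrier H \<Longrightarrow> x \<in> X \<Longrightarrow>
    \<pi> (g \<otimes>\<^bsub>H\<^esub> h) x = \<pi> g (\<pi> h x)"
  by (auto simp: acts_on_def)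

lemma acts_on_restrict:
  assumes "acts_on G X \<pi>" "P \<subseteq> carrier G"
  shows "acts_on (G\<lparr>carrier := P\<rparr>) X \<pi>"
  using assms unfolding acts_on_def by (auto simp: subset_iff)

context group
begin

lemma acts_on_inv:
  assumes "acts_on G X \<pi>" "g \<in> carrier G" "x \<in> X"
  shows "\<pi> (inv g) (\<pi> g x) = x" "\<pi> g (\<pi> (inv g) x) = x"
  using assms acts_on_mult[OF assms(1), of "inv g" g x] acts_on_mult[OF assms(1), of g "inv g" x]
  by (auto simp: acts_on_one)

lemma acts_on_bij_betw:
  assumes "acts_on G X \<pi>" "g \<in> carrier G"
  shows "bij_betw (\<pi> g) X X"
  using assms by (intro bij_betw_byWitness[where f' = "\<pi> (inv g)"])
    (auto simp: acts_on_inv acts_on_closed)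

lemma acts_on_fixed_inv:
  assumes "acts_on G X \<pi>" "g \<in> carrier G" "x \<in> X" "\<pi> g x = x"
  shows "\<pi> (inv g) x = x"
  using acts_on_inv(1)[OF assms(1-3)] assms(4) by simp

lemma acts_on_fixed_subset:
  assumes "acts_on G X \<pi>"
  shows "acts_on G {x\<in>X. \<forall>h\<in>carrier G. \<pi> h x = x} \<pi>"
  using assms unfolding acts_on_def by auto

lemma acts_on_Diff:
  assumes "acts_on G X \<pi>" "acts_on G Y \<pi>" "Y \<subseteq> X"
  shows "acts_on G (X - Y) \<pi>"
proof -
  have "\<pi> h x \<notin> Y" if "h \<in> carrier G" "x \<in> X" "x \<notin> Y" for h x
    using that acts_on_inv(1)[OF assms(1) that(1,2)] acts_on_closed[OF assms(2), of "inv h" "\<pi> h x"]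
    by auto
  then show ?thesis
    using assms unfolding acts_on_def by auto
qed

lemma stabilizer_subgroup:
  assumes "acts_on G X \<pi>" "x \<in> X"
  shows "subgroup {g\<in>carrier G. \<pi> g x = x} G"
  using assms by unfold_locales (auto simp: acts_on_mult acts_on_one acts_on_fixed_inv)

text \<open>A free orbit is a copy of the group, so one point per orbit parametrises X without
  repetition. Sums over free orbits become double sums through this bijection.\<close>

lemma free_transversal:
  assumes act: "acts_on G X \<pi>"
    and free: "\<And>h x. h \<in> carrier G \<Longrightarrow> x \<in> X \<Longrightarrow> \<pi> h x = x \<Longrightarrow> h = \<one>"
  shows "\<exists>R\<subseteq>X. bij_betw (\<lambda>(x, h). \<pi> h x) (R \<times> carrier G) X"
proof -
  define orb where "orb x = (\<lambda>h. \<pi> h x) ` carrier G" for x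
  \<comment> \<open>The choice sees only the orbit of x, so \<open>rep\<close> is constant on orbits
    and hence idempotent.\<close>
  define rep where "rep x = (SOME y. y \<in> orb x)" for x
  have orb_eq: "orb (\<pi> h x) = orb x" if "h \<in> carrier G" "x \<in> X" for h x
  proof -
    have "\<pi> g x \<in> orb (\<pi> h x)" if "g \<in> carrier G" for g
    proof -
      have "\<pi> (g \<otimes> inv h) (\<pi> h x) = \<pi> g x"
        using that \<open>h \<in> carrier G\<close> \<open>x \<in> X\<close> act
        by (simp add: acts_on_mult acts_on_inv acts_on_closed)
      then show ?thesis
        using that \<open>h \<in> carrier G\<close> unfolding orb_def by (metis image_eqI inv_closed m_closed)
    qed
    moreover have "\<pi> g (\<pi> h x) \<in> orb x" if "g \<in> carrier G" for g
      using that \<open>h \<in> carrier G\<close> \<open>x \<in> X\<close> acts_on_mult[OF act, of g h x] unfolding orb_def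
      by (metis image_eqI m_closed)
    ultimately show ?thesis
      unfolding orb_def by auto
  qed
  have rep: "rep x \<in> orb x" for x
    unfolding rep_def by (rule someI[of _ "\<pi> \<one> x"]) (auto simp: orb_def)
  define R where "R = rep ` X"
  have RX: "R \<subseteq> X"
  proof -
    have "orb x \<subseteq> X" if "x \<in> X" for x
      using that act by (auto simp: orb_def acts_on_closed)
    then show ?thesis
      using rep unfolding R_def by blast
  qed
  have rep_rep: "rep x = x" if "x \<in> R" for x
  proof -
    obtain y where y: "y \<in> X" "x = rep y"
      using \<open>x \<in> R\<close> by (auto simp: R_def)
    obtain h where "h \<in> carrier G" "x = \<pi> h y"
      using rep[of y] y by (auto simp: orb_def)
    then have "orb x = orb y"
      using orb_eq y by simp
    then show ?thesis
      using y unfolding rep_def by simp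
  qed
  have rep_orb: "rep (\<pi> h x) = rep x" if "h \<in> carrier G" "x \<in> X" for h x
    unfolding rep_def orb_eq[OF that] ..
  have "inj_on (\<lambda>(x, h). \<pi> h x) (R \<times> carrier G)"
  proof (rule inj_onI, clarify)
    fix x h y g
    assume *: "x \<in> R" "h \<in> carrier G" "y \<in> R" "g \<in> carrier G" "\<pi> h x = \<pi> g y"
    then have "x = y"
      using rep_orb rep_rep RX by (metis subsetD)
    have "\<pi> (inv h \<otimes> g) y = y"
      using * RX \<open>x = y\<close> acts_on_mult[OF act, of "inv h" g y] acts_on_inv(1)[OF act, of h x] by auto
    then have "inv h \<otimes> g = \<one>"
      using free[of "inv h \<otimes> g" y] * RX by auto
    then have "h = g"
      using * by (metis inv_closed inv_equality inv_inv)
    then show "x = y \<and> h = g"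
      using \<open>x = y\<close> by simp
  qed
  moreover have "(\<lambda>(x, h). \<pi> h x) ` (R \<times> carrier G) = X"
  proof
    show "(\<lambda>(x, h). \<pi> h x) ` (R \<times> carrier G) \<subseteq> X"
      using RX act by (auto simp: acts_on_def)
    show "X \<subseteq> (\<lambda>(x, h). \<pi> h x) ` (R \<times> carrier G)"
    proof
      fix x assume x: "x \<in> X"
      then obtain h where h: "h \<in> carrier G" "rep x = \<pi> h x"
        using rep[of x] by (auto simp: orb_def)
      then have "x = \<pi> (inv h) (rep x)"
        using x act by (simp add: acts_on_inv)
      then show "x \<in> (\<lambda>(x, h). \<pi> h x) ` (R \<times> carrier G)"
        using h x by (auto simp: R_def intro!: image_eqI[where x = "(rep x, inv h)"])
    qed
  qed
  ultimately show ?thesis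
    using RX by (auto simp: bij_betw_def)
qed

lemma sum_free_transversal:
  assumes "bij_betw (\<lambda>(x, h). \<pi> h x) (R \<times> carrier G) X"
  shows "sum f X = (\<Sum>x\<in>R. \<Sum>h\<in>carrier G. f (\<pi> h x))"
  using sum.reindex_bij_betw[OF assms, of f]
  by (simp add: sum.cartesian_product case_prod_unfold)

text \<open>Each free orbit contributes |G| equal terms, and |G| is zero in the ring of
  values.\<close>

lemma sum_invariant_free:
  fixes f :: "'x \<Rightarrow> 'k::comm_semiring_1"
  assumes "acts_on G X \<pi>"
    and "\<And>h x. h \<in> carrier G \<Longrightarrow> x \<in> X \<Longrightarrow> \<pi> h x = x \<Longrightarrow> h = \<one>"
    and "\<And>h x. h \<in> carrier G \<Longrightarrow> x \<in> X \<Longrightarrow> f (\<pi> h x) = f x"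
    and "of_nat (order G) = (0 :: 'k)"
  shows "sum f X = 0"
proof -
  obtain R where R: "R \<subseteq> X" "bij_betw (\<lambda>(x, h). \<pi> h x) (R \<times> carrier G) X"
    using free_transversal[OF assms(1)] assms(2) by metis
  have "sum f X = (\<Sum>x\<in>R. \<Sum>h\<in>carrier G. f x)"
    unfolding sum_free_transversal[OF R(2)] using R(1) assms(3) by (intro sum.cong) auto
  also have "\<dots> = 0"
    using assms(4) by (simp add: order_def)
  finally show ?thesis .
qed

text \<open>The order of the stabilizer divides a prime. This dichotomy singles out the subgroups of
  prime order.\<close>

lemma prime_order_fixed_or_free:
  assumes "prime (order G)" "acts_on G X \<pi>" "x \<in> X" "g \<in> carrier G" "\<pi> g x = x" "g \<noteq> \<one>"
  shows "\<forall>h\<in>carrier G. \<pi> h x = x"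
proof -
  let ?S = "{g\<in>carrier G. \<pi> g x = x}"
  have S: "subgroup ?S G"
    by (rule stabilizer_subgroup) fact+
  have fin: "finite (carrier G)"
    using assms(1) by (metis card.infinite not_prime_0 order_def)
  have "card ?S dvd order G"
    using lagrange[OF S] by (metis dvd_triv_right)
  moreover have "card ?S \<noteq> 1"
  proof
    assume "card ?S = 1"
    then obtain z where "?S = {z}"
      by (auto simp: card_1_singleton_iff)
    moreover have "g \<in> ?S" "\<one> \<in> ?S"
      using assms acts_on_one[of G X \<pi> x] by auto
    ultimately show False
      using \<open>g \<noteq> \<one>\<close> by auto
  qed
  ultimately have "card ?S = card (carrier G)"
    using assms(1) by (metis order_def prime_nat_iff)
  then have "?S = carrier G"
    using fin by (intro card_subset_eq) auto
  then show ?thesis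
    by auto
qed

text \<open>Nontrivial orbits of a p-group have length divisible by p, so the number of fixed points
  is divisible by p too, and a fixed point cannot be alone.\<close>

lemma p_group_second_fixed_point:
  assumes "prime p" "order G = p ^ n" "acts_on G S \<pi>" "finite S" "p dvd card S"
    and s0: "s0 \<in> S" "\<forall>g\<in>carrier G. \<pi> g s0 = s0"
  shows "\<exists>s\<in>S. s \<noteq> s0 \<and> (\<forall>g\<in>carrier G. \<pi> g s = s)"
proof (rule ccontr)
  assume no: "\<not> ?thesis"
  \<comment> \<open>The library notion of action takes values in the extensional bijections of S,
    hence the restriction. \<open>acts_on\<close> avoids this, so that maps like
    \<open>map (\<pi> g)\<close> on words qualify as they stand.\<close>
  define \<phi> where "\<phi> g = restrict (\<pi> g) S" for g
  have fin: "finite (carrier G)"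
    using assms(1,2) by (metis card.infinite not_prime_0 order_def power_eq_0_iff)
  interpret group_action G S \<phi>
    unfolding group_action_def
  proof (rule group_hom.intro, rule group_axioms, rule group_BijGroup, rule group_hom_axioms.intro, rule homI)
    fix g assume "g \<in> carrier G"
    then show "\<phi> g \<in> carrier (BijGroup S)"
      using acts_on_bij_betw[OF assms(3), of g] by (auto simp: BijGroup_def Bij_def \<phi>_def)
    fix h assume "h \<in> carrier G"
    then show "\<phi> (g \<otimes> h) = \<phi> g \<otimes>\<^bsub>BijGroup S\<^esub> \<phi> h"
      using \<open>g \<in> carrier G\<close> acts_on_bij_betw[OF assms(3), of g] acts_on_bij_betw[OF assms(3), of h] assms(3)
      by (simp add: BijGroup_def \<phi>_def Bij_def)
         (auto simp: compose_def restrict_def fun_eq_iff acts_on_mult acts_on_closed)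
  qed
  have orb: "orbit G \<phi> x = (\<lambda>g. \<pi> g x) ` carrier G" if "x \<in> S" for x
    using that by (auto simp: orbit_def \<phi>_def)
  have dvd: "p dvd card (orbit G \<phi> x)" if "x \<in> S" "x \<noteq> s0" for x
  proof -
    have "card (orbit G \<phi> x) dvd p ^ n"
      using orbit_stabilizer_theorem[OF that(1)] assms(2) by (metis dvd_triv_left)
    moreover have "card (orbit G \<phi> x) \<noteq> 1"
    proof
      assume "card (orbit G \<phi> x) = 1"
      then obtain z where "orbit G \<phi> x = {z}"
        by (auto simp: card_1_singleton_iff)
      then have "\<pi> g x = z" if "g \<in> carrier G" for g
        using that orb[OF \<open>x \<in> S\<close>] by auto
      then have "\<pi> g x = x" if "g \<in> carrier G" for g
        using that acts_on_one[OF assms(3) \<open>x \<in> S\<close>] by (metis one_closed)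
      then show False
        using no that by blast
    qed
    ultimately show ?thesis
      using assms(1) by (metis divides_primepow_nat dvd_power_same dvd_refl gr0I power_0 dvd_power)
  qed
  have dj: "pairwise (\<lambda>A B. disjnt A B) (orbits G S \<phi>)"
    unfolding pairwise_def disjnt_def using disjoint_union by blast
  have orbS: "orbit G \<phi> x \<subseteq> S" if "x \<in> S" for x
    using that orb assms(3) by (auto simp: acts_on_closed)
  have fin_orb: "finite A" if "A \<in> orbits G S \<phi>" for A
    using that orbS assms(4) by (auto simp: orbits_def intro: finite_subset)
  have s0orb: "orbit G \<phi> s0 = {s0}"
    using orb[OF s0(1)] s0(2) by auto
  have "\<Union>(orbits G S \<phi>) = S"
    using orbit_refl orbS by (auto simp: orbits_def)
  then have "card S = sum card (orbits G S \<phi>)"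
    using card_Union_disjoint[OF dj fin_orb] by simp
  also have "\<dots> = card {s0} + sum card (orbits G S \<phi> - {{s0}})"
  proof (rule sum.remove)
    show "finite (orbits G S \<phi>)"
      using assms(4) by (auto simp: orbits_def)
    show "{s0} \<in> orbits G S \<phi>"
      using s0orb s0(1) by (auto simp: orbits_def)
  qed
  finally have "card S = 1 + sum card (orbits G S \<phi> - {{s0}})"
    by simp
  moreover have "p dvd sum card (orbits G S \<phi> - {{s0}})"
    by (rule dvd_sum) (use dvd s0orb in \<open>auto simp: orbits_def\<close>)
  ultimately have "p dvd 1"
    using assms(5) by (metis dvd_add_left_iff)
  then show False
    using assms(1) by (simp add: not_prime_1)
qed

end

text \<open>The group of order p generated by f acts on S by translations without fixed points, so S
  splits into blocks of size p. Multiples of f are iterated translations because the type offers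
  only addition.\<close>

lemma dvd_card_translation_closed:
  fixes f :: "'v::ab_group_add"
  assumes p: "prime p" and S: "finite S" "\<And>s. s \<in> S \<Longrightarrow> s + f \<in> S"
    and f: "f \<noteq> 0" and pf: "((+) f ^^ p) 0 = 0"
  shows "p dvd card S"
proof -
  have add: "((+) f ^^ i) s = ((+) f ^^ i) 0 + s" for i s
    by (induction i) (simp_all add: add.assoc)
  have add': "((+) f ^^ (i + j)) 0 = ((+) f ^^ i) 0 + ((+) f ^^ j) 0" for i j
    by (simp add: funpow_add add[of i "((+) f ^^ j) 0"])
  have mult: "((+) f ^^ (p * i)) 0 = 0" for i
    by (induction i) (simp_all add: add' pf)
  have modp: "((+) f ^^ (i mod p)) 0 = ((+) f ^^ i) 0" for i
    using add'[of "p * (i div p)" "i mod p"] mult by simp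
  interpret Z: group "integer_mod_group p"
    by (rule group_integer_mod_group)
  have p0: "p > 0"
    using p prime_gt_0_nat by blast
  define \<pi> where "\<pi> i s = ((+) f ^^ nat i) s" for i :: int and s
  have closed: "((+) f ^^ i) s \<in> S" if "s \<in> S" for i s
    using that by (induction i) (auto simp: add.commute[of f] S(2))
  have act: "acts_on (integer_mod_group p) S \<pi>"
    unfolding acts_on_def
  proof (intro conjI ballI)
    fix g h s assume *: "g \<in> carrier (integer_mod_group p)" "h \<in> carrier (integer_mod_group p)" "s \<in> S"
    then have "nat ((g + h) mod int p) = (nat g + nat h) mod p"
      using p0 by (auto simp: carrier_integer_mod_group nat_mod_distrib nat_add_distrib)
    then show "\<pi> (g \<otimes>\<^bsub>integer_mod_group p\<^esub> h) s = \<pi> g (\<pi> h s)"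
      using p0 * modp[of "nat g + nat h"] unfolding \<pi>_def mult_integer_mod_group
      by (simp add: add[of _ s] add[of _ "_ + _"] add' add.assoc)
  qed (auto simp: closed \<pi>_def)
  have ordp: "order (integer_mod_group p) = p"
    using p0 by (simp add: order_def carrier_integer_mod_group)
  have free: "h = \<one>\<^bsub>integer_mod_group p\<^esub>"
    if "h \<in> carrier (integer_mod_group p)" "x \<in> S" "\<pi> h x = x" for h x
  proof (rule ccontr)
    assume "h \<noteq> \<one>\<^bsub>integer_mod_group p\<^esub>"
    \<comment> \<open>A point fixed by one nontrivial element is fixed by all of Z/p, in particular
      by 1, that is by adding f once.\<close>
    then have "\<forall>i\<in>carrier (integer_mod_group p). \<pi> i x = x"
      using that p ordp Z.prime_order_fixed_or_free[OF _ act] by metis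
    moreover have "1 \<in> carrier (integer_mod_group p)"
      using prime_gt_1_nat[OF p] by (simp add: carrier_integer_mod_group)
    ultimately have "\<pi> 1 x = x"
      by blast
    then have "f + x = x"
      by (simp add: \<pi>_def)
    then show False
      using f by (metis add_cancel_left_left)
  qed
  obtain R where "bij_betw (\<lambda>(x, h). \<pi> h x) (R \<times> carrier (integer_mod_group p)) S"
    using Z.free_transversal[OF act] free by metis
  then have "card S = card R * p"
    using bij_betw_same_card ordp by (metis card_cartesian_product order_def)
  then show ?thesis
    by simp
qed

section \<open>Frames and summands of permutation modules\<close>

definition lin_map :: "('g, 'k::field, 'v::ab_group_add) kG_module \<Rightarrow>
    ('h, 'k, 'w::ab_group_add) kG_module \<Rightarrow> ('v \<Rightarrow> 'w) \<Rightarrow> bool" where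
  "lin_map M N f \<longleftrightarrow> (\<forall>v\<in>vspace M. f v \<in> vspace N) \<and>
     (\<forall>v\<in>vspace M. \<forall>w\<in>vspace M. f (v + w) = f v + f w) \<and>
     (\<forall>c. \<forall>v\<in>vspace M. f (scal M c v) = scal N c (f v))"

definition kG_map :: "('g, 'b) monoid_scheme \<Rightarrow> ('g, 'k::field, 'v::ab_group_add) kG_module \<Rightarrow>
    ('g, 'k, 'w::ab_group_add) kG_module \<Rightarrow> ('v \<Rightarrow> 'w) \<Rightarrow> bool" where
  "kG_map G M N f \<longleftrightarrow> lin_map M N f \<and>
     (\<forall>g\<in>carrier G. \<forall>v\<in>vspace M. f (act M g v) = act N g (f v))"

text \<open>A pair of dual families permuted by the group. Having one on X amounts to being a
  retract of the permutation module on X (\<open>frame_perm_module\<close>,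
  \<open>frame_retract'\<close>, \<open>retract_perm_module\<close>), but no second module or
  ambient type has to be carried along. The forms are constrained on \<open>vspace M\<close> only,
  since they are arbitrary functions outside.\<close>

definition frame :: "('g, 'b) monoid_scheme \<Rightarrow> ('g, 'k::field, 'v::ab_group_add) kG_module \<Rightarrow>
    'x set \<Rightarrow> ('g \<Rightarrow> 'x \<Rightarrow> 'x) \<Rightarrow> ('x \<Rightarrow> 'v) \<Rightarrow> ('x \<Rightarrow> 'v \<Rightarrow> 'k) \<Rightarrow> bool" where
  "frame G M X \<pi> m l \<longleftrightarrow> finite X \<and> acts_on G X \<pi> \<and>
     (\<forall>x\<in>X. m x \<in> vspace M \<and> l x \<in> linear_forms M) \<and>
     (\<forall>v\<in>vspace M. v = (\<Sum>x\<in>X. scal M (l x v) (m x))) \<and>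
     (\<forall>g\<in>carrier G. \<forall>x\<in>X. m (\<pi> g x) = act M g (m x) \<and>
        (\<forall>v\<in>vspace M. l (\<pi> g x) (act M g v) = l x v))"

lemma lin_mapD:
  assumes "lin_map M N f"
  shows "v \<in> vspace M \<Longrightarrow> f v \<in> vspace N"
    and "v \<in> vspace M \<Longrightarrow> w \<in> vspace M \<Longrightarrow> f (v + w) = f v + f w"
    and "v \<in> vspace M \<Longrightarrow> f (scal M c v) = scal N c (f v)"
  using assms by (auto simp: lin_map_def)

lemma kG_mapD:
  assumes "kG_map G M N f"
  shows "lin_map M N f"
    and "g \<in> carrier G \<Longrightarrow> v \<in> vspace M \<Longrightarrow> f (act M g v) = act N g (f v)"
  using assms by (auto simp: kG_map_def)

lemma linear_formsD:
  assumes "l \<in> linear_forms M"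
  shows "v \<in> vspace M \<Longrightarrow> w \<in> vspace M \<Longrightarrow> l (v + w) = l v + l w"
    and "v \<in> vspace M \<Longrightarrow> l (scal M c v) = c * l v"
  using assms by (auto simp: linear_forms_def)

lemma lin_map_compose: "lin_map M N f \<Longrightarrow> lin_map N L g \<Longrightarrow> lin_map M L (\<lambda>v. g (f v))"
  by (auto simp: lin_map_def)

lemma kG_map_compose: "kG_map G M N f \<Longrightarrow> kG_map G N L g \<Longrightarrow> kG_map G M L (\<lambda>v. g (f v))"
  by (auto simp: kG_map_def lin_map_def)

lemma linear_forms_compose: "lin_map M N f \<Longrightarrow> l \<in> linear_forms N \<Longrightarrow> (\<lambda>v. l (f v)) \<in> linear_forms M"
  by (auto simp: lin_map_def linear_forms_def)

lemma frameD:
  assumes "frame G M X \<pi> m l"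
  shows "finite X" and "acts_on G X \<pi>"
    and "x \<in> X \<Longrightarrow> m x \<in> vspace M" and "x \<in> X \<Longrightarrow> l x \<in> linear_forms M"
    and "v \<in> vspace M \<Longrightarrow> (\<Sum>x\<in>X. scal M (l x v) (m x)) = v"
    and "g \<in> carrier G \<Longrightarrow> x \<in> X \<Longrightarrow> m (\<pi> g x) = act M g (m x)"
    and "g \<in> carrier G \<Longrightarrow> x \<in> X \<Longrightarrow> v \<in> vspace M \<Longrightarrow> l (\<pi> g x) (act M g v) = l x v"
  using assms unfolding frame_def by auto

lemma frame_restrict:
  assumes "frame G M X \<pi> m l" "P \<subseteq> carrier G"
  shows "frame (G\<lparr>carrier := P\<rparr>) M X \<pi> m l"
  using assms acts_on_restrict[OF frameD(2)[OF assms(1)] assms(2)]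
  unfolding frame_def by (auto simp: subset_iff)

section \<open>Linear algebra inside one module\<close>

context kG_module
begin

lemma zero_closed: "0 \<in> vspace M"
  by (rule vs.subspace_0[OF subspace])

lemma add_closed: "v \<in> vspace M \<Longrightarrow> w \<in> vspace M \<Longrightarrow> v + w \<in> vspace M"
  by (rule vs.subspace_add[OF subspace])

lemma diff_closed: "v \<in> vspace M \<Longrightarrow> w \<in> vspace M \<Longrightarrow> v - w \<in> vspace M"
  by (rule vs.subspace_diff[OF subspace])

lemma scal_closed: "v \<in> vspace M \<Longrightarrow> scal M c v \<in> vspace M"
  by (rule vs.subspace_scale[OF subspace])

lemma sum_closed: "(\<And>x. x \<in> A \<Longrightarrow> f x \<in> vspace M) \<Longrightarrow> sum f A \<in> vspace M"
  by (rule vs.subspace_sum[OF subspace])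

lemmas closed = zero_closed add_closed scal_closed act_closed

lemma linear_form_zero: "l \<in> linear_forms M \<Longrightarrow> l 0 = 0"
  using linear_formsD(2)[of l M 0 0] zero_closed by simp

lemma linear_form_sum:
  assumes "l \<in> linear_forms M" "\<And>x. x \<in> A \<Longrightarrow> f x \<in> vspace M"
  shows "l (sum f A) = (\<Sum>x\<in>A. l (f x))"
  using assms(2)
  by (induction A rule: infinite_finite_induct)
     (auto simp: linear_form_zero assms(1) linear_formsD(1)[OF assms(1)] sum_closed)

lemma linear_form_diff:
  assumes "l \<in> linear_forms M" "v \<in> vspace M" "w \<in> vspace M"
  shows "l (v - w) = l v - l w"
  using linear_formsD(1)[OF assms(1), of "v - w" w] assms by (simp add: diff_closed)

lemma lin_map_zero:
  assumes "lin_map M N f" "vector_space (scal N)"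
  shows "f 0 = 0"
proof -
  interpret N: vector_space "scal N" by fact
  show ?thesis
    using lin_mapD(3)[OF assms(1), of 0 0] zero_closed by simp
qed

lemma lin_map_sum:
  assumes "lin_map M N f" "vector_space (scal N)" "\<And>x. x \<in> A \<Longrightarrow> h x \<in> vspace M"
  shows "f (sum h A) = (\<Sum>x\<in>A. f (h x))"
  using assms(3)
  by (induction A rule: infinite_finite_induct)
     (auto simp: lin_map_zero[OF assms(1,2)] lin_mapD(2)[OF assms(1)] sum_closed)

lemma lin_map_diff:
  assumes "lin_map M N f" "v \<in> vspace M" "w \<in> vspace M"
  shows "f (v - w) = f v - f w"
  using lin_mapD(2)[OF assms(1), of "v - w" w] assms by (simp add: diff_closed)

lemma vector_space_scal: "vector_space (scal M)"
  by unfold_locales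

lemma lin_map_act: "g \<in> carrier G \<Longrightarrow> lin_map M M (act M g)"
  by (auto simp: lin_map_def act_closed act_add act_scal)

lemmas act_zero = lin_map_zero[OF lin_map_act vector_space_scal]
lemmas act_sum = lin_map_sum[OF lin_map_act vector_space_scal]
lemmas act_diff = lin_map_diff[OF lin_map_act]

lemma act_inv:
  assumes "g \<in> carrier G" "v \<in> vspace M"
  shows "act M g (act M (inv g) v) = v" "act M (inv g) (act M g v) = v"
  using act_mult[of g "inv g" v] act_mult[of "inv g" g v] assms by (auto simp: act_one)

lemma kG_module_subspace:
  assumes "S \<subseteq> vspace M" "vs.subspace S" "\<And>g v. g \<in> carrier G \<Longrightarrow> v \<in> S \<Longrightarrow> act M g v \<in> S"
  shows "kG_module G (M\<lparr>vspace := S\<rparr>)"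
proof -
  have "kG_module_axioms G (M\<lparr>vspace := S\<rparr>)"
    using assms by unfold_locales
      (auto simp: subset_iff act_closed act_add act_scal act_one act_mult)
  then show ?thesis
    using vector_space_scal by (simp add: kG_module_def is_group)
qed

lemma submodule_kG_module:
  assumes "kG_submodule G W M"
  shows "kG_module G W"
  using assms kG_module_subspace unfolding kG_submodule_def by blast

lemma restrict_kG_module:
  assumes "subgroup P G"
  shows "kG_module (G\<lparr>carrier := P\<rparr>) M"
proof -
  interpret P: group "G\<lparr>carrier := P\<rparr>"
    by (rule subgroup.subgroup_is_group[OF assms is_group])
  show ?thesis
    using subgroup.subset[OF assms] subspace
    by unfold_locales (auto simp: subset_iff act_closed act_add act_scal act_one act_mult)
qed

end

lemma kG_submoduleD:
  assumes "kG_submodule G W M"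
  shows "vspace W \<subseteq> vspace M" "scal W = scal M" "act W = act M"
  using assms by (auto simp: kG_submodule_def)

lemma kG_map_inclusion: "kG_submodule G W M \<Longrightarrow> kG_map G W M (\<lambda>v. v)"
  by (auto simp: kG_map_def lin_map_def dest: kG_submoduleD)

lemma (in kG_module) direct_sum_projection:
  assumes "direct_sum G M W U"
  obtains e where "kG_map G M W e" "\<And>w. w \<in> vspace W \<Longrightarrow> e w = w"
    "\<And>v. v \<in> vspace M \<Longrightarrow> v - e v \<in> vspace U"
proof -
  have W: "kG_submodule G W M" and U: "kG_submodule G U M"
    and int: "vspace W \<inter> vspace U = {0}"
    and sum: "vspace M = {w + u | w u. w \<in> vspace W \<and> u \<in> vspace U}"
    using assms by (auto simp: direct_sum_def)
  interpret W: kG_module G W by (rule submodule_kG_module[OF W])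
  interpret U: kG_module G U by (rule submodule_kG_module[OF U])
  note eqs = kG_submoduleD[OF W] kG_submoduleD[OF U]
  define e where "e v = (THE w. w \<in> vspace W \<and> v - w \<in> vspace U)" for v
  have e: "e v = w" if "w \<in> vspace W" "v - w \<in> vspace U" for v w
    unfolding e_def
  proof (rule the_equality)
    fix w' assume w': "w' \<in> vspace W \<and> v - w' \<in> vspace U"
    then have "w' - w \<in> vspace W" "(v - w) - (v - w') \<in> vspace U"
      using that by (blast intro: W.diff_closed U.diff_closed)+
    moreover have "(v - w) - (v - w') = w' - w"
      by simp
    ultimately have "w' - w \<in> vspace W \<inter> vspace U"
      by simp
    then show "w' = w"
      using int by simp
  qed (use that in auto)
  have ex: "\<exists>w. w \<in> vspace W \<and> v - w \<in> vspace U" if "v \<in> vspace M" for v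
    using that sum by auto
  have eW: "e v \<in> vspace W" and eU: "v - e v \<in> vspace U" if "v \<in> vspace M" for v
    using ex[OF that] e by auto
  show thesis
  proof
    show "kG_map G M W e"
      unfolding kG_map_def lin_map_def
    proof (intro conjI ballI allI)
      fix v w c assume v: "v \<in> vspace M"
      show "e v \<in> vspace W"
        by (rule eW[OF v])
      show "e (scal M c v) = scal W c (e v)"
        using W.scal_closed[OF eW[OF v]] U.scal_closed[OF eU[OF v]]
        by (intro e) (auto simp: eqs vs.scale_right_diff_distrib)
      assume w: "w \<in> vspace M"
      show "e (v + w) = e v + e w"
        using W.add_closed[OF eW[OF v] eW[OF w]] U.add_closed[OF eU[OF v] eU[OF w]]
        by (intro e) (auto simp: algebra_simps)
    next
      fix g v assume g: "g \<in> carrier G" and v: "v \<in> vspace M"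
      show "e (act M g v) = act W g (e v)"
        using W.act_closed[OF g eW[OF v]] U.act_closed[OF g eU[OF v]] eW[OF v] g v
        by (intro e) (auto simp: eqs act_diff subsetD[OF eqs(1)])
    qed
    show "e w = w" if "w \<in> vspace W" for w
      using that U.zero_closed by (intro e) auto
    show "v - e v \<in> vspace U" if "v \<in> vspace M" for v
      by (rule eU[OF that])
  qed
qed

text \<open>Splitting maps stand for an isomorphism with a direct summand. They connect modules over
  different ambient types and compose directly.\<close>

definition retract :: "('g, 'b) monoid_scheme \<Rightarrow> ('g, 'k::field, 'v::ab_group_add) kG_module \<Rightarrow>
    ('g, 'k, 'w::ab_group_add) kG_module \<Rightarrow> ('v \<Rightarrow> 'w) \<Rightarrow> ('w \<Rightarrow> 'v) \<Rightarrow> bool" where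
  "retract G M N i r \<longleftrightarrow> kG_map G M N i \<and> kG_map G N M r \<and> (\<forall>v\<in>vspace M. r (i v) = v)"

lemma retract_direct_sum:
  assumes "kG_module G M" "direct_sum G M W U"
  shows "\<exists>e. retract G W M (\<lambda>v. v) e"
proof -
  interpret kG_module G M by fact
  obtain e where "kG_map G M W e" "\<And>w. w \<in> vspace W \<Longrightarrow> e w = w"
    using direct_sum_projection[OF assms(2)] by metis
  then show ?thesis
    using assms(2) kG_map_inclusion[of G W M] unfolding retract_def direct_sum_def by auto
qed

lemma retract_trans:
  assumes "retract G L M i r" "retract G M N j s"
  shows "retract G L N (\<lambda>v. j (i v)) (\<lambda>v. r (s v))"
  using assms unfolding retract_def by (auto intro: kG_map_compose simp: kG_map_def lin_map_def)

lemma retract_summand: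
  assumes "kG_module G M" "kG_module G N" "direct_summand G W N" "kG_iso G M W"
  shows "\<exists>i r. retract G M N i r"
proof -
  interpret M: kG_module G M by fact
  obtain U where U: "direct_sum G N W U"
    using assms(3) by (auto simp: direct_summand_def)
  obtain e where e: "retract G W N (\<lambda>v. v) e"
    using retract_direct_sum[OF assms(2) U] by blast
  obtain f where f: "bij_betw f (vspace M) (vspace W)"
    "\<forall>v\<in>vspace M. \<forall>w\<in>vspace M. f (v + w) = f v + f w"
    "\<forall>c. \<forall>v\<in>vspace M. f (scal M c v) = scal W c (f v)"
    "\<forall>g\<in>carrier G. \<forall>v\<in>vspace M. f (act M g v) = act W g (f v)"
    using assms(4) unfolding kG_iso_def by blast
  define h where "h = inv_into (vspace M) f"
  have fh: "h w \<in> vspace M" "f (h w) = w" if "w \<in> vspace W" for w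
    using f(1) that by (auto simp: h_def bij_betw_def inv_into_into f_inv_into_f)
  have hf: "h (f v) = v" "f v \<in> vspace W" if "v \<in> vspace M" for v
    using f(1) that by (auto simp: h_def bij_betw_def)
  have "kG_map G M W f"
    using f hf by (auto simp: kG_map_def lin_map_def)
  moreover have "kG_map G W M h"
    unfolding kG_map_def lin_map_def
  proof (intro conjI ballI allI)
    fix v assume v: "v \<in> vspace W"
    then show "h v \<in> vspace M"
      by (rule fh)
    show "h (scal W c v) = scal M c (h v)" for c
      using hf(1)[of "scal M c (h v)"] f(3) fh[OF v] by (simp add: M.scal_closed)
    show "h (v + w) = h v + h w" if "w \<in> vspace W" for w
      using hf(1)[of "h v + h w"] f(2) fh[OF v] fh[OF that] by (simp add: M.add_closed)
    show "h (act W g v) = act M g (h v)" if "g \<in> carrier G" for g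
      using hf(1)[of "act M g (h v)"] f(4) fh[OF v] that by (simp add: M.act_closed)
  qed
  ultimately have "retract G M W f h"
    using hf by (auto simp: retract_def)
  then show ?thesis
    using retract_trans e by blast
qed

text \<open>The image of i is the required summand: the idempotent i r splits N into it and the
  kernel of r.\<close>

lemma summand_retract:
  assumes "kG_module G M" "kG_module G N" "retract G M N i r"
  shows "\<exists>W. direct_summand G W N \<and> kG_iso G M W"
proof -
  interpret M: kG_module G M by fact
  interpret N: kG_module G N by fact
  have i: "kG_map G M N i" and r: "kG_map G N M r" and ri: "\<And>v. v \<in> vspace M \<Longrightarrow> r (i v) = v"
    using assms(3) by (auto simp: retract_def)
  note il = lin_mapD[OF kG_mapD(1)[OF i]] and rl = lin_mapD[OF kG_mapD(1)[OF r]]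
  note ig = kG_mapD(2)[OF i] and rg = kG_mapD(2)[OF r]
  have i0: "i 0 = 0" and r0: "r 0 = 0"
    using M.lin_map_zero[OF kG_mapD(1)[OF i] N.vector_space_scal]
      N.lin_map_zero[OF kG_mapD(1)[OF r] M.vector_space_scal] by auto
  define W where "W = N\<lparr>vspace := i ` vspace M\<rparr>"
  define U where "U = N\<lparr>vspace := {u\<in>vspace N. r u = 0}\<rparr>"
  have "kG_submodule G W N"
    unfolding kG_submodule_def
  proof (intro exI conjI ballI)
    show "W = N\<lparr>vspace := i ` vspace M\<rparr>"
      by (simp add: W_def)
    show "i ` vspace M \<subseteq> vspace N"
      using il by auto
    show "N.vs.subspace (i ` vspace M)"
    proof (rule N.vs.subspaceI)
      show "0 \<in> i ` vspace M"
        using i0 M.zero_closed by (metis image_eqI)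
      fix x y c assume "x \<in> i ` vspace M"
      then obtain v where v: "x = i v" "v \<in> vspace M" by blast
      show "scal N c x \<in> i ` vspace M"
        using v il(3)[of v c] M.scal_closed by (metis image_eqI)
      assume "y \<in> i ` vspace M"
      then obtain w where w: "y = i w" "w \<in> vspace M" by blast
      show "x + y \<in> i ` vspace M"
        using v w il(2)[of v w] M.add_closed by (metis image_eqI)
    qed
    show "act N g v \<in> i ` vspace M" if "g \<in> carrier G" "v \<in> i ` vspace M" for g v
      using that ig M.act_closed by (auto simp flip: ig)
  qed
  moreover have "kG_submodule G U N"
    unfolding kG_submodule_def
  proof (intro exI conjI ballI)
    show "U = N\<lparr>vspace := {u\<in>vspace N. r u = 0}\<rparr>"
      by (simp add: U_def)
    show "N.vs.subspace {u\<in>vspace N. r u = 0}"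
      by (rule N.vs.subspaceI) (auto simp: N.closed r0 rl)
  qed (auto simp: rg M.act_zero N.act_closed)
  moreover have "vspace W \<inter> vspace U = {0}"
    using ri i0 r0 M.zero_closed N.zero_closed by (force simp: W_def U_def)
  moreover have "vspace N = {w + u | w u. w \<in> vspace W \<and> u \<in> vspace U}"
  proof (intro equalityI subsetI)
    fix x assume x: "x \<in> vspace N"
    have "r (x - i (r x)) = 0"
      using x by (simp add: N.lin_map_diff[OF kG_mapD(1)[OF r]] ri rl il)
    then have "i (r x) \<in> vspace W" "x - i (r x) \<in> vspace U" "x = i (r x) + (x - i (r x))"
      using x by (auto simp: W_def U_def rl il N.diff_closed)
    then show "x \<in> {w + u | w u. w \<in> vspace W \<and> u \<in> vspace U}"
      by blast
  qed (auto simp: W_def U_def il N.add_closed)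
  ultimately have "direct_sum G N W U"
    by (simp add: direct_sum_def)
  moreover have "bij_betw i (vspace M) (vspace W)"
    unfolding bij_betw_def W_def using ri by (auto intro: inj_on_inverseI)
  then have "kG_iso G M W"
    unfolding kG_iso_def using il ig by (intro exI[of _ i]) (auto simp: W_def)
  ultimately show ?thesis
    unfolding direct_summand_def by blast
qed

text \<open>Vectors are pushed forward along r and forms pulled back along i, while the index set
  and its action stay the same. Allowing a frame for a subgroup H is how frames for subgroups of
  order p reach the core with the same number of fixed points.\<close>

lemma frame_retract:
  assumes M: "kG_module G M" and N: "kG_module G N" and "retract G M N i r" "H \<subseteq> carrier G"
    and fr: "frame (G\<lparr>carrier := H\<rparr>) N X \<pi> m l"
  shows "frame (G\<lparr>carrier := H\<rparr>) M X \<pi> (\<lambda>x. r (m x)) (\<lambda>x v. l x (i v))"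
proof -
  interpret M: kG_module G M by fact
  interpret N: kG_module G N by fact
  have i: "kG_map G M N i" and r: "kG_map G N M r" and ri: "\<And>v. v \<in> vspace M \<Longrightarrow> r (i v) = v"
    using assms(3) by (auto simp: retract_def)
  note il = lin_mapD[OF kG_mapD(1)[OF i]] and rl = lin_mapD[OF kG_mapD(1)[OF r]]
  note ig = kG_mapD(2)[OF i] and rg = kG_mapD(2)[OF r]
  have "(\<Sum>x\<in>X. scal M (l x (i v)) (r (m x))) = v" if v: "v \<in> vspace M" for v
  proof -
    have "r (i v) = r (\<Sum>x\<in>X. scal N (l x (i v)) (m x))"
      using frameD(5)[OF fr il(1)[OF v]] by simp
    also have "\<dots> = (\<Sum>x\<in>X. scal M (l x (i v)) (r (m x)))"
      using frameD(3)[OF fr]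
      by (subst N.lin_map_sum[OF kG_mapD(1)[OF r] M.vector_space_scal]) (auto simp: N.scal_closed rl)
    finally show ?thesis
      using ri[OF v] by simp
  qed
  then show ?thesis
    using fr \<open>H \<subseteq> carrier G\<close> unfolding frame_def
    by (auto simp: rl ig rg il subset_iff intro: linear_forms_compose[OF kG_mapD(1)[OF i]])
qed

lemma frame_retract':
  assumes "kG_module G M" "kG_module G N" "retract G M N i r" "frame G N X \<pi> m l"
  shows "frame G M X \<pi> (\<lambda>x. r (m x)) (\<lambda>x v. l x (i v))"
  using frame_retract[of G M N i r "carrier G" X \<pi> m l] assms by simp

lemma sum_apply: "(\<Sum>x\<in>A. f x) y = (\<Sum>x\<in>A. f x y)"
  by (induction A rule: infinite_finite_induct) auto

section \<open>Permutation modules and their retracts\<close>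

lemma (in group) kG_module_perm_module:
  assumes "acts_on G X \<pi>"
  shows "kG_module G (perm_module G X \<pi> :: ('a, 'k::field, 'x \<Rightarrow> 'k) kG_module)"
proof -
  interpret vector_space "\<lambda>(c::'k) f (x::'x). c * f x"
    by unfold_locales (auto simp: algebra_simps)
  have inv: "\<pi> (inv g) x \<in> X" "\<pi> (inv (g \<otimes> h)) x = \<pi> (inv h) (\<pi> (inv g) x)"
    if "g \<in> carrier G" "h \<in> carrier G" "x \<in> X" for g h x
    using that assms by (auto simp: acts_on_closed acts_on_mult inv_mult_group)
  let ?M = "perm_module G X \<pi> :: ('a, 'k, 'x \<Rightarrow> 'k) kG_module"
  have "kG_module_axioms G ?M"
  proof
    show "module.subspace (scal ?M) (vspace ?M)"
      by (simp add: perm_module_def subspace_def)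
    fix g and v :: "'x \<Rightarrow> 'k" assume g: "g \<in> carrier G"
    show "act ?M g v \<in> vspace ?M"
      by (simp add: perm_module_def)
    show "act ?M g (v + w) = act ?M g v + act ?M g w" for w
      by (simp add: perm_module_def fun_eq_iff)
    show "act ?M g (scal ?M c v) = scal ?M c (act ?M g v)" for c
      by (simp add: perm_module_def fun_eq_iff)
    show "act ?M (g \<otimes> h) v = act ?M g (act ?M h v)" if "h \<in> carrier G" for h
      using g that by (simp add: perm_module_def fun_eq_iff inv)
  next
    fix v assume "v \<in> vspace ?M"
    then show "act ?M \<one> v = v"
      using assms by (simp add: perm_module_def fun_eq_iff acts_on_one)
  qed
  moreover have "vector_space (scal ?M)"
    using vector_space_axioms by (simp add: perm_module_def)
  ultimately show ?thesis
    by (simp add: kG_module_def is_group)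
qed

lemma (in group) frame_perm_module:
  assumes "acts_on G X \<pi>" "finite X"
  shows "frame G (perm_module G X \<pi> :: ('a, 'k::field, 'x \<Rightarrow> 'k) kG_module) X \<pi>
    (\<lambda>x y. if y = x then 1 else 0) (\<lambda>x v. v x)"
  unfolding frame_def
proof (intro conjI ballI)
  fix g x assume *: "g \<in> carrier G" "x \<in> X"
  have "\<pi> (inv g) y = x \<longleftrightarrow> y = \<pi> g x" if "y \<in> X" for y
    using acts_on_inv[OF assms(1) *(1)] that * by auto
  then show "(\<lambda>y. if y = \<pi> g x then 1 else 0) =
      act (perm_module G X \<pi> :: ('a, 'k::field, 'x \<Rightarrow> 'k) kG_module) g (\<lambda>y. if y = x then 1 else 0)"
    using * assms(1) by (auto simp: perm_module_def fun_eq_iff acts_on_closed)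
  show "act (perm_module G X \<pi>) g v (\<pi> g x) = v x" for v :: "'x \<Rightarrow> 'k"
    using * assms(1) by (auto simp: perm_module_def acts_on_inv acts_on_closed)
next
  fix v assume "v \<in> vspace (perm_module G X \<pi> :: ('a, 'k::field, 'x \<Rightarrow> 'k) kG_module)"
  then show "v = (\<Sum>x\<in>X. scal (perm_module G X \<pi>) (v x) (\<lambda>y. if y = x then 1 else 0))"
    using assms(2) by (auto simp: perm_module_def fun_eq_iff sum_apply if_distrib cong: if_cong)
qed (use assms in \<open>auto simp: perm_module_def linear_forms_def\<close>)

text \<open>The forms are the coordinates of an embedding into the permutation module, and the frame
  identity says that recombining the vectors m x is a left inverse.\<close>

lemma retract_perm_module:
  fixes M :: "('g, 'k::field, 'v::ab_group_add) kG_module" and X :: "'x set"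
  assumes M: "kG_module G M" and fr: "frame G M X \<pi> m l"
  shows "retract G M (perm_module G X \<pi>) (\<lambda>v x. if x \<in> X then l x v else 0)
    (\<lambda>f. \<Sum>x\<in>X. scal M (f x) (m x))"
proof -
  interpret M: kG_module G M by fact
  note F = frameD[OF fr]
  show ?thesis
    unfolding retract_def kG_map_def lin_map_def
  proof (intro conjI ballI allI)
    fix g v assume *: "g \<in> carrier G" "v \<in> vspace M"
    have "l x (act M g v) = l (\<pi> (inv\<^bsub>G\<^esub> g) x) v" if "x \<in> X" for x
      using F(7)[of g "\<pi> (inv\<^bsub>G\<^esub> g) x" v] * that F(2) by (simp add: M.acts_on_inv acts_on_closed)
    then show "(\<lambda>x. if x \<in> X then l x (act M g v) else 0) =
       act (perm_module G X \<pi>) g (\<lambda>x. if x \<in> X then l x v else 0)"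
      using * F(2) by (auto simp: perm_module_def acts_on_closed)
  next
    fix g and f :: "'x \<Rightarrow> 'k" assume *: "g \<in> carrier G"
    have "(\<Sum>x\<in>X. scal M (act (perm_module G X \<pi>) g f x) (m x)) =
        (\<Sum>x\<in>X. scal M (f (\<pi> (inv\<^bsub>G\<^esub> g) x)) (m x))"
      by (intro sum.cong) (auto simp: perm_module_def)
    also have "\<dots> = (\<Sum>x\<in>X. scal M (f x) (m (\<pi> g x)))"
      using sum.reindex_bij_betw[OF M.acts_on_bij_betw[OF F(2) *], symmetric,
          of "\<lambda>x. scal M (f (\<pi> (inv\<^bsub>G\<^esub> g) x)) (m x)"] * F(2)
      by (simp add: M.acts_on_inv)
    also have "\<dots> = act M g (\<Sum>x\<in>X. scal M (f x) (m x))"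
      using F * by (simp add: M.act_sum M.scal_closed M.act_scal)
    finally show "(\<Sum>x\<in>X. scal M (act (perm_module G X \<pi>) g f x) (m x)) =
        act M g (\<Sum>x\<in>X. scal M (f x) (m x))" .
  next
    fix v assume "v \<in> vspace M"
    then show "(\<Sum>x\<in>X. scal M (if x \<in> X then l x v else 0) (m x)) = v"
      using F(5)[of v] by simp
  qed (use F in \<open>auto simp: perm_module_def linear_formsD(1)[OF F(4)] linear_formsD(2)[OF F(4)] M.vs.scale_left_distrib sum.distrib
        M.vs.scale_sum_right fun_eq_iff intro!: M.sum_closed M.scal_closed\<close>)
qed

section \<open>Projective modules in terms of frames\<close>

definition free_act :: "('g, 'b) monoid_scheme \<Rightarrow> 'g \<Rightarrow> nat \<times> 'g \<Rightarrow> nat \<times> 'g" where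
  "free_act G = (\<lambda>g (i, h). (i, g \<otimes>\<^bsub>G\<^esub> h))"

lemma (in group) acts_on_free_act: "acts_on G ({..<n} \<times> carrier G) (free_act G)"
  by (auto simp: acts_on_def free_act_def m_assoc)

text \<open>Projective modules are the retracts of permutation modules on free G-sets, so they are
  captured by frames as well. From here on, proving projectivity means writing down a frame.\<close>

lemma projective_iff_frame:
  assumes "finite (carrier G)"
  shows "projective G M \<longleftrightarrow>
    kG_module G M \<and> (\<exists>n m l. frame G M ({..<n} \<times> carrier G) (free_act G) m l)"
proof (cases "kG_module G M")
  case True
  then interpret M: kG_module G M .
  have fm: "free_module G n = perm_module G ({..<n} \<times> carrier G) (free_act G)" for n
    by (simp add: free_module_def free_act_def)
  have kf: "kG_module G (free_module G n :: ('a, 'c, nat \<times> 'a \<Rightarrow> 'c) kG_module)" for n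
    unfolding fm by (rule M.kG_module_perm_module[OF M.acts_on_free_act])
  show ?thesis
  proof
    assume "projective G M"
    then obtain n W where "direct_summand G W (free_module G n)" "kG_iso G M W"
      by (auto simp: projective_def)
    then obtain i r where "retract G M (free_module G n) i r"
      using retract_summand[OF True kf] by blast
    moreover have "finite ({..<n} \<times> carrier G)"
      using assms by simp
    ultimately show "kG_module G M \<and> (\<exists>n m l. frame G M ({..<n} \<times> carrier G) (free_act G) m l)"
      using frame_retract'[OF True kf _ M.frame_perm_module[OF M.acts_on_free_act, folded fm]] True
      by blast
  next
    assume "kG_module G M \<and> (\<exists>n m l. frame G M ({..<n} \<times> carrier G) (free_act G) m l)"
    then obtain n m l where "frame G M ({..<n} \<times> carrier G) (free_act G) m l"
      by blast
    from summand_retract[OF True kf[unfolded fm] retract_perm_module[OF True this]]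
    show "projective G M"
      using True by (auto simp: projective_def fm)
  qed
qed (auto simp: projective_def)

lemma frame_trivial_source:
  assumes "trivial_source G M"
  shows "\<exists>(X :: nat set) \<pi> m l. frame G M X \<pi> m l"
proof -
  obtain X :: "nat set" and \<phi> W where *: "kG_module G M" "finite X" "group_action G X \<phi>"
    "direct_summand G W (perm_module G X \<phi> :: (_, _, nat \<Rightarrow> _) kG_module)" "kG_iso G M W"
    using assms unfolding trivial_source_def by blast
  interpret M: kG_module G M by fact
  interpret group_action G X \<phi> by fact
  have act: "acts_on G X \<phi>"
    unfolding acts_on_def
  proof (intro conjI ballI)
    show "\<phi> \<one>\<^bsub>G\<^esub> x = x" if "x \<in> X" for x
      using id_eq_one that by (metis restrict_apply')
    show "\<phi> h x \<in> X" if "h \<in> carrier G" "x \<in> X" for h x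
      using element_image[OF that refl] .
    show "\<phi> (g \<otimes>\<^bsub>G\<^esub> h) x = \<phi> g (\<phi> h x)" if "g \<in> carrier G" "h \<in> carrier G" "x \<in> X" for g h x
      using that by (intro composition_rule)
  qed
  show ?thesis
    using retract_summand[OF *(1) M.kG_module_perm_module[OF act] *(4,5)]
      frame_retract'[OF *(1) M.kG_module_perm_module[OF act] _ M.frame_perm_module[OF act *(2)]]
    by blast
qed

section \<open>Frames of tensor powers\<close>

definition fixed_points :: "('h, 'c) monoid_scheme \<Rightarrow> 'x set \<Rightarrow> ('h \<Rightarrow> 'x \<Rightarrow> 'x) \<Rightarrow> 'x set" where
  "fixed_points H X \<pi> = {x\<in>X. \<forall>h\<in>carrier H. \<pi> h x = x}"

definition words :: "'x set \<Rightarrow> nat \<Rightarrow> 'x list set" where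
  "words X m = {xs. length xs = m \<and> set xs \<subseteq> X}"

lemma words_eq: "words X m = {xs. set xs \<subseteq> X \<and> length xs = m}"
  by (auto simp: words_def)

lemma finite_words: "finite X \<Longrightarrow> finite (words X m)"
  unfolding words_eq by (rule finite_lists_length_eq)

lemma card_words: "finite X \<Longrightarrow> card (words X m) = card X ^ m"
  unfolding words_eq by (rule card_lists_length_eq)

lemma words_Suc: "bij_betw (\<lambda>(x, xs). x # xs) (X \<times> words X m) (words X (Suc m))"
  by (intro bij_betw_byWitness[where f' = "\<lambda>xs. (hd xs, tl xs)"])
     (auto simp: words_def length_Suc_conv)

lemma prod_sum_words:
  fixes f :: "nat \<Rightarrow> 'x \<Rightarrow> 'k::comm_semiring_1"
  shows "(\<Prod>i<m. \<Sum>x\<in>X. f i x) = (\<Sum>xs\<in>words X m. \<Prod>i<m. f i (xs ! i))"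
proof (induction m arbitrary: f)
  case 0
  have "words X 0 = {[]}"
    by (auto simp: words_def)
  then show ?case
    by simp
next
  case (Suc m)
  have "(\<Prod>i<Suc m. \<Sum>x\<in>X. f i x) = (\<Sum>x\<in>X. f 0 x) * (\<Sum>xs\<in>words X m. \<Prod>i<m. f (Suc i) (xs ! i))"
    by (simp add: prod.lessThan_Suc_shift Suc.IH del: prod.lessThan_Suc)
  also have "\<dots> = (\<Sum>(x, xs)\<in>X \<times> words X m. f 0 x * (\<Prod>i<m. f (Suc i) (xs ! i)))"
    by (simp add: sum_product sum.cartesian_product)
  also have "\<dots> = (\<Sum>(x, xs)\<in>X \<times> words X m. \<Prod>i<Suc m. f i ((x # xs) ! i))"
    by (simp add: prod.lessThan_Suc_shift del: prod.lessThan_Suc)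
  also have "\<dots> = (\<Sum>xs\<in>words X (Suc m). \<Prod>i<Suc m. f i (xs ! i))"
    by (subst sum.reindex_bij_betw[OF words_Suc, symmetric]) (simp add: case_prod_unfold)
  finally show ?case .
qed

lemma acts_on_words:
  assumes "acts_on G X \<pi>"
  shows "acts_on G (words X m) (\<lambda>g. map (\<pi> g))"
  using assms unfolding acts_on_def words_def
  by (auto simp: subset_iff intro!: map_idI)

text \<open>This is where the exact power in the count of fixed points of a tensor power comes
  from.\<close>

lemma fixed_points_words:
  "fixed_points H (words X m) (\<lambda>h. map (\<pi> h)) = words (fixed_points H X \<pi>) m"
  unfolding fixed_points_def words_def by (auto simp: subset_iff map_idI) (metis map_eq_conv map_ident)

section \<open>Module structure and frames of tensor powers\<close>

context kG_module
begin

abbreviation (input) "tp \<equiv> tensor_power M"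

sublocale tensor: vector_space "\<lambda>(c :: 'k) (t :: ('v \<Rightarrow> 'k) list \<Rightarrow> 'k) \<phi>s. c * t \<phi>s"
  by unfold_locales (auto simp: algebra_simps)

lemma tensor_power_eqs:
  "scal (tp m) = (\<lambda>c t \<phi>s. c * t \<phi>s)"
  "act (tp m) = (\<lambda>g t \<phi>s. t (map (\<lambda>\<phi>. \<phi> \<circ> act M g) \<phi>s))"
  "vspace (tp m) = tensor.span (pure_tensor M ` words (vspace M) m)"
  by (auto simp: tensor_power_def words_def)

lemma pure_tensor_closed: "vs \<in> words (vspace M) m \<Longrightarrow> pure_tensor M vs \<in> vspace (tp m)"
  unfolding tensor_power_eqs by (intro tensor.span_base) auto

text \<open>Linear identities between tensors hold on a subspace, so checking pure tensors is
  enough.\<close>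

lemma tensor_power_induct:
  assumes "t \<in> vspace (tp m)" "tensor.subspace S"
    and "\<And>vs. vs \<in> words (vspace M) m \<Longrightarrow> pure_tensor M vs \<in> S"
  shows "t \<in> S"
proof -
  have "vspace (tp m) \<subseteq> S"
    unfolding tensor_power_eqs by (rule tensor.span_minimal) (use assms in auto)
  then show ?thesis
    using assms(1) by blast
qed

lemma kG_module_tensor_power: "kG_module G (tp m)"
proof -
  have "kG_module_axioms G (tp m)"
  proof
    show "module.subspace (scal (tp m)) (vspace (tp m))"
      by (simp add: tensor_power_eqs)
    fix g t assume g: "g \<in> carrier G" and t: "t \<in> vspace (tp m)"
    show "act (tp m) g t \<in> vspace (tp m)"
    proof -
      have "t \<in> {t. act (tp m) g t \<in> vspace (tp m)}"
      proof (rule tensor_power_induct[OF t])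
        show "tensor.subspace {t. act (tp m) g t \<in> vspace (tp m)}"
        proof (rule tensor.subspaceI)
          have "act (tp m) g 0 = 0"
            by (simp add: tensor_power_eqs fun_eq_iff)
          then show "0 \<in> {t. act (tp m) g t \<in> vspace (tp m)}"
            by (simp add: tensor_power_eqs tensor.span_zero)
          fix s u c
          assume s: "s \<in> {t. act (tp m) g t \<in> vspace (tp m)}"
          have "act (tp m) g (\<lambda>\<phi>s. c * s \<phi>s) = (\<lambda>\<phi>s. c * act (tp m) g s \<phi>s)"
            by (simp add: tensor_power_eqs)
          then show "(\<lambda>\<phi>s. c * s \<phi>s) \<in> {t. act (tp m) g t \<in> vspace (tp m)}"
            using s tensor.span_scale[of "act (tp m) g s" _ c] by (simp add: tensor_power_eqs(3))
          assume u: "u \<in> {t. act (tp m) g t \<in> vspace (tp m)}"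
          have "act (tp m) g (s + u) = act (tp m) g s + act (tp m) g u"
            by (simp add: tensor_power_eqs fun_eq_iff)
          then show "s + u \<in> {t. act (tp m) g t \<in> vspace (tp m)}"
            using s u tensor.span_add by (simp add: tensor_power_eqs(3))
        qed
        fix vs assume "vs \<in> words (vspace M) m"
        then have "map (act M g) vs \<in> words (vspace M) m"
          using g by (auto simp: words_def act_closed subset_iff)
        then show "pure_tensor M vs \<in> {t. act (tp m) g t \<in> vspace (tp m)}"
          using pure_tensor_closed by (simp add: tensor_power_act_pure[OF g])
      qed
      then show ?thesis by simp
    qed
    show "act (tp m) g (t + u) = act (tp m) g t + act (tp m) g u" for u
      by (simp add: tensor_power_eqs fun_eq_iff)
    show "act (tp m) g (scal (tp m) c t) = scal (tp m) c (act (tp m) g t)" for c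
      by (simp add: tensor_power_eqs fun_eq_iff)
    \<comment> \<open>The two sides may differ for an arbitrary function t: \<open>act_mult\<close>
      holds only on \<open>vspace M\<close>, so the composed forms can differ outside it. Pure
      tensors evaluate forms on \<open>vspace M\<close> only.\<close>
    show "act (tp m) (g \<otimes> h) t = act (tp m) g (act (tp m) h t)" if h: "h \<in> carrier G" for h
    proof -
      have "t \<in> {t. act (tp m) (g \<otimes> h) t = act (tp m) g (act (tp m) h t)}"
      proof (rule tensor_power_induct[OF t])
        show "tensor.subspace {t. act (tp m) (g \<otimes> h) t = act (tp m) g (act (tp m) h t)}"
          by (rule tensor.subspaceI) (auto simp: tensor_power_eqs fun_eq_iff)
        fix vs assume "vs \<in> words (vspace M) m"
        then have "map (act M (g \<otimes> h)) vs = map (act M g) (map (act M h) vs)"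
          using g h by (auto simp: words_def subset_iff act_mult)
        then show "pure_tensor M vs \<in> {t. act (tp m) (g \<otimes> h) t = act (tp m) g (act (tp m) h t)}"
          using g h by (simp add: tensor_power_act_pure del: map_map)
      qed
      then show ?thesis by simp
    qed
  next
    fix t assume t: "t \<in> vspace (tp m)"
    have "t \<in> {t. act (tp m) \<one> t = t}"
    proof (rule tensor_power_induct[OF t])
      show "tensor.subspace {t. act (tp m) \<one> t = t}"
        by (rule tensor.subspaceI) (auto simp: tensor_power_eqs fun_eq_iff)
      fix vs assume "vs \<in> words (vspace M) m"
      then have "map (act M \<one>) vs = vs"
        by (intro map_idI) (auto simp: words_def subset_iff act_one)
      then show "pure_tensor M vs \<in> {t. act (tp m) \<one> t = t}"
        by (simp add: tensor_power_act_pure)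
    qed
    then show "act (tp m) \<one> t = t" by simp
  qed
  moreover have "vector_space (scal (tp m))"
    unfolding tensor_power_eqs by (rule tensor.vector_space_axioms)
  ultimately show ?thesis
    by (simp add: kG_module_def is_group)
qed

text \<open>Expand every factor of a pure tensor in the frame and distribute the product of sums
  over words. In this model of the tensor power the product of the forms l x is evaluation at the
  list of these forms.\<close>

lemma frame_tensor_power:
  assumes fr: "frame G M X \<pi> b l"
  shows "frame G (tp m) (words X m) (\<lambda>g. map (\<pi> g)) (\<lambda>xs. pure_tensor M (map b xs))
    (\<lambda>xs t. t (map l xs))"
proof -
  note F = frameD[OF fr]
  have lin: "map l xs \<in> words (linear_forms M) m" if "xs \<in> words X m" for xs
    using that F(4) by (auto simp: words_def)
  have bV: "map b xs \<in> words (vspace M) m" if "xs \<in> words X m" for xs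
    using that F(3) by (auto simp: words_def)
  have pure: "pure_tensor M vs = (\<Sum>xs\<in>words X m. (\<lambda>\<phi>s. pure_tensor M vs (map l xs) * pure_tensor M (map b xs) \<phi>s))"
    if vs: "vs \<in> words (vspace M) m" for vs
  proof
    fix \<phi>s
    show "pure_tensor M vs \<phi>s =
      (\<Sum>xs\<in>words X m. (\<lambda>\<phi>s. pure_tensor M vs (map l xs) * pure_tensor M (map b xs) \<phi>s)) \<phi>s"
    proof (cases "\<phi>s \<in> words (linear_forms M) m")
      case True
      have "(\<phi>s ! i) (vs ! i) = (\<Sum>x\<in>X. l x (vs ! i) * (\<phi>s ! i) (b x))" if "i < m" for i
      proof -
        have v: "vs ! i \<in> vspace M" and phi: "\<phi>s ! i \<in> linear_forms M"
          using that vs True by (auto simp: words_def)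
        have "(\<phi>s ! i) (vs ! i) = (\<phi>s ! i) (\<Sum>x\<in>X. scal M (l x (vs ! i)) (b x))"
          using F(5)[OF v] by simp
        also have "\<dots> = (\<Sum>x\<in>X. l x (vs ! i) * (\<phi>s ! i) (b x))"
          using F(3) phi by (subst linear_form_sum) (auto simp: scal_closed linear_formsD)
        finally show ?thesis .
      qed
      then have "(\<Prod>i<m. (\<phi>s ! i) (vs ! i)) = (\<Prod>i<m. \<Sum>x\<in>X. l x (vs ! i) * (\<phi>s ! i) (b x))"
        by simp
      also have "\<dots> = (\<Sum>xs\<in>words X m. \<Prod>i<m. l (xs ! i) (vs ! i) * (\<phi>s ! i) (b (xs ! i)))"
        by (rule prod_sum_words)
      also have "\<dots> = (\<Sum>xs\<in>words X m. pure_tensor M vs (map l xs) * pure_tensor M (map b xs) \<phi>s)"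
      proof (rule sum.cong)
        fix xs assume xs: "xs \<in> words X m"
        then show "(\<Prod>i<m. l (xs ! i) (vs ! i) * (\<phi>s ! i) (b (xs ! i))) =
            pure_tensor M vs (map l xs) * pure_tensor M (map b xs) \<phi>s"
          using lin[OF xs] True vs by (auto simp: words_def pure_tensor_def prod.distrib)
      qed simp
      finally show ?thesis
        using True vs by (simp add: pure_tensor_def words_def sum_apply)
    next
      \<comment> \<open>Away from lists of m linear forms both sides are 0 by the default value in
        \<open>pure_tensor\<close>.\<close>
      case False
      then have "pure_tensor M ws \<phi>s = 0" if "length ws = m" for ws
        using that by (auto simp: pure_tensor_def words_def)
      then show ?thesis
        using vs by (simp add: sum_apply words_def)
    qed
  qed
  show ?thesis
    unfolding frame_def
  proof (intro conjI ballI)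
    show "finite (words X m)" "acts_on G (words X m) (\<lambda>g. map (\<pi> g))"
      using F by (auto intro: finite_words acts_on_words)
    fix xs assume xs: "xs \<in> words X m"
    show "pure_tensor M (map b xs) \<in> vspace (tp m)"
      by (rule pure_tensor_closed[OF bV[OF xs]])
    show "(\<lambda>t. t (map l xs)) \<in> linear_forms (tp m)"
      by (simp add: linear_forms_def tensor_power_eqs)
    fix g assume g: "g \<in> carrier G"
    have "map b (map (\<pi> g) xs) = map (act M g) (map b xs)"
      using xs g F(6) by (auto simp: words_def subset_iff)
    then show "pure_tensor M (map b (map (\<pi> g) xs)) = act (tp m) g (pure_tensor M (map b xs))"
      by (simp only: tensor_power_act_pure[OF g])
    fix t assume t: "t \<in> vspace (tp m)"
    have "t \<in> {t. act (tp m) g t (map l (map (\<pi> g) xs)) = t (map l xs)}"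
    proof (rule tensor_power_induct[OF t])
      show "tensor.subspace {t. act (tp m) g t (map l (map (\<pi> g) xs)) = t (map l xs)}"
        by (rule tensor.subspaceI) (auto simp: tensor_power_eqs)
      fix vs assume vs: "vs \<in> words (vspace M) m"
      have "map (\<pi> g) xs \<in> words X m"
        using xs g F(2) by (auto simp: words_def acts_on_closed subset_iff)
      then have "map l (map (\<pi> g) xs) \<in> words (linear_forms M) m"
        by (rule lin)
      moreover have "l (\<pi> g (xs ! i)) (act M g (vs ! i)) = l (xs ! i) (vs ! i)" if "i < m" for i
        using that vs xs g by (intro F(7)) (auto simp: words_def)
      ultimately show "pure_tensor M vs \<in> {t. act (tp m) g t (map l (map (\<pi> g) xs)) = t (map l xs)}"
        using lin[OF xs] xs vs
        by (simp add: tensor_power_act_pure[OF g]) (auto simp: pure_tensor_def words_def intro!: prod.cong)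
    qed
    then show "act (tp m) g t (map l (map (\<pi> g) xs)) = t (map l xs)"
      by simp
  next
    fix t assume t: "t \<in> vspace (tp m)"
    \<comment> \<open>\<open>r\<close> is the operator defined by the frame. It is linear, so the
      tensors it fixes form a subspace, and \<open>pure\<close> puts the pure tensors into
      it.\<close>
    define r where "r t = (\<lambda>\<phi>s. \<Sum>xs\<in>words X m. t (map l xs) * pure_tensor M (map b xs) \<phi>s)"
      for t :: "('v \<Rightarrow> 'k) list \<Rightarrow> 'k"
    have "t \<in> {t. r t = t}"
    proof (rule tensor_power_induct[OF t])
      show "tensor.subspace {t. r t = t}"
      proof (rule tensor.subspaceI; clarsimp)
        show "r 0 = 0"
          by (simp add: r_def fun_eq_iff)
        fix s c assume s: "r s = s"
        have "r (\<lambda>\<phi>s. c * s \<phi>s) = (\<lambda>\<phi>s. c * r s \<phi>s)"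
          by (simp add: r_def sum_distrib_left mult.assoc)
        then show "r (\<lambda>\<phi>s. c * s \<phi>s) = (\<lambda>\<phi>s. c * s \<phi>s)"
          by (simp only: s)
        fix u assume u: "r u = u"
        have "r (s + u) = r s + r u"
          by (simp add: r_def fun_eq_iff distrib_right sum.distrib)
        then show "r (s + u) = s + u"
          by (simp only: s u)
      qed
      show "pure_tensor M vs \<in> {t. r t = t}" if "vs \<in> words (vspace M) m" for vs
      proof -
        have "r (pure_tensor M vs) = (\<Sum>xs\<in>words X m. (\<lambda>\<phi>s. pure_tensor M vs (map l xs) * pure_tensor M (map b xs) \<phi>s))"
          by (simp add: r_def fun_eq_iff sum_apply)
        also have "\<dots> = pure_tensor M vs"
          by (rule pure[OF that, symmetric])
        finally show ?thesis
          by blast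
      qed
    qed
    then have "t = r t"
      by simp
    also have "r t = (\<Sum>xs\<in>words X m. scal (tp m) (t (map l xs)) (pure_tensor M (map b xs)))"
      by (simp add: r_def tensor_power_eqs fun_eq_iff sum_apply)
    finally show "t = (\<Sum>xs\<in>words X m. scal (tp m) (t (map l xs)) (pure_tensor M (map b xs)))" .
  qed
qed

end

definition reduced_frame :: "('g, 'b) monoid_scheme \<Rightarrow> ('g, 'k::field, 'v::ab_group_add) kG_module \<Rightarrow>
    'x set \<Rightarrow> ('g \<Rightarrow> 'x \<Rightarrow> 'x) \<Rightarrow> ('x \<Rightarrow> 'v) \<Rightarrow> ('x \<Rightarrow> 'v \<Rightarrow> 'k) \<Rightarrow> bool" where
  "reduced_frame G M X \<pi> m l \<longleftrightarrow> frame G M X \<pi> m l \<and>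
     (\<forall>x\<in>fixed_points G X \<pi>. \<forall>y\<in>fixed_points G X \<pi>. l x (m y) = (if x = y then 1 else 0))"

text \<open>A product of Kronecker deltas over the letters is the Kronecker delta of the
  words.\<close>

lemma (in kG_module) reduced_frame_tensor_power:
  assumes "reduced_frame G M X \<pi> b l"
  shows "reduced_frame G (tensor_power M m) (words X m) (\<lambda>g. map (\<pi> g))
    (\<lambda>xs. pure_tensor M (map b xs)) (\<lambda>xs t. t (map l xs))"
  unfolding reduced_frame_def fixed_points_words
proof (intro conjI ballI)
  have fr: "frame G M X \<pi> b l"
    using assms by (simp add: reduced_frame_def)
  show "frame G (tensor_power M m) (words X m) (\<lambda>g. map (\<pi> g))
    (\<lambda>xs. pure_tensor M (map b xs)) (\<lambda>xs t. t (map l xs))"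
    by (rule frame_tensor_power[OF fr])
  fix xs ys assume *: "xs \<in> words (fixed_points G X \<pi>) m" "ys \<in> words (fixed_points G X \<pi>) m"
  then have "set (map l xs) \<subseteq> linear_forms M"
    using frameD(4)[OF fr] by (auto simp: words_def fixed_points_def)
  then have "pure_tensor M (map b ys) (map l xs) = (\<Prod>i<m. l (xs ! i) (b (ys ! i)))"
    using * by (auto simp: pure_tensor_def words_def)
  also have "\<dots> = (\<Prod>i<m. if xs ! i = ys ! i then 1 else 0)"
  proof (intro prod.cong refl)
    fix i assume "i \<in> {..<m}"
    then have "xs ! i \<in> fixed_points G X \<pi>" "ys ! i \<in> fixed_points G X \<pi>"
      using * by (auto simp: words_def intro: subsetD nth_mem)
    then show "l (xs ! i) (b (ys ! i)) = (if xs ! i = ys ! i then 1 else 0)"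
      using assms by (simp add: reduced_frame_def)
  qed
  also have "\<dots> = (if xs = ys then 1 else 0)"
  proof (cases "xs = ys")
    case False
    then obtain i where "i < m" "xs ! i \<noteq> ys ! i"
      using * by (auto simp: words_def list_eq_iff_nth_eq)
    then have "(\<Prod>i<m. if xs ! i = ys ! i then 1 else 0 :: 'k) = 0"
      by (intro prod_zero) auto
    then show ?thesis
      using False by simp
  qed simp
  finally show "pure_tensor M (map b ys) (map l xs) = (if xs = ys then 1 else 0)" .
qed

section \<open>Relative traces and reduced frames\<close>

text \<open>The relative trace from the trivial subgroup, applied to an endomorphism. For a finite
  group and a finite-dimensional M these traces are the equivariant endomorphisms that factor
  through a projective module. \<open>norm_map\<close> is the analogue for vectors.\<close>

definition trace_map :: "('g, 'b) monoid_scheme \<Rightarrow> ('g, 'k::field, 'v::ab_group_add) kG_module \<Rightarrow>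
    ('v \<Rightarrow> 'v) \<Rightarrow> 'v \<Rightarrow> 'v" where
  "trace_map G M \<beta> v = (\<Sum>g\<in>carrier G. act M g (\<beta> (act M (inv\<^bsub>G\<^esub> g) v)))"

definition norm_map :: "('g, 'b) monoid_scheme \<Rightarrow> ('g, 'k::field, 'v::ab_group_add) kG_module \<Rightarrow>
    'v \<Rightarrow> 'v" where
  "norm_map G M v = (\<Sum>g\<in>carrier G. act M g v)"

definition invariants :: "('g, 'b) monoid_scheme \<Rightarrow> ('g, 'k::field, 'v::ab_group_add) kG_module \<Rightarrow>
    'v set" where
  "invariants G M = {v\<in>vspace M. \<forall>g\<in>carrier G. act M g v = v}"

context kG_module
begin

lemma norm_map_closed: "v \<in> vspace M \<Longrightarrow> norm_map G M v \<in> vspace M"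
  unfolding norm_map_def by (intro sum_closed act_closed)

lemma trace_map_closed: "lin_map M M \<beta> \<Longrightarrow> v \<in> vspace M \<Longrightarrow> trace_map G M \<beta> v \<in> vspace M"
  unfolding trace_map_def by (rule sum_closed) (simp add: lin_mapD(1) act_closed)

text \<open>Hence traces vanish on the Brauer quotient, which for a group of order p is the space of
  invariants modulo norms.\<close>

lemma trace_map_invariant: "v \<in> invariants G M \<Longrightarrow> trace_map G M \<beta> v = norm_map G M (\<beta> v)"
  unfolding trace_map_def norm_map_def invariants_def by (intro sum.cong) auto

lemma lin_mapI:
  assumes "\<And>v. v \<in> vspace M \<Longrightarrow> f v \<in> vspace M"
    and "\<And>v w. v \<in> vspace M \<Longrightarrow> w \<in> vspace M \<Longrightarrow> f (v + w) = f v + f w"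
    and "\<And>c v. v \<in> vspace M \<Longrightarrow> f (scal M c v) = scal M c (f v)"
  shows "lin_map M M f"
  using assms by (auto simp: lin_map_def)

lemma lin_map_add_maps: "lin_map M M f \<Longrightarrow> lin_map M M g \<Longrightarrow> lin_map M M (\<lambda>v. f v + g v)"
  by (rule lin_mapI) (auto simp: lin_mapD add_closed algebra_simps vs.scale_right_distrib)

lemma lin_map_sum_maps:
  "(\<And>x. x \<in> A \<Longrightarrow> lin_map M M (f x)) \<Longrightarrow> lin_map M M (\<lambda>v. \<Sum>x\<in>A. f x v)"
  by (rule lin_mapI)
     (auto simp: lin_map_def vs.scale_sum_right simp flip: sum.distrib intro!: sum_closed sum.cong)

lemma lin_map_rank_one:
  "l \<in> linear_forms M \<Longrightarrow> w \<in> vspace M \<Longrightarrow> lin_map M M (\<lambda>v. scal M (l v) w)"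
  by (rule lin_mapI) (auto simp: linear_formsD scal_closed vs.scale_left_distrib)

lemma lin_map_trace_map:
  assumes "lin_map M M \<beta>"
  shows "lin_map M M (trace_map G M \<beta>)"
  unfolding trace_map_def[abs_def] using assms
  by (intro lin_map_sum_maps lin_map_compose[OF _ lin_map_act] lin_map_compose[OF lin_map_act]) auto

lemma trace_map_add:
  assumes "lin_map M M \<beta>" "lin_map M M \<gamma>" "v \<in> vspace M"
  shows "trace_map G M (\<lambda>v. \<beta> v + \<gamma> v) v = trace_map G M \<beta> v + trace_map G M \<gamma> v"
  unfolding trace_map_def sum.distrib[symmetric] using assms
  by (intro sum.cong) (auto simp: act_add act_closed lin_mapD)

lemma linear_form_norm_map:
  assumes "l \<in> linear_forms M" "\<And>g v. g \<in> carrier G \<Longrightarrow> v \<in> vspace M \<Longrightarrow> l (act M g v) = l v" "v \<in> vspace M"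
  shows "l (norm_map G M v) = of_nat (order G) * l v"
  unfolding norm_map_def using assms by (simp add: linear_form_sum act_closed order_def)

text \<open>Along a free orbit the rank one maps given by m x and l x are the conjugates of the one
  at a representative, so they sum to a trace. The map \<beta> collects the representatives.\<close>

lemma frame_free_part:
  assumes fr: "frame G M X \<pi> m l" and Y: "Y \<subseteq> X" "acts_on G Y \<pi>"
    and free: "\<forall>h\<in>carrier G. \<forall>x\<in>Y. \<pi> h x = x \<longrightarrow> h = \<one>"
  shows "\<exists>\<beta>. lin_map M M \<beta> \<and>
    (\<forall>v\<in>vspace M. (\<Sum>x\<in>Y. scal M (l x v) (m x)) = trace_map G M \<beta> v)"
proof -
  note F = frameD[OF fr]
  obtain R where R: "R \<subseteq> Y" "bij_betw (\<lambda>(x, h). \<pi> h x) (R \<times> carrier G) Y"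
    using free_transversal[OF Y(2)] free by metis
  have RX: "x \<in> X" if "x \<in> R" for x
    using that R(1) Y(1) by blast
  define \<beta> where "\<beta> v = (\<Sum>x\<in>R. scal M (l x v) (m x))" for v
  show ?thesis
  proof (intro exI conjI ballI)
    show "lin_map M M \<beta>"
      unfolding \<beta>_def[abs_def] using F(3,4) RX by (intro lin_map_sum_maps lin_map_rank_one) auto
    fix v assume v: "v \<in> vspace M"
    have lh: "l (\<pi> h x) v = l x (act M (inv h) v)" if "x \<in> R" "h \<in> carrier G" for x h
      using F(7)[of h x "act M (inv h) v"] RX that v by (simp add: act_closed act_inv)
    have "(\<Sum>x\<in>Y. scal M (l x v) (m x)) =
        (\<Sum>x\<in>R. \<Sum>h\<in>carrier G. scal M (l (\<pi> h x) v) (m (\<pi> h x)))"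
      by (rule sum_free_transversal[OF R(2)])
    also have "\<dots> = (\<Sum>x\<in>R. \<Sum>h\<in>carrier G. act M h (scal M (l x (act M (inv h) v)) (m x)))"
      using RX F(3,6) by (intro sum.cong refl) (auto simp: lh act_scal)
    also have "\<dots> = (\<Sum>h\<in>carrier G. \<Sum>x\<in>R. act M h (scal M (l x (act M (inv h) v)) (m x)))"
      by (rule sum.swap)
    also have "\<dots> = trace_map G M \<beta> v"
      unfolding trace_map_def \<beta>_def using RX F(3)
      by (intro sum.cong refl act_sum[symmetric]) (auto intro: scal_closed)
    finally show "(\<Sum>x\<in>Y. scal M (l x v) (m x)) = trace_map G M \<beta> v" .
  qed
qed

text \<open>A weakened frame: the free part is remembered only as some trace. This form survives the
  removal of an index, because the trace can absorb the correction.\<close>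

definition trace_decomposition :: "'x set \<Rightarrow> ('x \<Rightarrow> 'v) \<Rightarrow> ('x \<Rightarrow> 'v \<Rightarrow> 'k) \<Rightarrow> ('v \<Rightarrow> 'v) \<Rightarrow> bool" where
  "trace_decomposition I t l \<beta> \<longleftrightarrow> finite I \<and>
     (\<forall>x\<in>I. t x \<in> invariants G M \<and> l x \<in> linear_forms M \<and>
        (\<forall>g\<in>carrier G. \<forall>v\<in>vspace M. l x (act M g v) = l x v)) \<and>
     lin_map M M \<beta> \<and>
     (\<forall>v\<in>vspace M. v = (\<Sum>x\<in>I. scal M (l x v) (t x)) + trace_map G M \<beta> v)"

text \<open>If the forms and vectors are not biorthogonal, some nontrivial combination of the \<open>t x\<close> is a norm
  \<open>norm_map G M w\<close>.  For an invariant form \<open>l\<close> the map \<open>v \<mapsto> l v \<cdot> norm_map G M w\<close> is the trace of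
  \<open>v \<mapsto> l v \<cdot> w\<close>, so one index can be absorbed into the trace.\<close>

lemma trace_decomposition_reduce:
  assumes dec: "trace_decomposition I t l \<beta>"
    and xy: "x0 \<in> I" "y0 \<in> I" "l x0 (t y0) \<noteq> (if x0 = y0 then 1 else 0)"
  shows "\<exists>l' \<beta>'. trace_decomposition (I - {x0}) t l' \<beta>'"
proof -
  have fin: "finite I" and tI: "\<And>x. x \<in> I \<Longrightarrow> t x \<in> invariants G M"
    and lI: "\<And>x. x \<in> I \<Longrightarrow> l x \<in> linear_forms M"
    and linv: "\<And>x g v. x \<in> I \<Longrightarrow> g \<in> carrier G \<Longrightarrow> v \<in> vspace M \<Longrightarrow> l x (act M g v) = l x v"
    and \<beta>: "lin_map M M \<beta>"
    and sum: "\<And>v. v \<in> vspace M \<Longrightarrow> v = (\<Sum>x\<in>I. scal M (l x v) (t x)) + trace_map G M \<beta> v"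
    using dec unfolding trace_decomposition_def by blast+
  have tV: "t x \<in> vspace M" if "x \<in> I" for x
    using tI[OF that] by (simp add: invariants_def)
  \<comment> \<open>Inserting t y0 into the decomposition expresses the norm of \<beta> (t y0) as
    the combination of the t x with coefficients c x. The choice of x0 and y0 makes c x0
    nonzero.\<close>
  define c where "c x = (if x = y0 then 1 else 0) - l x (t y0)" for x
  define w where "w = \<beta> (t y0)"
  have wV: "w \<in> vspace M"
    using lin_mapD(1)[OF \<beta>] tV xy(2) by (simp add: w_def)
  have c0: "c x0 \<noteq> 0"
    using xy(3) by (auto simp: c_def)
  have "(\<Sum>x\<in>I. scal M (c x) (t x)) =
      (\<Sum>x\<in>I. if x = y0 then t x else 0) - (\<Sum>x\<in>I. scal M (l x (t y0)) (t x))"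
    unfolding sum_subtractf[symmetric] c_def
    by (intro sum.cong) (auto simp: vs.scale_left_diff_distrib)
  also have "(\<Sum>x\<in>I. if x = y0 then t x else 0) = t y0"
    using fin xy(2) by simp
  also have "t y0 - (\<Sum>x\<in>I. scal M (l x (t y0)) (t x)) = trace_map G M \<beta> (t y0)"
    using sum[OF tV[OF xy(2)]] by (simp add: diff_eq_eq add.commute)
  also have "\<dots> = norm_map G M w"
    unfolding w_def by (rule trace_map_invariant[OF tI[OF xy(2)]])
  finally have norm_w: "norm_map G M w = (\<Sum>x\<in>I. scal M (c x) (t x))" by simp
  \<comment> \<open>Subtracting l x0 v / c x0 times this relation eliminates the index x0. The
    subtracted term is a multiple of a norm and moves into the trace.\<close>
  define l' where "l' x v = l x v - c x / c x0 * l x0 v" for x v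
  define \<beta>' where "\<beta>' v = \<beta> v + scal M (l x0 v / c x0) w" for v
  have l0: "(\<lambda>v. l x0 v / c x0) \<in> linear_forms M"
    using linear_formsD[OF lI[OF xy(1)]] by (auto simp: linear_forms_def add_divide_distrib)
  have \<gamma>: "lin_map M M (\<lambda>v. scal M (l x0 v / c x0) w)"
    by (rule lin_map_rank_one[OF l0 wV])
  have "trace_decomposition (I - {x0}) t l' \<beta>'"
    unfolding trace_decomposition_def
  proof (intro conjI ballI)
    show "finite (I - {x0})"
      using fin by simp
    show "lin_map M M \<beta>'"
      unfolding \<beta>'_def[abs_def] by (rule lin_map_add_maps[OF \<beta> \<gamma>])
    fix x assume x: "x \<in> I - {x0}"
    then show "t x \<in> invariants G M"
      using tI by blast
    show "l' x \<in> linear_forms M"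
      using linear_formsD[OF lI] x xy(1)
      by (auto simp: linear_forms_def l'_def algebra_simps)
    fix g v assume "g \<in> carrier G" "v \<in> vspace M"
    then show "l' x (act M g v) = l' x v"
      using linv x xy(1) by (simp add: l'_def)
  next
    fix v assume v: "v \<in> vspace M"
    have "trace_map G M (\<lambda>v. scal M (l x0 v / c x0) w) v =
        (\<Sum>g\<in>carrier G. scal M (l x0 v / c x0) (act M g w))"
      unfolding trace_map_def using v xy(1) wV
      by (intro sum.cong) (auto simp: act_scal linv)
    then have "trace_map G M \<beta>' v = trace_map G M \<beta> v + scal M (l x0 v / c x0) (norm_map G M w)"
      unfolding \<beta>'_def trace_map_add[OF \<beta> \<gamma> v] by (simp add: norm_map_def vs.scale_sum_right)
    moreover have "(\<Sum>x\<in>I. scal M (l x v) (t x)) =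
        (\<Sum>x\<in>I - {x0}. scal M (l' x v) (t x)) + scal M (l x0 v / c x0) (norm_map G M w)"
    proof -
      have "(\<Sum>x\<in>I. scal M (l x v) (t x)) - scal M (l x0 v / c x0) (norm_map G M w) =
          (\<Sum>x\<in>I. scal M (l' x v) (t x))"
        unfolding norm_w vs.scale_sum_right sum_subtractf[symmetric] l'_def
        by (intro sum.cong) (auto simp: vs.scale_left_diff_distrib mult.commute)
      also have "\<dots> = scal M (l' x0 v) (t x0) + (\<Sum>x\<in>I - {x0}. scal M (l' x v) (t x))"
        by (rule sum.remove[OF fin xy(1)])
      also have "l' x0 v = 0"
        using c0 by (simp add: l'_def)
      finally show ?thesis
        by (simp add: diff_eq_eq)
    qed
    ultimately show "v = (\<Sum>x\<in>I - {x0}. scal M (l' x v) (t x)) + trace_map G M \<beta>' v"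
      using sum[OF v] by (simp add: algebra_simps)
  qed
  then show ?thesis by blast
qed

text \<open>Each violation allows one index to be dropped while the vectors t x stay the same, so
  the process ends with a subset of I.\<close>

lemma trace_decomposition_biorthogonal:
  assumes "trace_decomposition I t l \<beta>"
  shows "\<exists>J l' \<beta>'. J \<subseteq> I \<and> trace_decomposition J t l' \<beta>' \<and>
    (\<forall>x\<in>J. \<forall>y\<in>J. l' x (t y) = (if x = y then 1 else 0))"
  using assms
proof (induction "card I" arbitrary: I l \<beta> rule: less_induct)
  case less
  show ?case
  proof (cases "\<forall>x\<in>I. \<forall>y\<in>I. l x (t y) = (if x = y then 1 else 0)")
    case True
    then show ?thesis
      using less.prems by blast
  next
    case False
    then obtain x0 y0 where xy: "x0 \<in> I" "y0 \<in> I" "l x0 (t y0) \<noteq> (if x0 = y0 then 1 else 0)"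
      by blast
    obtain l' \<beta>' where red: "trace_decomposition (I - {x0}) t l' \<beta>'"
      using trace_decomposition_reduce[OF less.prems xy] by blast
    have "card (I - {x0}) < card I"
      using less.prems xy(1) by (intro psubset_card_mono) (auto simp: trace_decomposition_def)
    from less.hyps[OF this red] show ?thesis
      by (meson Diff_subset subset_trans)
  qed
qed

text \<open>For a group of prime order the points that are not fixed form a free set, so
  \<open>frame_free_part\<close> covers all of them.\<close>

lemma prime_order_frame_split:
  assumes fr: "frame G M X \<pi> m l" and p: "prime (order G)"
  obtains \<beta> where "lin_map M M \<beta>"
    "\<And>v. v \<in> vspace M \<Longrightarrow> v = (\<Sum>x\<in>fixed_points G X \<pi>. scal M (l x v) (m x)) + trace_map G M \<beta> v"
proof -
  note F = frameD[OF fr]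
  let ?I = "fixed_points G X \<pi>"
  have IX: "?I \<subseteq> X"
    by (auto simp: fixed_points_def)
  have "acts_on G ?I \<pi>"
    unfolding fixed_points_def by (rule acts_on_fixed_subset[OF F(2)])
  then have act: "acts_on G (X - ?I) \<pi>"
    by (intro acts_on_Diff F(2) IX)
  have free: "\<forall>h\<in>carrier G. \<forall>x\<in>X - ?I. \<pi> h x = x \<longrightarrow> h = \<one>"
  proof (intro ballI impI, rule ccontr)
    fix h x assume "h \<in> carrier G" "x \<in> X - ?I" "\<pi> h x = x" "h \<noteq> \<one>"
    moreover from this have "\<forall>g\<in>carrier G. \<pi> g x = x"
      by (intro prime_order_fixed_or_free[OF p F(2), of x h]) auto
    ultimately show False
      by (simp add: fixed_points_def)
  qed
  obtain \<beta> where \<beta>: "lin_map M M \<beta>"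
    "\<And>v. v \<in> vspace M \<Longrightarrow> (\<Sum>x\<in>X - ?I. scal M (l x v) (m x)) = trace_map G M \<beta> v"
    using frame_free_part[OF fr Diff_subset act free] by blast
  show thesis
  proof
    fix v assume v: "v \<in> vspace M"
    have "v = (\<Sum>x\<in>X. scal M (l x v) (m x))"
      using F(5)[OF v] by simp
    also have "\<dots> = (\<Sum>x\<in>?I. scal M (l x v) (m x)) + trace_map G M \<beta> v"
      using sum.subset_diff[OF IX F(1), of "\<lambda>x. scal M (l x v) (m x)"] \<beta>(2)[OF v]
      by (simp add: add.commute)
    finally show "v = (\<Sum>x\<in>?I. scal M (l x v) (m x)) + trace_map G M \<beta> v" .
  qed (fact \<beta>(1))
qed

text \<open>Biorthogonalisation leaves the trace of an unspecified \<beta>. Expanding the values of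
  \<beta> in the original frame turns this trace into a frame again, indexed by X times the group
  with left multiplication; hence the index type of the result.\<close>

lemma reduced_frame_exists:
  fixes X :: "'x set"
  assumes fr: "frame G M X \<pi> m l" and p: "prime (order G)"
  shows "\<exists>(Y :: ('x + 'x \<times> 'g) set) \<pi>' m' l'. reduced_frame G M Y \<pi>' m' l'"
proof -
  note F = frameD[OF fr]
  let ?I = "fixed_points G X \<pi>"
  have fin: "finite (carrier G)"
    using p by (metis card.infinite not_prime_0 order_def)
  obtain \<beta>0 where \<beta>0: "lin_map M M \<beta>0"
    "\<And>v. v \<in> vspace M \<Longrightarrow> v = (\<Sum>x\<in>?I. scal M (l x v) (m x)) + trace_map G M \<beta>0 v"
    using prime_order_frame_split[OF assms] by blast
  have "trace_decomposition ?I m l \<beta>0"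
    unfolding trace_decomposition_def
  proof (intro conjI ballI)
    show "finite ?I"
      using F(1) by (simp add: fixed_points_def)
    fix x assume "x \<in> ?I"
    then have x: "x \<in> X" "\<And>g. g \<in> carrier G \<Longrightarrow> \<pi> g x = x"
      by (auto simp: fixed_points_def)
    show "m x \<in> invariants G M"
      using F(3)[OF x(1)] F(6)[OF _ x(1)] x(2) by (auto simp: invariants_def)
    show "l x \<in> linear_forms M"
      by (rule F(4)[OF x(1)])
    show "l x (act M g v) = l x v" if "g \<in> carrier G" "v \<in> vspace M" for g v
      using F(7)[OF that(1) x(1) that(2)] x(2)[OF that(1)] by simp
  qed (use \<beta>0 in auto)
  then obtain J k \<beta> where J: "trace_decomposition J m k \<beta>"
    "\<forall>x\<in>J. \<forall>y\<in>J. k x (m y) = (if x = y then 1 else 0)"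
    using trace_decomposition_biorthogonal by blast
  have finJ: "finite J" and mJ: "\<And>x. x \<in> J \<Longrightarrow> m x \<in> invariants G M"
    and kJ: "\<And>x. x \<in> J \<Longrightarrow> k x \<in> linear_forms M"
    and kinv: "\<And>x g v. x \<in> J \<Longrightarrow> g \<in> carrier G \<Longrightarrow> v \<in> vspace M \<Longrightarrow> k x (act M g v) = k x v"
    and \<beta>: "lin_map M M \<beta>"
    and sum: "\<And>v. v \<in> vspace M \<Longrightarrow> v = (\<Sum>x\<in>J. scal M (k x v) (m x)) + trace_map G M \<beta> v"
    using J(1) unfolding trace_decomposition_def by blast+
  define Y where "Y = J <+> X \<times> carrier G"
  define \<pi>' where "\<pi>' h y = case_sum Inl (\<lambda>(x, g). Inr (x, h \<otimes> g)) y" for h and y :: "'x + 'x \<times> 'g"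
  define m' where "m' = case_sum m (\<lambda>(x, g). act M g (m x))"
  define l' where "l' = case_sum k (\<lambda>(x, g) v. l x (\<beta> (act M (inv g) v)))"
  have fp: "fixed_points G Y \<pi>' = Inl ` J"
  proof -
    \<comment> \<open>A nontrivial h exists because the order is prime, and it moves every point of
      the second summand.\<close>
    obtain h where h: "h \<in> carrier G" "h \<noteq> \<one>"
    proof -
      have "card (carrier G) \<noteq> card {\<one>}"
        using p by (auto simp: order_def)
      then have "carrier G \<noteq> {\<one>}"
        by metis
      then show thesis
        using that one_closed by blast
    qed
    have "\<pi>' h (Inr (x, g)) \<noteq> Inr (x, g)" if "g \<in> carrier G" for x g
      using h that by (simp add: \<pi>'_def)
    then show ?thesis
      using h(1) unfolding fixed_points_def Y_def by (auto simp: \<pi>'_def)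
  qed
  have "frame G M Y \<pi>' m' l'"
    unfolding frame_def
  proof (intro conjI ballI)
    show "finite Y"
      using finJ F(1) fin by (simp add: Y_def)
    show "acts_on G Y \<pi>'"
      by (auto simp: acts_on_def Y_def \<pi>'_def m_assoc)
  next
    fix y assume y: "y \<in> Y"
    show "m' y \<in> vspace M"
      using y F(3) mJ by (auto simp: Y_def m'_def invariants_def act_closed)
    show "l' y \<in> linear_forms M"
    proof (cases y)
      case (Inr xg)
      then show ?thesis
        using y linear_forms_compose[OF lin_map_compose[OF lin_map_act \<beta>] F(4)]
        by (auto simp: Y_def l'_def)
    qed (use y kJ in \<open>auto simp: Y_def l'_def\<close>)
    fix g assume g: "g \<in> carrier G"
    show "m' (\<pi>' g y) = act M g (m' y)"
      using y mJ g F(3) by (auto simp: Y_def m'_def \<pi>'_def invariants_def act_mult)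
    fix v assume v: "v \<in> vspace M"
    show "l' (\<pi>' g y) (act M g v) = l' y v"
      using y kinv g v by (auto simp: Y_def l'_def \<pi>'_def inv_mult_group act_mult act_closed act_inv)
  next
    fix v assume v: "v \<in> vspace M"
    have "(\<Sum>y\<in>Y. scal M (l' y v) (m' y)) = (\<Sum>x\<in>J. scal M (k x v) (m x)) +
        (\<Sum>(x, g)\<in>X \<times> carrier G. scal M (l x (\<beta> (act M (inv g) v))) (act M g (m x)))"
      unfolding Y_def using finJ F(1) fin
      by (subst sum.Plus) (auto simp: l'_def m'_def intro!: sum.cong)
    also have "(\<Sum>(x, g)\<in>X \<times> carrier G. scal M (l x (\<beta> (act M (inv g) v))) (act M g (m x))) =
        (\<Sum>g\<in>carrier G. \<Sum>x\<in>X. scal M (l x (\<beta> (act M (inv g) v))) (act M g (m x)))"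
      unfolding sum.cartesian_product[symmetric] by (rule sum.swap)
    also have "\<dots> = trace_map G M \<beta> v"
      unfolding trace_map_def
    proof (rule sum.cong)
      fix g assume g: "g \<in> carrier G"
      have b: "\<beta> (act M (inv g) v) \<in> vspace M"
        using g v by (intro lin_mapD(1)[OF \<beta>] act_closed) auto
      have "act M g (\<beta> (act M (inv g) v)) =
          act M g (\<Sum>x\<in>X. scal M (l x (\<beta> (act M (inv g) v))) (m x))"
        by (simp only: F(5)[OF b])
      also have "\<dots> = (\<Sum>x\<in>X. scal M (l x (\<beta> (act M (inv g) v))) (act M g (m x)))"
        using g F(3) by (simp add: act_sum scal_closed act_scal)
      finally show "(\<Sum>x\<in>X. scal M (l x (\<beta> (act M (inv g) v))) (act M g (m x))) =
          act M g (\<beta> (act M (inv g) v))" by simp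
    qed simp
    finally show "v = (\<Sum>y\<in>Y. scal M (l' y v) (m' y))"
      using sum[OF v] by simp
  qed
  then have "reduced_frame G M Y \<pi>' m' l'"
    using J(2) by (auto simp: reduced_frame_def fp m'_def l'_def)
  then show ?thesis by blast
qed

end

section \<open>Fitting decomposition and nilpotency of traces\<close>

context vector_space
begin

text \<open>\<open>dim\<close> is 0 on subspaces without a finite basis, so a finite spanning set B
  accompanies every comparison of dimensions.\<close>

lemma independent_card_le_dim_span:
  assumes "independent A" "A \<subseteq> S" "S \<subseteq> span B" "finite B"
  shows "finite A" "card A \<le> dim S"
proof -
  obtain C where C: "C \<subseteq> S" "independent C" "S \<subseteq> span C" "card C = dim S"
    using basis_exists by blast
  have "finite C"
    using independent_span_bound[OF assms(4) C(2)] C(1) assms(3) by blast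
  then show "finite A" "card A \<le> dim S"
    using independent_span_bound[of C A] assms(1,2) C by auto
qed

lemma dim_strict_mono:
  assumes "subspace A" "A \<subset> S" "S \<subseteq> span B" "finite B"
  shows "dim A < dim S"
proof -
  obtain C where C: "C \<subseteq> A" "independent C" "A \<subseteq> span C" "card C = dim A"
    using basis_exists by blast
  obtain v where v: "v \<in> S" "v \<notin> A"
    using assms(2) by blast
  have "span C \<subseteq> A"
    by (rule span_minimal[OF C(1) assms(1)])
  then have "v \<notin> span C"
    using v by blast
  then have "independent (insert v C)"
    by (rule independent_insertI[OF _ C(2)])
  moreover have "insert v C \<subseteq> S"
    using v C(1) assms(2) by blast
  ultimately have "finite (insert v C)" "card (insert v C) \<le> dim S"
    by (rule independent_card_le_dim_span[OF _ _ assms(3,4)])+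
  moreover have "v \<notin> C"
    using v C(1) by blast
  ultimately show ?thesis
    using C(4) by simp
qed

lemma decreasing_subspaces_stable:
  fixes S :: "nat \<Rightarrow> 'b set"
  assumes "\<And>n. subspace (S n)" "\<And>n. S (Suc n) \<subseteq> S n" "\<And>n. S n \<subseteq> span B" "finite B"
  shows "\<exists>n. S (Suc n) = S n"
proof -
  obtain n where n: "dim (S n) \<le> dim (S i)" for i
    using ex_has_least_nat[of "\<lambda>_. True" 0 "\<lambda>n. dim (S n)"] by auto
  have "\<not> S (Suc n) \<subset> S n"
    using dim_strict_mono[OF assms(1) _ assms(3,4)] n[of "Suc n"] by (metis not_le)
  then show ?thesis
    using assms(2) by blast
qed

lemma increasing_subspaces_stable:
  fixes S :: "nat \<Rightarrow> 'b set"
  assumes "\<And>n. subspace (S n)" "\<And>n. S n \<subseteq> S (Suc n)" "\<And>n. S n \<subseteq> span B" "finite B"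
  shows "\<exists>n. S (Suc n) = S n"
proof -
  \<comment> \<open>A largest dimension is found as a least codimension. Dimensions are at most card
    B, so the truncated subtraction is faithful.\<close>
  obtain n where n: "card B - dim (S n) \<le> card B - dim (S i)" for i
    using ex_has_least_nat[of "\<lambda>_. True" 0 "\<lambda>n. card B - dim (S n)"] by auto
  have "dim (S (Suc n)) \<le> card B"
    by (rule dim_le_card[OF assms(3,4)])
  then have "\<not> dim (S n) < dim (S (Suc n))"
    using n[of "Suc n"] by linarith
  then have "\<not> S n \<subset> S (Suc n)"
    using dim_strict_mono[OF assms(1) _ assms(3,4)] by blast
  then show ?thesis
    using assms(2) by blast
qed

end

lemma kG_submodule_trans:
  assumes "kG_submodule G L W" "kG_submodule G W M"
  shows "kG_submodule G L M"
  using assms unfolding kG_submodule_def by force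

context kG_module
begin

lemma biorthogonal_independent:
  assumes "finite F" and v: "\<And>x. x \<in> F \<Longrightarrow> v x \<in> vspace M"
    and l: "\<And>x. x \<in> F \<Longrightarrow> l x \<in> linear_forms M"
    and bi: "\<And>x y. x \<in> F \<Longrightarrow> y \<in> F \<Longrightarrow> l x (v y) = (if x = y then 1 else 0)"
  shows "inj_on v F" "vs.independent (v ` F)"
proof -
  show inj: "inj_on v F"
    using bi by (intro inj_onI) (metis zero_neq_one)
  show "vs.independent (v ` F)"
  proof (rule vs.independent_if_scalars_zero)
    show "finite (v ` F)"
      using assms(1) by simp
    fix f w assume *: "(\<Sum>w\<in>v ` F. scal M (f w) w) = 0" "w \<in> v ` F"
    then obtain y where y: "y \<in> F" "w = v y" by blast
    have "0 = l y (\<Sum>x\<in>F. scal M (f (v x)) (v x))"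
      using *(1) linear_form_zero[OF l[OF y(1)]] by (simp add: sum.reindex[OF inj])
    also have "\<dots> = (\<Sum>x\<in>F. f (v x) * l y (v x))"
      using v l[OF y(1)] by (subst linear_form_sum) (auto simp: linear_formsD scal_closed)
    also have "\<dots> = (\<Sum>x\<in>F. if x = y then f (v x) else 0)"
      using bi y(1) by (intro sum.cong) auto
    also have "\<dots> = f w"
      using assms(1) y by simp
    finally show "f w = 0" by simp
  qed
qed

text \<open>Later statements take a frame for an arbitrary group H as their witness of finite
  dimension.\<close>

lemma frame_spans:
  assumes "frame H M X \<pi> m l"
  shows "vspace M \<subseteq> vs.span (m ` X)"
proof
  fix v assume "v \<in> vspace M"
  then have "(\<Sum>x\<in>X. scal M (l x v) (m x)) = v"
    by (rule frameD(5)[OF assms])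
  moreover have "(\<Sum>x\<in>X. scal M (l x v) (m x)) \<in> vs.span (m ` X)"
    by (intro vs.span_sum vs.span_scale vs.span_base imageI)
  ultimately show "v \<in> vs.span (m ` X)" by simp
qed

section \<open>Higman's criterion and the Fitting decomposition\<close>

lemma trace_map_equivariant:
  assumes "lin_map M M \<beta>" "g \<in> carrier G" "v \<in> vspace M"
  shows "trace_map G M \<beta> (act M g v) = act M g (trace_map G M \<beta> v)"
proof -
  let ?f = "\<lambda>h. act M h (\<beta> (act M (inv h) (act M g v)))"
  have bij: "bij_betw (\<lambda>h. g \<otimes> h) (carrier G) (carrier G)"
    using assms(2) by (intro bij_betw_byWitness[where f' = "\<lambda>h. inv g \<otimes> h"])
      (auto simp: inv_solve_left m_assoc[symmetric])
  have "trace_map G M \<beta> (act M g v) = (\<Sum>h\<in>carrier G. ?f (g \<otimes> h))"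
    unfolding trace_map_def by (rule sum.reindex_bij_betw[OF bij, symmetric])
  also have "\<dots> = (\<Sum>h\<in>carrier G. act M g (act M h (\<beta> (act M (inv h) v))))"
    using assms by (intro sum.cong refl)
      (simp add: inv_mult_group act_mult act_closed act_inv lin_mapD(1))
  also have "\<dots> = act M g (trace_map G M \<beta> v)"
    unfolding trace_map_def using assms by (intro act_sum[symmetric]) (auto simp: act_closed lin_mapD(1))
  finally show ?thesis .
qed

lemma trace_map_kG_map: "lin_map M M \<beta> \<Longrightarrow> kG_map G M M (trace_map G M \<beta>)"
  unfolding kG_map_def by (auto simp: lin_map_trace_map trace_map_equivariant)

text \<open>One direction of Higman's criterion: the index set of the frame is free, so the whole
  frame identity is a trace.\<close>

lemma projective_trace_identity:
  assumes "finite (carrier G)" "projective G M"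
  shows "\<exists>\<beta>. lin_map M M \<beta> \<and> (\<forall>v\<in>vspace M. trace_map G M \<beta> v = v)"
proof -
  obtain n m l where fr: "frame G M ({..<n} \<times> carrier G) (free_act G) m l"
    using assms projective_iff_frame by blast
  have "\<forall>h\<in>carrier G. \<forall>x\<in>{..<n} \<times> carrier G. free_act G h x = x \<longrightarrow> h = \<one>"
    by (auto simp: free_act_def)
  from frame_free_part[OF fr subset_refl frameD(2)[OF fr] this] show ?thesis
    by (simp add: frameD(5)[OF fr] eq_commute)
qed

text \<open>The other direction, for an identity of W that factors through M, with \<beta> merely
  linear and \<theta> equivariant. The frame of M serves as a finite dual basis; its vectors, mapped
  by \<theta> and translated by G, form a frame of W on a free set.\<close>

lemma trace_identity_projective:
  assumes fin: "finite (carrier G)" and W: "kG_module G W" and fr: "frame H M X \<pi> m l"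
    and \<theta>: "kG_map G M W \<theta>" and \<beta>: "lin_map W M \<beta>"
    and eq: "\<And>w. w \<in> vspace W \<Longrightarrow> (\<Sum>g\<in>carrier G. act W g (\<theta> (\<beta> (act W (inv g) w)))) = w"
  shows "projective G W"
proof -
  interpret W: kG_module G W by fact
  note F = frameD[OF fr]
  \<comment> \<open>Numbering X makes the index set literally that of a free module.\<close>
  obtain n and x :: "nat \<Rightarrow> 'd" where x: "bij_betw x {..<n} X"
    using F(1) by (metis ex_bij_betw_nat_finite lessThan_atLeast0)
  have xX: "x i \<in> X" if "i < n" for i
    using x that by (auto simp: bij_betw_def)
  note \<theta>D = lin_mapD[OF kG_mapD(1)[OF \<theta>]]
  define m' where "m' = (\<lambda>(i, h). act W h (\<theta> (m (x i))))"
  define l' where "l' = (\<lambda>(i, h) w. l (x i) (\<beta> (act W (inv h) w)))"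
  have "frame G W ({..<n} \<times> carrier G) (free_act G) m' l'"
    unfolding frame_def
  proof (intro conjI ballI)
    fix z assume z: "z \<in> {..<n} \<times> carrier G"
    show "m' z \<in> vspace W"
      using z F(3) xX by (auto simp: m'_def W.act_closed \<theta>D)
    show "l' z \<in> linear_forms W"
      using z xX F(4) linear_forms_compose[OF lin_map_compose[OF W.lin_map_act \<beta>]]
      by (auto simp: l'_def)
    fix g assume g: "g \<in> carrier G"
    show "m' (free_act G g z) = act W g (m' z)"
      using z g F(3) xX by (auto simp: m'_def free_act_def W.act_mult \<theta>D)
    fix v assume v: "v \<in> vspace W"
    show "l' (free_act G g z) (act W g v) = l' z v"
      using z g v by (auto simp: l'_def free_act_def inv_mult_group W.act_mult W.act_closed W.act_inv)
  next
    fix v assume v: "v \<in> vspace W"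
    have "(\<Sum>z\<in>{..<n} \<times> carrier G. scal W (l' z v) (m' z)) =
        (\<Sum>i<n. \<Sum>h\<in>carrier G. scal W (l' (i, h) v) (m' (i, h)))"
      by (simp add: sum.cartesian_product)
    also have "\<dots> = (\<Sum>h\<in>carrier G. \<Sum>i<n. scal W (l' (i, h) v) (m' (i, h)))"
      by (rule sum.swap)
    also have "\<dots> = (\<Sum>h\<in>carrier G. act W h (\<theta> (\<beta> (act W (inv h) v))))"
    proof (rule sum.cong)
      fix h assume h: "h \<in> carrier G"
      let ?u = "\<beta> (act W (inv h) v)"
      have u: "?u \<in> vspace M"
        using h v by (intro lin_mapD(1)[OF \<beta>] W.act_closed) auto
      have "?u = (\<Sum>i<n. scal M (l (x i) ?u) (m (x i)))"
        using F(5)[OF u] sum.reindex_bij_betw[OF x, of "\<lambda>x. scal M (l x ?u) (m x)"] by simp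
      then have "act W h (\<theta> ?u) = act W h (\<theta> (\<Sum>i<n. scal M (l (x i) ?u) (m (x i))))"
        by simp
      also have "\<dots> = (\<Sum>i<n. scal W (l (x i) ?u) (act W h (\<theta> (m (x i)))))"
        using F(3) xX h
        by (subst lin_map_sum[OF kG_mapD(1)[OF \<theta>] W.vector_space_scal], simp add: scal_closed,
            subst W.act_sum) (auto simp: scal_closed \<theta>D W.scal_closed W.act_scal)
      finally show "(\<Sum>i<n. scal W (l' (i, h) v) (m' (i, h))) = act W h (\<theta> ?u)"
        by (simp add: l'_def m'_def)
    qed simp
    also have "\<dots> = v"
      by (rule eq[OF v])
    finally show "v = (\<Sum>z\<in>{..<n} \<times> carrier G. scal W (l' z v) (m' z))"
      by simp
  qed (use fin acts_on_free_act in auto)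
  then show ?thesis
    using projective_iff_frame[OF fin] W by blast
qed

lemma kG_map_funpow: "kG_map G M M \<phi> \<Longrightarrow> kG_map G M M (\<phi> ^^ n)"
proof (induction n)
  case (Suc n)
  then show ?case
    using kG_map_compose[of G M M "\<phi> ^^ n" M \<phi>] by (simp add: comp_def)
qed (auto simp: kG_map_def lin_map_def)

lemma submodule_subspace: "kG_submodule G W M \<Longrightarrow> vs.subspace (vspace W)"
  by (auto simp: kG_submodule_def)

lemma image_submodule:
  assumes "kG_map G M M f"
  shows "kG_submodule G (M\<lparr>vspace := f ` vspace M\<rparr>) M"
  unfolding kG_submodule_def
proof (intro exI[of _ "f ` vspace M"] conjI ballI refl)
  note f = lin_mapD[OF kG_mapD(1)[OF assms]] kG_mapD(2)[OF assms]
  show "f ` vspace M \<subseteq> vspace M"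
    using f(1) by blast
  show "vs.subspace (f ` vspace M)"
  proof (rule vs.subspaceI)
    show "0 \<in> f ` vspace M"
      using lin_map_zero[OF kG_mapD(1)[OF assms] vector_space_scal] zero_closed by (metis image_eqI)
    show "v + w \<in> f ` vspace M" if "v \<in> f ` vspace M" "w \<in> f ` vspace M" for v w
      using that f(2) add_closed by (auto simp flip: f(2))
    show "scal M c v \<in> f ` vspace M" if "v \<in> f ` vspace M" for c v
      using that scal_closed by (auto simp flip: f(3))
  qed
  show "act M g v \<in> f ` vspace M" if "g \<in> carrier G" "v \<in> f ` vspace M" for g v
    using that act_closed by (auto simp flip: f(4))
qed

lemma kernel_submodule:
  assumes "kG_map G M M f"
  shows "kG_submodule G (M\<lparr>vspace := {v\<in>vspace M. f v = 0}\<rparr>) M"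
  unfolding kG_submodule_def
proof (intro exI[of _ "{v\<in>vspace M. f v = 0}"] conjI ballI refl)
  note f = lin_mapD[OF kG_mapD(1)[OF assms]] kG_mapD(2)[OF assms]
  show "vs.subspace {v\<in>vspace M. f v = 0}"
    using lin_map_zero[OF kG_mapD(1)[OF assms] vector_space_scal]
    by (intro vs.subspaceI) (auto simp: f closed)
qed (auto simp: kG_mapD(2)[OF assms] act_zero act_closed)

text \<open>The images stabilise at n and the kernels at k, with no comparison between the two:
  surjectivity on the stable image together with the stable kernel gives bijectivity there.\<close>

lemma Fitting:
  assumes \<phi>: "kG_map G M M \<phi>" and span: "vspace M \<subseteq> vs.span B" "finite B"
  obtains n where
    "direct_sum G M (M\<lparr>vspace := (\<phi> ^^ n) ` vspace M\<rparr>) (M\<lparr>vspace := {v\<in>vspace M. (\<phi> ^^ n) v = 0}\<rparr>)"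
    "bij_betw \<phi> ((\<phi> ^^ n) ` vspace M) ((\<phi> ^^ n) ` vspace M)"
proof -
  note pow = kG_map_funpow[OF \<phi>]
  note powD = lin_mapD[OF kG_mapD(1)[OF pow]] and \<phi>D = lin_mapD[OF kG_mapD(1)[OF \<phi>]]
  have z: "(\<phi> ^^ n) 0 = 0" for n
    by (rule lin_map_zero[OF kG_mapD(1)[OF pow] vector_space_scal])
  let ?I = "\<lambda>n. (\<phi> ^^ n) ` vspace M" and ?K = "\<lambda>n. {v\<in>vspace M. (\<phi> ^^ n) v = 0}"
  have subI: "vs.subspace (?I n)" and subK: "vs.subspace (?K n)" for n
    using submodule_subspace[OF image_submodule[OF pow]] submodule_subspace[OF kernel_submodule[OF pow]]
    by simp_all
  obtain n where n: "?I (Suc n) = ?I n"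
  proof -
    have "?I n \<subseteq> vs.span B" for n
      using powD(1) span(1) by blast
    moreover have "?I (Suc n) \<subseteq> ?I n" for n
      using \<phi>D(1) by (auto simp: funpow_swap1 simp del: funpow.simps(2) intro!: imageI)
        (metis \<phi>D(1) funpow_Suc_right image_eqI o_apply)
    ultimately have "\<exists>n. ?I (Suc n) = ?I n"
      by (intro vs.decreasing_subspaces_stable[where S = ?I, OF subI _ _ span(2)])
    then show thesis
      using that by blast
  qed
  obtain k where k: "?K (Suc k) = ?K k"
  proof -
    have "?K n \<subseteq> vs.span B" for n
      using span(1) by blast
    moreover have "?K n \<subseteq> ?K (Suc n)" for n
      using z[of 1] by auto
    ultimately have "\<exists>n. ?K (Suc n) = ?K n"
      by (intro vs.increasing_subspaces_stable[where S = ?K, OF subK _ _ span(2)])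
    then show thesis
      using that by blast
  qed
  define W where "W = ?I n"
  have \<phi>W: "\<phi> ` W = W"
    using n by (auto simp: W_def image_comp)
  have powW: "(\<phi> ^^ i) ` W = W" for i
  proof (induction i)
    case (Suc i)
    have "(\<phi> ^^ Suc i) ` W = \<phi> ` (\<phi> ^^ i) ` W"
      by (simp add: image_comp)
    then show ?case
      using Suc \<phi>W by simp
  qed simp
  have WM: "W \<subseteq> vspace M"
    using powD(1) by (auto simp: W_def)
  have ker: "w = 0" if "w \<in> W" "\<phi> w = 0" for w
  proof -
    \<comment> \<open>Lift w through \<phi>^k inside W. Then u is killed by \<phi>^(k+1), hence
      already by \<phi>^k, and so w = 0.\<close>
    obtain u where u: "u \<in> W" "w = (\<phi> ^^ k) u"
      using powW[of k] \<open>w \<in> W\<close> by blast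
    then have "u \<in> ?K (Suc k)"
      using that WM by auto
    then have "u \<in> ?K k"
      unfolding k .
    then show ?thesis
      using u by simp
  qed
  have inj: "inj_on \<phi> W"
  proof (rule inj_onI)
    fix u v assume *: "u \<in> W" "v \<in> W" "\<phi> u = \<phi> v"
    have "\<phi> (u - v) = 0"
      using * WM lin_map_diff[OF kG_mapD(1)[OF \<phi>]] by (simp add: subset_iff)
    moreover have "u - v \<in> W"
      using * vs.subspace_diff[OF subI] by (simp add: W_def)
    ultimately show "u = v"
      using ker by fastforce
  qed
  have kerpow: "w = 0" if "w \<in> W" "(\<phi> ^^ i) w = 0" for w i
    using that
  proof (induction i arbitrary: w)
    case (Suc i)
    have "\<phi> w \<in> W"
      using \<phi>W Suc.prems by blast
    then have "\<phi> w = 0"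
      using Suc by (simp add: funpow_swap1)
    then show ?case
      using ker Suc.prems by blast
  qed simp
  show thesis
  proof (rule that[of n])
    show "bij_betw \<phi> (?I n) (?I n)"
      using inj \<phi>W by (auto simp: bij_betw_def W_def)
    show "direct_sum G M (M\<lparr>vspace := ?I n\<rparr>) (M\<lparr>vspace := ?K n\<rparr>)"
      unfolding direct_sum_def
    proof (intro conjI image_submodule kernel_submodule pow)
      show "vspace (M\<lparr>vspace := ?I n\<rparr>) \<inter> vspace (M\<lparr>vspace := ?K n\<rparr>) = {0}"
        using kerpow[of _ n] z[of n] zero_closed vs.subspace_0[OF subI[of n]] by (auto simp: W_def)
      show "vspace M = {w + u |w u. w \<in> vspace (M\<lparr>vspace := ?I n\<rparr>) \<and> u \<in> vspace (M\<lparr>vspace := ?K n\<rparr>)}"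
      proof (intro equalityI subsetI)
        fix v assume v: "v \<in> vspace M"
        then have "(\<phi> ^^ n) v \<in> (\<phi> ^^ n) ` W"
          unfolding powW by (simp add: W_def)
        then obtain w where w: "w \<in> W" "(\<phi> ^^ n) v = (\<phi> ^^ n) w" by blast
        have "(\<phi> ^^ n) (v - w) = 0"
          using v w WM lin_map_diff[OF kG_mapD(1)[OF pow]] by (simp add: subset_iff)
        then have "w \<in> ?I n" "v - w \<in> ?K n" "v = w + (v - w)"
          using v w WM by (auto simp: W_def diff_closed)
        then have "\<exists>w u. v = w + u \<and> w \<in> ?I n \<and> u \<in> ?K n"
          by blast
        then show "v \<in> {w + u |w u. w \<in> vspace (M\<lparr>vspace := ?I n\<rparr>) \<and> u \<in> vspace (M\<lparr>vspace := ?K n\<rparr>)}"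
          by simp
      qed (use powD(1) add_closed in auto)
    qed
  qed
qed

text \<open>On its stable image a trace is invertible. Composing with the equivariant inverse writes
  the identity of that summand as a trace, so the summand is projective and must vanish.\<close>

lemma trace_map_nilpotent:
  assumes fin: "finite (carrier G)" and fr: "frame H M X \<pi> m l"
    and \<beta>: "lin_map M M \<beta>"
    and no_proj: "\<And>Q. direct_summand G Q M \<Longrightarrow> projective G Q \<Longrightarrow> vspace Q = {0}"
  shows "\<exists>n. \<forall>v\<in>vspace M. (trace_map G M \<beta> ^^ n) v = 0"
proof -
  define \<phi> where "\<phi> = trace_map G M \<beta>"
  have \<phi>: "kG_map G M M \<phi>"
    unfolding \<phi>_def by (rule trace_map_kG_map[OF \<beta>])
  note pow = kG_map_funpow[OF \<phi>]
  have span: "vspace M \<subseteq> vs.span (m ` X)" "finite (m ` X)"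
    using frame_spans[OF fr] frameD(1)[OF fr] by auto
  obtain n where ds: "direct_sum G M (M\<lparr>vspace := (\<phi> ^^ n) ` vspace M\<rparr>) (M\<lparr>vspace := {v\<in>vspace M. (\<phi> ^^ n) v = 0}\<rparr>)"
    and bij: "bij_betw \<phi> ((\<phi> ^^ n) ` vspace M) ((\<phi> ^^ n) ` vspace M)"
    using Fitting[OF \<phi> span] by blast
  define W where "W = M\<lparr>vspace := (\<phi> ^^ n) ` vspace M\<rparr>"
  have W: "kG_submodule G W M"
    unfolding W_def by (rule image_submodule[OF pow])
  interpret W: kG_module G W
    by (rule submodule_kG_module[OF W])
  have eqs: "scal W = scal M" "act W = act M" and WM: "vspace W \<subseteq> vspace M"
    using kG_submoduleD[OF W] by auto
  have bijW: "bij_betw (\<phi> ^^ i) (vspace W) (vspace W)" for i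
    using bij_betw_funpow[of \<phi> "vspace W" i] bij by (simp add: W_def)
  \<comment> \<open>The exponent is n+1: \<phi>^n carries M into W, and one more factor is the trace
    to be inverted. This gives \<theta> on all of M with \<theta> (\<phi> w) = w on W.\<close>
  define \<psi> where "\<psi> = inv_into (vspace W) (\<phi> ^^ Suc n)"
  have \<psi>: "\<psi> w \<in> vspace W" "(\<phi> ^^ Suc n) (\<psi> w) = w" if "w \<in> vspace W" for w
    using bijW[of "Suc n"] that unfolding \<psi>_def bij_betw_def
    by (metis inv_into_into, metis f_inv_into_f)
  have \<psi>': "\<psi> ((\<phi> ^^ Suc n) w) = w" if "w \<in> vspace W" for w
    using bijW[of "Suc n"] that unfolding \<psi>_def bij_betw_def by (metis inv_into_f_f)
  define \<theta> where "\<theta> v = \<psi> ((\<phi> ^^ n) v)" for v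
  note S = lin_mapD[OF kG_mapD(1)[OF pow[of "Suc n"]]] kG_mapD(2)[OF pow[of "Suc n"]]
  have "kG_map G W W \<psi>"
    unfolding kG_map_def lin_map_def
  proof (intro conjI ballI allI)
    fix v assume v: "v \<in> vspace W"
    show "\<psi> v \<in> vspace W"
      by (rule \<psi>(1)[OF v])
    have vM: "\<psi> v \<in> vspace M"
      using \<psi>(1)[OF v] WM by blast
    show "\<psi> (scal W c v) = scal W c (\<psi> v)" for c
      using \<psi>'[of "scal W c (\<psi> v)"] S(3)[OF vM, of c] \<psi>[OF v] W.scal_closed[of "\<psi> v" c]
      by (simp only: eqs)
    show "\<psi> (act W g v) = act W g (\<psi> v)" if "g \<in> carrier G" for g
      using \<psi>'[of "act W g (\<psi> v)"] S(4)[OF that vM] \<psi>[OF v] W.act_closed[OF that, of "\<psi> v"]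
      by (simp only: eqs)
    fix w assume w: "w \<in> vspace W"
    have wM: "\<psi> w \<in> vspace M"
      using \<psi>(1)[OF w] WM by blast
    show "\<psi> (v + w) = \<psi> v + \<psi> w"
      using \<psi>'[of "\<psi> v + \<psi> w"] S(2)[OF vM wM] \<psi>[OF v] \<psi>[OF w] W.add_closed[of "\<psi> v" "\<psi> w"]
      by (simp only:)
  qed
  moreover have "kG_map G M W (\<phi> ^^ n)"
    using pow[of n] by (auto simp: kG_map_def lin_map_def W_def)
  ultimately have \<theta>: "kG_map G M W \<theta>"
    unfolding \<theta>_def[abs_def] by (rule kG_map_compose[rotated])
  have "lin_map W M \<beta>"
    using \<beta> WM by (auto simp: lin_map_def eqs subset_iff)
  moreover have "(\<Sum>g\<in>carrier G. act W g (\<theta> (\<beta> (act W (inv g) w)))) = w" if w: "w \<in> vspace W" for w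
  proof -
    have wM: "w \<in> vspace M"
      using w WM by blast
    have b: "\<beta> (act M (inv g) w) \<in> vspace M" if "g \<in> carrier G" for g
      using that wM by (simp add: lin_mapD(1)[OF \<beta>] act_closed)
    have "(\<Sum>g\<in>carrier G. act W g (\<theta> (\<beta> (act W (inv g) w)))) =
        (\<Sum>g\<in>carrier G. \<theta> (act M g (\<beta> (act M (inv g) w))))"
      using b by (intro sum.cong) (auto simp: eqs kG_mapD(2)[OF \<theta>])
    also have "\<dots> = \<theta> (\<phi> w)"
      unfolding \<phi>_def trace_map_def using b
      by (intro lin_map_sum[OF kG_mapD(1)[OF \<theta>] W.vector_space_scal, symmetric]) (auto simp: act_closed)
    also have "\<dots> = w"
      using \<psi>'[OF w] by (simp add: \<theta>_def funpow_swap1)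
    finally show ?thesis .
  qed
  ultimately have "projective G W"
    using trace_identity_projective[OF fin W.kG_module_axioms fr \<theta>] by blast
  moreover have "direct_summand G W M"
    using ds unfolding direct_summand_def W_def by blast
  ultimately have "vspace W = {0}"
    using no_proj by blast
  then show ?thesis
    by (auto simp: W_def \<phi>_def)
qed

end

section \<open>Existence of the core and the lower bound\<close>

context kG_module
begin

lemma projective_zero:
  assumes "finite (carrier G)"
  shows "projective G (M\<lparr>vspace := {0}\<rparr>)"
proof -
  have "kG_module G (M\<lparr>vspace := {0}\<rparr>)"
    by (rule kG_module_subspace) (auto simp: zero_closed act_zero vs.subspace_def)
  moreover have "frame G (M\<lparr>vspace := {0}\<rparr>) ({..<0} \<times> carrier G) (free_act G) undefined undefined"
    by (auto simp: frame_def acts_on_def)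
  ultimately show ?thesis
    using projective_iff_frame[OF assms] by blast
qed

text \<open>Here M is the sum of Q, U and P, and Q and P are joined. Their sum is projective by
  Higman's criterion: the block map built from maps with trace 1 on Q and on P has trace 1.\<close>

lemma projective_sum_split:
  assumes fin: "finite (carrier G)" and fr: "frame H M X \<pi> m l"
    and MP: "direct_sum G M M' P" and QU: "direct_sum G M' Q U"
    and P: "projective G P" and Q: "projective G Q"
  shows "\<exists>P'. direct_sum G M U P' \<and> projective G P'"
proof -
  have M'M: "kG_submodule G M' M" and PM: "kG_submodule G P M"
    and MPint: "vspace M' \<inter> vspace P = {0}"
    and MPsum: "vspace M = {w + u | w u. w \<in> vspace M' \<and> u \<in> vspace P}"
    using MP by (auto simp: direct_sum_def)
  have QM': "kG_submodule G Q M'" and UM': "kG_submodule G U M'"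
    and QUint: "vspace Q \<inter> vspace U = {0}"
    and QUsum: "vspace M' = {w + u | w u. w \<in> vspace Q \<and> u \<in> vspace U}"
    using QU by (auto simp: direct_sum_def)
  have QM: "kG_submodule G Q M" and UM: "kG_submodule G U M"
    using kG_submodule_trans QM' UM' M'M by blast+
  note eqs = kG_submoduleD(2,3)[OF M'M] kG_submoduleD(2,3)[OF PM] kG_submoduleD(2,3)[OF QM]
  note subs = kG_submoduleD(1)[OF M'M] kG_submoduleD(1)[OF PM] kG_submoduleD(1)[OF QM]
    kG_submoduleD(1)[OF UM] kG_submoduleD(1)[OF QM'] kG_submoduleD(1)[OF UM']
  interpret M': kG_module G M' by (rule submodule_kG_module[OF M'M])
  interpret P: kG_module G P by (rule submodule_kG_module[OF PM])
  interpret Q: kG_module G Q by (rule submodule_kG_module[OF QM])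
  interpret U: kG_module G U by (rule submodule_kG_module[OF UM])
  obtain e where e: "kG_map G M M' e" and e_id: "\<And>w. w \<in> vspace M' \<Longrightarrow> e w = w"
    and eP: "\<And>v. v \<in> vspace M \<Longrightarrow> v - e v \<in> vspace P"
    using direct_sum_projection[OF MP] by metis
  obtain f where f: "kG_map G M' Q f" and f_id: "\<And>w. w \<in> vspace Q \<Longrightarrow> f w = w"
    and fU: "\<And>v. v \<in> vspace M' \<Longrightarrow> v - f v \<in> vspace U"
    using M'.direct_sum_projection[OF QU] by metis
  obtain \<beta>P where \<beta>P: "lin_map P P \<beta>P" "\<And>v. v \<in> vspace P \<Longrightarrow> trace_map G P \<beta>P v = v"
    using P.projective_trace_identity[OF fin P] by blast
  obtain \<beta>Q where \<beta>Q: "lin_map Q Q \<beta>Q" "\<And>v. v \<in> vspace Q \<Longrightarrow> trace_map G Q \<beta>Q v = v"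
    using Q.projective_trace_identity[OF fin Q] by blast
  note eD = lin_mapD[OF kG_mapD(1)[OF e]] kG_mapD(2)[OF e]
  note fD = lin_mapD[OF kG_mapD(1)[OF f]] kG_mapD(2)[OF f]
  have e0: "e p = 0" if "p \<in> vspace P" for p
  proof -
    have "p \<in> vspace M"
      using that subs(2) by blast
    then have "e p \<in> vspace M'" "p - (p - e p) \<in> vspace P"
      using eD(1) eP that P.diff_closed by blast+
    then show ?thesis
      using MPint by auto
  qed
  define S where "S = {q + p | q p. q \<in> vspace Q \<and> p \<in> vspace P}"
  define P' where "P' = M\<lparr>vspace := S\<rparr>"
  have P'M: "kG_submodule G P' M"
    unfolding kG_submodule_def
  proof (intro exI[of _ S] conjI ballI)
    show "P' = M\<lparr>vspace := S\<rparr>"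
      by (simp add: P'_def)
    show "S \<subseteq> vspace M"
      unfolding S_def using subs(2,3) add_closed by blast
    show "vs.subspace S"
      unfolding S_def by (intro vs.subspace_sums submodule_subspace QM PM)
    fix g v assume g: "g \<in> carrier G" and "v \<in> S"
    then obtain q r where qr: "q \<in> vspace Q" "r \<in> vspace P" "v = q + r"
      by (auto simp: S_def)
    moreover have "act M g q \<in> vspace Q" "act M g r \<in> vspace P"
      using Q.act_closed[OF g qr(1)] P.act_closed[OF g qr(2)] by (simp_all add: eqs)
    moreover have "q \<in> vspace M" "r \<in> vspace M"
      using qr subs(2,3) by blast+
    ultimately show "act M g v \<in> S"
      using g by (auto simp: S_def act_add)
  qed
  interpret P': kG_module G P' by (rule submodule_kG_module[OF P'M])
  have eqs': "scal P' = scal M" "act P' = act M" "vspace P' = S"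
    by (simp_all add: P'_def)
  have SM: "S \<subseteq> vspace M"
    using kG_submoduleD(1)[OF P'M] eqs' by simp
  have "direct_sum G M U P'"
    unfolding direct_sum_def eqs'
  proof (intro conjI UM P'M)
    show "vspace U \<inter> S = {0}"
    proof (intro equalityI subsetI)
      fix x assume x: "x \<in> vspace U \<inter> S"
      then obtain q r where qr: "q \<in> vspace Q" "r \<in> vspace P" "x = q + r"
        by (auto simp: S_def)
      have "x - q \<in> vspace M'"
        using x qr(1) subs(5,6) by (intro M'.diff_closed) auto
      moreover have "x - q = r"
        using qr by simp
      ultimately have "r = 0"
        using qr(2) MPint by auto
      then show "x \<in> {0}"
        using x qr QUint by auto
    qed (use U.zero_closed P'.zero_closed eqs' in auto)
    show "vspace M = {w + u | w u. w \<in> vspace U \<and> u \<in> S}"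
    proof (intro equalityI subsetI)
      fix v assume "v \<in> vspace M"
      then obtain q u r where "q \<in> vspace Q" "u \<in> vspace U" "r \<in> vspace P" "v = q + u + r"
        unfolding MPsum QUsum by blast
      then have "u \<in> vspace U" "q + r \<in> S" "v = u + (q + r)"
        by (auto simp: S_def algebra_simps)
      then show "v \<in> {w + u | w u. w \<in> vspace U \<and> u \<in> S}"
        by blast
    qed (use subs(4) SM add_closed in blast)
  qed
  moreover have "projective G P'"
  proof -
    \<comment> \<open>\<theta> is the projection of M onto Q + P along U.\<close>
    define \<theta> where "\<theta> v = f (e v) + (v - e v)" for v
    define \<beta> where "\<beta> v = \<beta>Q (f (e v)) + \<beta>P (v - e v)" for v
    have part: "f (e v) \<in> vspace Q" "v - e v \<in> vspace P" "e v \<in> vspace M" if "v \<in> vspace M" for v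
      using that eD(1) fD(1) eP subs(1) by auto
    have \<theta>S: "\<theta> v \<in> S" if "v \<in> vspace M" for v
      using part[OF that] by (auto simp: S_def \<theta>_def)
    have fM: "f (scal M c w) = scal M c (f w)" "g \<in> carrier G \<Longrightarrow> f (act M g w) = act M g (f w)"
      if "w \<in> vspace M'" for c g w
      using fD(3)[OF that] fD(4)[OF _ that] by (simp_all add: eqs)
    have \<theta>: "kG_map G M P' \<theta>"
      unfolding kG_map_def lin_map_def eqs'
      using part by (auto simp: \<theta>S) (auto simp: \<theta>_def eD fD fM eqs vs.scale_right_distrib
        vs.scale_right_diff_distrib act_add act_diff add_closed diff_closed subsetD[OF subs(3)])
    have \<theta>_id: "\<theta> v = v" if v: "v \<in> S" for v
    proof -
      obtain q r where qr: "q \<in> vspace Q" "r \<in> vspace P" "v = q + r"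
        using v by (auto simp: S_def)
      moreover have "q \<in> vspace M" "r \<in> vspace M" "q \<in> vspace M'"
        using qr subs by blast+
      ultimately have "e v = q"
        using eD(2)[of q r] e_id[of q] e0[of r] by simp
      then show ?thesis
        using qr f_id by (simp add: \<theta>_def)
    qed
    have \<beta>S: "\<beta> v \<in> S" if "v \<in> vspace M" for v
      using lin_mapD(1)[OF \<beta>Q(1) part(1)[OF that]] lin_mapD(1)[OF \<beta>P(1) part(2)[OF that]]
      by (auto simp: S_def \<beta>_def)
    have \<beta>add: "\<beta> (v + w) = \<beta> v + \<beta> w" if v: "v \<in> vspace M" and w: "w \<in> vspace M" for v w
    proof -
      have "v + w - e (v + w) = (v - e v) + (w - e w)"
        using v w by (simp add: eD(2))
      then have "\<beta>P (v + w - e (v + w)) = \<beta>P (v - e v) + \<beta>P (w - e w)"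
        by (simp only: lin_mapD(2)[OF \<beta>P(1) part(2)[OF v] part(2)[OF w]])
      moreover have "\<beta>Q (f (e (v + w))) = \<beta>Q (f (e v)) + \<beta>Q (f (e w))"
        using v w part by (simp add: eD fD lin_mapD(2)[OF \<beta>Q(1)])
      ultimately show ?thesis
        by (simp add: \<beta>_def)
    qed
    have \<beta>scal: "\<beta> (scal M c v) = scal M c (\<beta> v)" if v: "v \<in> vspace M" for c v
    proof -
      have "scal M c v - e (scal M c v) = scal P c (v - e v)"
        using v by (simp add: eD(3) eqs vs.scale_right_diff_distrib)
      moreover have "f (e (scal M c v)) = scal Q c (f (e v))"
        using v by (simp add: eD(1,3) fD(3))
      ultimately show ?thesis
        using part[OF v] unfolding \<beta>_def
        by (simp add: lin_mapD(3)[OF \<beta>Q(1)] lin_mapD(3)[OF \<beta>P(1)])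
           (simp add: eqs vs.scale_right_distrib)
    qed
    have "lin_map P' M \<beta>"
      unfolding lin_map_def eqs' using SM \<beta>S \<beta>add \<beta>scal by (auto simp: subset_iff)
    moreover have "(\<Sum>g\<in>carrier G. act P' g (\<theta> (\<beta> (act P' (inv g) v)))) = v" if "v \<in> vspace P'" for v
    proof -
      have vS: "v \<in> S" and v: "v \<in> vspace M"
        using that SM eqs' by auto
      have "act P' g (\<theta> (\<beta> (act P' (inv g) v))) =
          act Q g (\<beta>Q (act Q (inv g) (f (e v)))) + act P g (\<beta>P (act P (inv g) (v - e v)))"
        if g: "g \<in> carrier G" for g
      proof -
        have gi: "inv g \<in> carrier G"
          using g by simp
        have a: "act M (inv g) v \<in> vspace M"
          by (rule act_closed[OF gi v])
        have "f (e (act M (inv g) v)) = act Q (inv g) (f (e v))"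
          using v gi by (simp add: eD(1,4) fD(4))
        moreover have "act M (inv g) v - e (act M (inv g) v) = act P (inv g) (v - e v)"
          using v gi part(3)[OF v] by (simp add: eD(4) eqs act_diff)
        ultimately have b: "\<beta> (act M (inv g) v) =
            \<beta>Q (act Q (inv g) (f (e v))) + \<beta>P (act P (inv g) (v - e v))"
          by (simp add: \<beta>_def)
        have "\<beta>Q (act Q (inv g) (f (e v))) \<in> vspace M" "\<beta>P (act P (inv g) (v - e v)) \<in> vspace M"
          using lin_mapD(1)[OF \<beta>Q(1) Q.act_closed[OF gi part(1)[OF v]]]
            lin_mapD(1)[OF \<beta>P(1) P.act_closed[OF gi part(2)[OF v]]] subs by blast+
        moreover have "act P' g (\<theta> (\<beta> (act P' (inv g) v))) = act M g (\<beta> (act M (inv g) v))"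
          by (simp only: eqs' \<theta>_id[OF \<beta>S[OF a]])
        ultimately show ?thesis
          unfolding b using g by (simp add: eqs act_add)
      qed
      then have "(\<Sum>g\<in>carrier G. act P' g (\<theta> (\<beta> (act P' (inv g) v)))) =
          trace_map G Q \<beta>Q (f (e v)) + trace_map G P \<beta>P (v - e v)"
        unfolding trace_map_def by (simp add: sum.distrib)
      also have "\<dots> = \<theta> v"
        using \<beta>Q(2) \<beta>P(2) part[OF v] by (simp add: \<theta>_def)
      finally show ?thesis
        using \<theta>_id[OF vS] by simp
    qed
    ultimately show ?thesis
      by (rule trace_identity_projective[OF fin P'.kG_module_axioms fr \<theta>])
  qed
  ultimately show ?thesis by blast
qed

text \<open>Take a projective complement with M' of least dimension: a nonzero projective summand of
  M' could be moved to the complement by \<open>projective_sum_split\<close>.\<close>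

lemma core_exists:
  assumes fin: "finite (carrier G)" and fr: "frame H M X \<pi> m l"
  shows "\<exists>M'. is_core G M M'"
proof -
  have span: "vspace M \<subseteq> vs.span (m ` X)" "finite (m ` X)"
    using frame_spans[OF fr] frameD(1)[OF fr] by auto
  define good where "good = (\<lambda>(M', P). direct_sum G M M' P \<and> projective G P)"
  have "kG_submodule G M M"
    using subspace act_closed unfolding kG_submodule_def by (intro exI[of _ "vspace M"]) auto
  moreover have "kG_submodule G (M\<lparr>vspace := {0}\<rparr>) M"
    using zero_closed unfolding kG_submodule_def
    by (intro exI[of _ "{0}"]) (auto simp: act_zero vs.subspace_def)
  ultimately have "direct_sum G M M (M\<lparr>vspace := {0}\<rparr>)"
    using zero_closed by (auto simp: direct_sum_def)
  then have "good (M, M\<lparr>vspace := {0}\<rparr>)"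
    by (simp add: good_def projective_zero[OF fin])
  from ex_has_least_nat[of good, OF this, of "\<lambda>(M', P). vs.dim (vspace M')"]
  obtain M' P where MP: "direct_sum G M M' P" "projective G P"
    and least: "\<And>N' P'. direct_sum G M N' P' \<Longrightarrow> projective G P' \<Longrightarrow> vs.dim (vspace M') \<le> vs.dim (vspace N')"
    by (auto simp: good_def)
  have "vspace Q = {0}" if Q: "direct_summand G Q M'" "projective G Q" for Q
  proof (rule ccontr)
    assume nz: "vspace Q \<noteq> {0}"
    obtain U where U: "direct_sum G M' Q U"
      using Q(1) by (auto simp: direct_summand_def)
    obtain P' where P': "direct_sum G M U P'" "projective G P'"
      using projective_sum_split[OF fin fr MP(1) U MP(2) Q(2)] by blast
    have QM': "kG_submodule G Q M'" and UM': "kG_submodule G U M'" and int: "vspace Q \<inter> vspace U = {0}"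
      using U by (auto simp: direct_sum_def)
    have M'M: "kG_submodule G M' M"
      using MP(1) by (simp add: direct_sum_def)
    have "vspace U \<noteq> vspace M'"
      using nz int kG_submoduleD(1)[OF QM'] by auto
    then have "vspace U \<subset> vspace M'"
      using kG_submoduleD(1)[OF UM'] by blast
    moreover have "vs.subspace (vspace U)"
      by (rule submodule_subspace[OF kG_submodule_trans[OF UM' M'M]])
    ultimately have "vs.dim (vspace U) < vs.dim (vspace M')"
      using vs.dim_strict_mono[OF _ _ _ span(2)] kG_submoduleD(1)[OF M'M] span(1) by blast
    then show False
      using least[OF P'] by simp
  qed
  then show ?thesis
    unfolding is_core_def using MP by blast
qed

text \<open>The components in \<open>P\<close> of the fixed frame vectors are invisible to the fixed frame forms: expanded in a
  free frame of \<open>P\<close>, the value is a sum over free \<open>Q\<close>-orbits of a constant, hence a multiple of \<open>p\<close>.\<close>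

lemma core_dim_lower_bound:
  assumes fin: "finite (carrier G)" and fr: "reduced_frame (G\<lparr>carrier := Q\<rparr>) M Y \<sigma> b k"
    and Q: "subgroup Q G" "of_nat (card Q) = (0 :: 'k)"
    and KP: "direct_sum G M K P" and P: "projective G P"
  shows "card (fixed_points (G\<lparr>carrier := Q\<rparr>) Y \<sigma>) \<le> kG_dim K"
proof -
  let ?H = "G\<lparr>carrier := Q\<rparr>" and ?F = "fixed_points (G\<lparr>carrier := Q\<rparr>) Y \<sigma>"
  have frame: "frame ?H M Y \<sigma> b k"
    using fr by (simp add: reduced_frame_def)
  have bi: "k x (b y) = (if x = y then 1 else 0)" if "x \<in> ?F" "y \<in> ?F" for x y
    using fr that by (simp add: reduced_frame_def)
  note F = frameD[OF frame]
  have QG: "Q \<subseteq> carrier G"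
    by (rule subgroup.subset[OF Q(1)])
  interpret H: group ?H
    by (rule subgroup.subgroup_is_group[OF Q(1) is_group])
  have KM: "kG_submodule G K M" and PM: "kG_submodule G P M"
    using KP by (auto simp: direct_sum_def)
  interpret K: kG_module G K by (rule submodule_kG_module[OF KM])
  interpret P: kG_module G P by (rule submodule_kG_module[OF PM])
  note eqs = kG_submoduleD[OF KM] kG_submoduleD[OF PM]
  obtain e where e: "kG_map G M K e" and eP: "\<And>v. v \<in> vspace M \<Longrightarrow> v - e v \<in> vspace P"
    using direct_sum_projection[OF KP] by metis
  obtain n m l where frP: "frame G P ({..<n} \<times> carrier G) (free_act G) m l"
    using P projective_iff_frame[OF fin] by blast
  note FP = frameD[OF frP]
  have FY: "x \<in> Y" "\<And>h. h \<in> Q \<Longrightarrow> \<sigma> h x = x" if "x \<in> ?F" for x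
    using that by (auto simp: fixed_points_def)
  have "k y (e (b x)) = k y (b x)" if x: "x \<in> ?F" and y: "y \<in> ?F" for x y
  proof -
    define r where "r = b x - e (b x)"
    have bx: "b x \<in> vspace M"
      using F(3) FY(1)[OF x] by blast
    have r: "r \<in> vspace P"
      unfolding r_def by (rule eP[OF bx])
    have ky: "k y \<in> linear_forms M"
      using F(4) FY(1)[OF y] by blast
    have rinv: "act P h r = r" if "h \<in> Q" for h
    proof -
      have hb: "act M h (b x) = b x"
        using F(6)[of h x] FY[OF x] that by simp
      then have "e (b x) = act M h (e (b x))"
        using kG_mapD(2)[OF e, of h "b x"] that QG bx by (auto simp: eqs)
      then show ?thesis
        using hb that QG bx lin_mapD(1)[OF kG_mapD(1)[OF e] bx] eqs(1)
        by (auto simp: r_def eqs act_diff subset_iff)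
    qed
    have mM: "m z \<in> vspace M" if "z \<in> {..<n} \<times> carrier G" for z
      using FP(3)[OF that] eqs(4) by blast
    have "k y r = k y (\<Sum>z\<in>{..<n} \<times> carrier G. scal M (l z r) (m z))"
      using FP(5)[OF r] by (simp add: eqs)
    also have "\<dots> = (\<Sum>z\<in>{..<n} \<times> carrier G. l z r * k y (m z))"
      using mM by (subst linear_form_sum[OF ky]) (auto simp: scal_closed linear_formsD(2)[OF ky])
    also have "\<dots> = 0"
    proof (rule H.sum_invariant_free)
      show "acts_on ?H ({..<n} \<times> carrier G) (free_act G)"
        by (rule acts_on_restrict[OF acts_on_free_act QG])
      show "h = \<one>\<^bsub>?H\<^esub>" if "h \<in> carrier ?H" "z \<in> {..<n} \<times> carrier G" "free_act G h z = z" for h z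
        using that QG by (auto simp: free_act_def subset_iff)
      show "of_nat (order ?H) = (0 :: 'k)"
        using Q(2) by (simp add: order_def)
      fix h z assume h: "h \<in> carrier ?H" and z: "z \<in> {..<n} \<times> carrier G"
      then have hG: "h \<in> carrier G" and hQ: "h \<in> Q"
        using QG by auto
      have "l (free_act G h z) r = l z r"
        using FP(7)[OF hG z r] rinv[OF hQ] by simp
      moreover have "k y (m (free_act G h z)) = k y (m z)"
        using F(7)[of h y "m z"] h FY[OF y] hQ mM[OF z] FP(6)[OF hG z] by (simp add: eqs)
      ultimately show "l (free_act G h z) r * k y (m (free_act G h z)) = l z r * k y (m z)"
        by simp
    qed
    finally have "k y r = 0" .
    then show ?thesis
      using linear_form_diff[OF ky bx, of "e (b x)"] lin_mapD(1)[OF kG_mapD(1)[OF e] bx] eqs(1)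
      by (auto simp: r_def)
  qed
  \<comment> \<open>Projecting to K does not change the values of the forms, so the projected
    vectors stay biorthogonal and are independent in K.\<close>
  then have bi': "k y (e (b x)) = (if y = x then 1 else 0)" if "x \<in> ?F" "y \<in> ?F" for x y
    using bi that by simp
  have finF: "finite ?F"
    using F(1) by (simp add: fixed_points_def)
  have eK: "e (b x) \<in> vspace K" if "x \<in> ?F" for x
    using lin_mapD(1)[OF kG_mapD(1)[OF e]] F(3) FY(1)[OF that] by blast
  have "inj_on (\<lambda>x. e (b x)) ?F" and ind: "vs.independent ((\<lambda>x. e (b x)) ` ?F)"
    using biorthogonal_independent[of ?F "\<lambda>x. e (b x)" k] finF eK eqs(1) F(4) FY(1) bi' by auto
  then have "card ?F = card ((\<lambda>x. e (b x)) ` ?F)"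
    by (simp add: card_image)
  also have "\<dots> \<le> vs.dim (vspace K)"
    using ind eK eqs(1) frame_spans[OF frame] F(1)
    by (intro vs.independent_card_le_dim_span(2)[of _ _ "b ` Y"]) auto
  also have "\<dots> = kG_dim K"
    by (simp add: kG_dim_def eqs)
  finally show ?thesis .
qed

end

section \<open>Invariant forms of p-groups\<close>

text \<open>The coordinate at v0 for a basis of the whole space that contains v0 and a basis of
  T.\<close>

lemma (in vector_space) separating_form:
  assumes T: "subspace T" and v0: "v0 \<notin> T"
  shows "\<exists>f. (\<forall>v w. f (v + w) = f v + f w) \<and> (\<forall>c v. f (scale c v) = c * f v) \<and>
    (\<forall>t\<in>T. f t = 0) \<and> f v0 = 1"
proof -
  obtain B where B: "B \<subseteq> T" "independent B" "T \<subseteq> span B" "card B = dim T"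
    using basis_exists by blast
  have TB: "span B \<subseteq> T"
    by (rule span_minimal[OF B(1) T])
  then have "v0 \<notin> span B"
    using v0 by blast
  then have ind: "independent (insert v0 B)"
    by (rule independent_insertI[OF _ B(2)])
  define C where "C = extend_basis (insert v0 B)"
  have C: "independent C" "insert v0 B \<subseteq> C" "span C = UNIV"
    using independent_extend_basis[OF ind] extend_basis_superset[OF ind] span_extend_basis[OF ind]
    by (simp_all add: C_def)
  have "representation C t v0 = 0" if "t \<in> T" for t
  proof -
    have "t \<in> span B" "B \<subseteq> C"
      using that B C by auto
    then have "representation C t = representation B t"
      by (intro representation_extend C)
    moreover have "v0 \<notin> B"
      using v0 B(1) by blast
    ultimately show ?thesis
      using representation_ne_zero[of B t v0] by auto
  qed
  moreover have "representation C v0 v0 = 1"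
    using representation_basis[OF C(1), of v0] C(2) by simp
  ultimately show ?thesis
    using representation_add[OF C(1)] representation_scale[OF C(1)] C(3)
    by (intro exI[of _ "\<lambda>v. representation C v v0"]) simp
qed

context kG_module
begin

text \<open>The \<open>\<int>/p\<close>-span of the translates of a form vanishing on \<open>T\<close> is finite of order divisible by \<open>p\<close>, so
  besides \<open>0\<close> the \<open>p\<close>-group fixes another element of it.\<close>

lemma invariant_form_exists:
  assumes p: "prime p" "order G = p ^ a" "CHAR('k) = p"
    and T: "vs.subspace T" "T \<subset> vspace M" "\<And>g v. g \<in> carrier G \<Longrightarrow> v \<in> T \<Longrightarrow> act M g v \<in> T"
  shows "\<exists>s. s \<in> linear_forms M \<and> (\<forall>g\<in>carrier G. \<forall>v\<in>vspace M. s (act M g v) = s v) \<and>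
    (\<forall>v\<in>T. s v = 0) \<and> (\<exists>v\<in>vspace M. s v \<noteq> 0)"
proof -
  have fin: "finite (carrier G)"
    using p(1,2) by (metis card.infinite not_prime_0 order_def power_eq_0_iff)
  obtain v0 where v0: "v0 \<in> vspace M" "v0 \<notin> T"
    using T(2) by blast
  obtain f where f: "\<And>v w. f (v + w) = f v + f w" "\<And>c v. f (scal M c v) = c * f v"
    "\<And>t. t \<in> T \<Longrightarrow> f t = 0" "f v0 = 1"
    using vs.separating_form[OF T(1) v0(2)] by blast
  \<comment> \<open>Natural coefficients suffice for the span over Z/p, and only their residues
    matter, which makes S finite even if the field is not. The value 0 outside
    \<open>vspace M\<close> lets equality of functions express equality of forms on M.\<close>
  define s where "s c = (\<lambda>v. if v \<in> vspace M then \<Sum>g\<in>carrier G. of_nat (c g) * f (act M g v) else 0)"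
    for c :: "'g \<Rightarrow> nat"
  define S where "S = range s"
  have of_nat_mod: "of_nat (n mod p) = (of_nat n :: 'k)" for n
  proof -
    have "(of_nat n :: 'k) = of_nat p * of_nat (n div p) + of_nat (n mod p)"
      by (metis mult_div_mod_eq of_nat_add of_nat_mult)
    moreover have "of_nat p = (0 :: 'k)"
      using of_nat_CHAR[where 'a = 'k] p(3) by simp
    ultimately show ?thesis by simp
  qed
  have "s c \<in> s ` (carrier G \<rightarrow>\<^sub>E {..<p})" for c
  proof -
    have "s c = s (restrict (\<lambda>g. c g mod p) (carrier G))"
      by (auto simp: s_def of_nat_mod fun_eq_iff intro!: sum.cong)
    moreover have "restrict (\<lambda>g. c g mod p) (carrier G) \<in> carrier G \<rightarrow>\<^sub>E {..<p}"
      using prime_gt_0_nat[OF p(1)] by auto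
    ultimately show ?thesis by (metis image_eqI)
  qed
  then have "S \<subseteq> s ` (carrier G \<rightarrow>\<^sub>E {..<p})"
    by (auto simp: S_def)
  then have finS: "finite S"
    by (rule finite_subset) (intro finite_imageI finite_PiE fin, simp)
  \<comment> \<open>The contragredient action, cut off outside \<open>vspace M\<close> as well; on
    \<open>s c\<close> it translates the coefficients on the right.\<close>
  define \<pi> where "\<pi> h t = (\<lambda>v. if v \<in> vspace M then t (act M (inv h) v) else 0)" for h and t :: "'v \<Rightarrow> 'k"
  have \<pi>s: "\<pi> h (s c) = s (\<lambda>g. c (g \<otimes> h))" if h: "h \<in> carrier G" for h c
  proof
    fix v
    have bij: "bij_betw (\<lambda>g. g \<otimes> h) (carrier G) (carrier G)"
      using h by (intro bij_betw_byWitness[where f' = "\<lambda>g. g \<otimes> inv h"]) (auto simp: m_assoc)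
    show "\<pi> h (s c) v = s (\<lambda>g. c (g \<otimes> h)) v"
    proof (cases "v \<in> vspace M")
      case True
      have "\<pi> h (s c) v = (\<Sum>g\<in>carrier G. of_nat (c g) * f (act M g (act M (inv h) v)))"
        using True h by (simp add: \<pi>_def s_def act_closed)
      also have "\<dots> = (\<Sum>g\<in>carrier G. of_nat (c (g \<otimes> h)) * f (act M (g \<otimes> h) (act M (inv h) v)))"
        by (rule sum.reindex_bij_betw[OF bij, symmetric])
      also have "\<dots> = (\<Sum>g\<in>carrier G. of_nat (c (g \<otimes> h)) * f (act M g v))"
        using True h by (intro sum.cong refl) (simp add: act_mult act_closed act_inv)
      finally show ?thesis
        using True by (simp add: s_def)
    qed (auto simp: \<pi>_def s_def)
  qed
  have act: "acts_on G S \<pi>"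
    unfolding acts_on_def
  proof (intro conjI ballI)
    fix t assume t: "t \<in> S"
    then obtain c where c: "t = s c" by (auto simp: S_def)
    show "\<pi> h t \<in> S" if "h \<in> carrier G" for h
      using \<pi>s[OF that] by (simp add: c S_def)
    show "\<pi> \<one> t = t"
      by (auto simp: c \<pi>_def s_def act_one fun_eq_iff)
    show "\<pi> (g \<otimes> h) t = \<pi> g (\<pi> h t)" if "g \<in> carrier G" "h \<in> carrier G" for g h
      using that by (auto simp: \<pi>_def fun_eq_iff inv_mult_group act_mult act_closed)
  qed
  \<comment> \<open>These coefficients give f itself on M; adding it is the translation by which S
    is counted modulo p.\<close>
  define c0 where "c0 g = (if g = \<one> then 1 else 0 :: nat)" for g
  have s_c0: "s c0 v = f v" if "v \<in> vspace M" for v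
  proof -
    have "s c0 v = (\<Sum>g\<in>carrier G. if g = \<one> then f (act M g v) else 0)"
      using that unfolding s_def c0_def by (auto intro!: sum.cong)
    then show ?thesis
      using fin that by (simp add: act_one)
  qed
  have "p dvd card S"
  proof (rule dvd_card_translation_closed[OF p(1) finS])
    show "s c0 \<noteq> 0"
      using s_c0[OF v0(1)] f(4) by (metis zero_fun_apply zero_neq_one)
    have "((+) (s c0) ^^ i) 0 = (\<lambda>v. of_nat i * s c0 v)" for i
      by (induction i) (auto simp: fun_eq_iff algebra_simps)
    then show "((+) (s c0) ^^ p) 0 = 0"
      by (simp add: fun_eq_iff flip: p(3))
    fix t assume "t \<in> S"
    then obtain c where c: "t = s c" by (auto simp: S_def)
    have "s c + s c0 = s (\<lambda>g. c g + c0 g)"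
      by (auto simp: s_def fun_eq_iff distrib_right sum.distrib)
    then show "t + s c0 \<in> S"
      by (simp add: c S_def)
  qed
  moreover have "s (\<lambda>_. 0) = 0"
    by (auto simp: s_def fun_eq_iff)
  then have "0 \<in> S" "\<forall>g\<in>carrier G. \<pi> g 0 = 0"
    by (auto simp: S_def \<pi>_def fun_eq_iff intro: range_eqI[OF sym])
  ultimately obtain t where t: "t \<in> S" "t \<noteq> 0" "\<forall>g\<in>carrier G. \<pi> g t = t"
    using p_group_second_fixed_point[OF p(1,2) act finS] by blast
  obtain c where c: "t = s c"
    using t(1) by (auto simp: S_def)
  show ?thesis
  proof (intro exI conjI ballI)
    show "t \<in> linear_forms M"
      unfolding c linear_forms_def s_def
      by (auto simp: add_closed scal_closed act_add act_scal f algebra_simps sum.distrib sum_distrib_left)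
    show "t (act M g v) = t v" if "g \<in> carrier G" "v \<in> vspace M" for g v
    proof -
      have "\<pi> (inv g) t v = t v"
        using t(3) that by simp
      then show ?thesis
        using that by (simp add: \<pi>_def)
    qed
    show "t v = 0" if "v \<in> T" for v
      using that T(3) f(3) by (simp add: c s_def)
    obtain v where "t v \<noteq> 0"
      using t(2) by (auto simp: fun_eq_iff)
    moreover from this have "v \<in> vspace M"
      by (auto simp: c s_def split: if_splits)
    ultimately show "\<exists>v\<in>vspace M. t v \<noteq> 0"
      by blast
  qed
qed

text \<open>The left ideal property of traces among the equivariant endomorphisms.\<close>

lemma trace_map_compose:
  assumes f: "kG_map G M M f" and \<beta>: "lin_map M M \<beta>" and v: "v \<in> vspace M"
  shows "trace_map G M (\<lambda>v. f (\<beta> v)) v = f (trace_map G M \<beta> v)"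
proof -
  have b: "\<beta> (act M (inv g) v) \<in> vspace M" if "g \<in> carrier G" for g
    using that v by (simp add: lin_mapD(1)[OF \<beta>] act_closed)
  have "f (trace_map G M \<beta> v) = (\<Sum>g\<in>carrier G. f (act M g (\<beta> (act M (inv g) v))))"
    unfolding trace_map_def using b
    by (subst lin_map_sum[OF kG_mapD(1)[OF f] vector_space_scal]) (auto simp: act_closed)
  also have "\<dots> = trace_map G M (\<lambda>v. f (\<beta> v)) v"
    unfolding trace_map_def using b by (intro sum.cong) (auto simp: kG_mapD(2)[OF f])
  finally show ?thesis by simp
qed

text \<open>Modulo the ideal of traces \<mu> is the identity, hence so are its powers.\<close>

lemma id_decomposition_power:
  assumes \<beta>: "lin_map M M \<beta>" and \<mu>: "kG_map G M M \<mu>"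
    and id: "\<And>v. v \<in> vspace M \<Longrightarrow> v = trace_map G M \<beta> v + \<mu> v"
  shows "\<exists>\<gamma>. lin_map M M \<gamma> \<and> (\<forall>v\<in>vspace M. v = trace_map G M \<gamma> v + (\<mu> ^^ n) v)"
proof (induction n)
  case 0
  have "lin_map M M (\<lambda>_. 0)"
    by (rule lin_mapI) (auto simp: zero_closed)
  moreover have "trace_map G M (\<lambda>_. 0) v = 0" for v
    by (simp add: trace_map_def act_zero)
  ultimately show ?case
    by (intro exI[of _ "\<lambda>_. 0"]) simp
next
  case (Suc n)
  then obtain \<gamma> where \<gamma>: "lin_map M M \<gamma>" "\<And>v. v \<in> vspace M \<Longrightarrow> v = trace_map G M \<gamma> v + (\<mu> ^^ n) v"
    by blast
  note pow = kG_map_funpow[OF \<mu>, of n]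
  have lin: "lin_map M M (\<lambda>v. (\<mu> ^^ n) (\<beta> v))"
    by (rule lin_map_compose[OF \<beta> kG_mapD(1)[OF pow]])
  have "v = trace_map G M (\<lambda>v. \<gamma> v + (\<mu> ^^ n) (\<beta> v)) v + (\<mu> ^^ Suc n) v" if v: "v \<in> vspace M" for v
  proof -
    have "(\<mu> ^^ n) v = (\<mu> ^^ n) (trace_map G M \<beta> v + \<mu> v)"
      using id[OF v] by simp
    also have "\<dots> = (\<mu> ^^ n) (trace_map G M \<beta> v) + (\<mu> ^^ n) (\<mu> v)"
      by (intro lin_mapD(2)[OF kG_mapD(1)[OF pow]] trace_map_closed \<beta> v lin_mapD(1)[OF kG_mapD(1)[OF \<mu>]])
    also have "(\<mu> ^^ n) (\<mu> v) = (\<mu> ^^ Suc n) v"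
      by (simp add: funpow_swap1)
    finally have "trace_map G M \<gamma> v + (\<mu> ^^ n) v =
        trace_map G M (\<lambda>v. \<gamma> v + (\<mu> ^^ n) (\<beta> v)) v + (\<mu> ^^ Suc n) v"
      unfolding trace_map_add[OF \<gamma>(1) lin v] trace_map_compose[OF pow \<beta> v] by (simp only: add.assoc)
    with \<gamma>(2)[OF v] show ?thesis
      by (rule trans)
  qed
  then show ?case
    using lin_map_add_maps[OF \<gamma>(1) lin] by blast
qed

end

section \<open>Transversals and p-subgroups\<close>

lemma (in group) left_transversal:
  assumes P: "subgroup P G"
  shows "\<exists>R\<subseteq>carrier G. bij_betw (\<lambda>(x, h). x \<otimes> h) (R \<times> P) (carrier G)"
proof -
  let ?H = "G\<lparr>carrier := P\<rparr>"
  have PG: "P \<subseteq> carrier G"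
    by (rule subgroup.subset[OF P])
  interpret H: group ?H
    by (rule subgroup.subgroup_is_group[OF P is_group])
  \<comment> \<open>Multiplying on the right by the inverse is a free left action of P. The inverse
    is undone below by reindexing P.\<close>
  have "acts_on ?H (carrier G) (\<lambda>h g. g \<otimes> inv h)"
    using PG by (auto simp: acts_on_def subset_iff inv_mult_group m_assoc)
  moreover have "h = \<one>\<^bsub>?H\<^esub>" if "h \<in> carrier ?H" "x \<in> carrier G" "x \<otimes> inv h = x" for h x
    using that PG by (auto simp: subset_iff)
  ultimately obtain R where R: "R \<subseteq> carrier G" "bij_betw (\<lambda>(x, h). x \<otimes> inv h) (R \<times> P) (carrier G)"
    using H.free_transversal[of "carrier G" "\<lambda>h g. g \<otimes> inv h"] by auto
  have "bij_betw (\<lambda>(x, h). (x, inv h)) (R \<times> P) (R \<times> P)"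
    using subgroup.m_inv_closed[OF P] PG
    by (intro bij_betw_byWitness[where f' = "\<lambda>(x, h). (x, inv h)"]) auto
  from bij_betw_trans[OF this R(2)]
  have "bij_betw (\<lambda>(x, h). x \<otimes> h) (R \<times> P) (carrier G)"
    using PG by (subst bij_betw_cong[where g = "(\<lambda>(x, h). x \<otimes> inv h) \<circ> (\<lambda>(x, h). (x, inv h))"]) auto
  then show ?thesis
    using R(1) by blast
qed

lemma (in group) sylow_exists:
  assumes "prime p" "finite (carrier G)"
  shows "\<exists>P a r. subgroup P G \<and> card P = p ^ a \<and> order G = p ^ a * r \<and> \<not> p dvd r"
proof -
  have "order G \<noteq> 0"
    using assms(2) order_gt_0_iff_finite by simp
  then obtain a r where ar: "order G = p ^ a * r" "\<not> p dvd r"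
    using multiplicity_decompose'[of "order G" p] assms(1) not_prime_unit by blast
  obtain P where "subgroup P G" "card P = p ^ a"
    using sylow_thm[OF assms(1) is_group ar(1) assms(2)] by metis
  then show ?thesis
    using ar by blast
qed

text \<open>Cauchy's theorem inside S, as \<open>sylow_thm\<close> with exponent 1. It will be
  applied to stabilizers of frame points.\<close>

lemma (in group) prime_order_subgroup:
  assumes "prime p" "order G = p ^ a" "S \<noteq> {\<one>}" "subgroup S G"
  shows "\<exists>Q. subgroup Q G \<and> Q \<subseteq> S \<and> card Q = p"
proof -
  have fin: "finite (carrier G)"
    using assms(1,2) by (metis card.infinite not_prime_0 order_def power_eq_0_iff)
  let ?S = "G\<lparr>carrier := S\<rparr>"
  interpret S: group ?S
    by (rule subgroup.subgroup_is_group[OF assms(4) is_group])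
  have SG: "S \<subseteq> carrier G"
    by (rule subgroup.subset[OF assms(4)])
  have "card S dvd p ^ a"
    using lagrange[OF assms(4)] assms(2) by (metis dvd_triv_right)
  then obtain i where i: "card S = p ^ i"
    using assms(1) by (metis divides_primepow_nat)
  have "card S \<noteq> 1"
    using subgroup.one_closed[OF assms(4)] assms(3) by (auto simp: card_1_singleton_iff)
  then have "i \<noteq> 0"
    using i by (intro notI) simp
  then have "order ?S = p ^ 1 * p ^ (i - 1)"
    using i by (simp add: order_def power_eq_if)
  then obtain Q where "subgroup Q ?S" "card Q = p ^ 1"
    using sylow_thm[OF assms(1) S.is_group, of 1 "p ^ (i - 1)"] finite_subset[OF SG fin] by auto
  then show ?thesis
    using incl_subgroup[OF assms(4)] subgroup.subset[of Q ?S] by auto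
qed

section \<open>The upper bound\<close>

context kG_module
begin

lemma lin_map_span:
  assumes h: "lin_map M M h" and D: "D \<subseteq> vspace M" and S: "vs.subspace S"
    and DS: "\<And>d. d \<in> D \<Longrightarrow> h d \<in> S" and v: "v \<in> vs.span D"
  shows "h v \<in> S"
proof -
  note hD = lin_mapD[OF h]
  have "vs.subspace {v\<in>vspace M. h v \<in> S}"
    using lin_map_zero[OF h vector_space_scal] closed
    by (intro vs.subspaceI) (auto simp: hD vs.subspace_0[OF S] vs.subspace_add[OF S] vs.subspace_scale[OF S])
  then have "vs.span D \<subseteq> {v\<in>vspace M. h v \<in> S}"
    using D DS by (intro vs.span_minimal) auto
  then show ?thesis
    using v by blast
qed

lemma norm_map_image:
  assumes f: "kG_map G M M f" and Q: "Q \<subseteq> carrier G" and w: "w \<in> vspace M"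
  shows "f (norm_map (G\<lparr>carrier := Q\<rparr>) M w) = norm_map (G\<lparr>carrier := Q\<rparr>) M (f w)"
proof -
  have "f (\<Sum>h\<in>Q. act M h w) = (\<Sum>h\<in>Q. f (act M h w))"
    using Q w by (subst lin_map_sum[OF kG_mapD(1)[OF f] vector_space_scal]) (auto simp: act_closed subset_iff)
  also have "\<dots> = (\<Sum>h\<in>Q. act M h (f w))"
    using Q w by (intro sum.cong) (auto simp: kG_mapD(2)[OF f] subset_iff)
  finally show ?thesis
    by (simp add: norm_map_def)
qed

text \<open>The map \<open>f\<close> is a power of the partial sum \<open>\<mu>\<close> of the frame over the points with nontrivial stabilizer,
  taken so high that \<open>\<mu>\<close> is bijective on its image \<open>L\<close>; the points with trivial stabilizer contribute a
  trace.  A \<open>G\<close>-invariant form on \<open>L\<close> that kills the span on the right vanishes on all of \<open>L\<close>, because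
  it kills the norms from subgroups of order \<open>p\<close>.\<close>

lemma p_group_trace_complement:
  assumes p: "prime p" "order G = p ^ a" "CHAR('k) = p"
    and fr: "frame G M X \<pi> m l" and D: "D \<subseteq> vspace M"
    and inv: "\<And>Q v. subgroup Q G \<Longrightarrow> card Q = p \<Longrightarrow> v \<in> invariants (G\<lparr>carrier := Q\<rparr>) M \<Longrightarrow>
      \<exists>u\<in>vs.span D. \<exists>w\<in>vspace M. v = u + norm_map (G\<lparr>carrier := Q\<rparr>) M w"
  shows "\<exists>f \<beta>. kG_map G M M f \<and> lin_map M M \<beta> \<and> (\<forall>v\<in>vspace M. v = trace_map G M \<beta> v + f v) \<and>
    f ` vspace M \<subseteq> vs.span ((\<lambda>(g, d). act M g (f d)) ` (carrier G \<times> D))"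
proof -
  note F = frameD[OF fr]
  define Xf where "Xf = {x\<in>X. \<forall>h\<in>carrier G. \<pi> h x = x \<longrightarrow> h = \<one>}"
  have XfX: "Xf \<subseteq> X"
    by (auto simp: Xf_def)
  \<comment> \<open>Stabilizers along an orbit are conjugate, so triviality of the stabilizer is an
    invariant condition.\<close>
  have stable: "\<pi> g x \<in> Xf" if g: "g \<in> carrier G" and x: "x \<in> Xf" for g x
  proof -
    have xX: "x \<in> X"
      using x XfX by blast
    have "h = \<one>" if h: "h \<in> carrier G" and hfix: "\<pi> h (\<pi> g x) = \<pi> g x" for h
    proof -
      have "\<pi> (inv g \<otimes> (h \<otimes> g)) x = \<pi> (inv g) (\<pi> h (\<pi> g x))"
        using g h xX F(2) by (simp add: acts_on_mult)
      also have "\<dots> = x"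
        using acts_on_inv(1)[OF F(2) g xX] hfix by simp
      finally have "inv g \<otimes> (h \<otimes> g) = \<one>"
        using x g h by (simp add: Xf_def)
      then have "g \<otimes> (inv g \<otimes> (h \<otimes> g)) = g"
        using g by simp
      moreover have "g \<otimes> (inv g \<otimes> (h \<otimes> g)) = h \<otimes> g"
        using g h by (simp add: m_assoc[symmetric])
      ultimately show ?thesis
        using g h by simp
    qed
    then show ?thesis
      using acts_on_closed[OF F(2) g xX] by (simp add: Xf_def)
  qed
  then have "acts_on G Xf \<pi>"
    using F(2) XfX unfolding acts_on_def by blast
  moreover have "\<forall>h\<in>carrier G. \<forall>x\<in>Xf. \<pi> h x = x \<longrightarrow> h = \<one>"
    by (auto simp: Xf_def)
  ultimately obtain \<beta>0 where \<beta>0: "lin_map M M \<beta>0"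
    "\<And>v. v \<in> vspace M \<Longrightarrow> (\<Sum>x\<in>Xf. scal M (l x v) (m x)) = trace_map G M \<beta>0 v"
    using frame_free_part[OF fr XfX] by blast
  define \<mu> where "\<mu> v = v - trace_map G M \<beta>0 v" for v
  note tr = trace_map_kG_map[OF \<beta>0(1)]
  note trD = lin_mapD[OF kG_mapD(1)[OF tr]] kG_mapD(2)[OF tr]
  have \<mu>: "kG_map G M M \<mu>"
    unfolding kG_map_def lin_map_def \<mu>_def
    by (auto simp: trD diff_closed act_diff vs.scale_right_diff_distrib)
  have \<mu>_sum: "\<mu> v = (\<Sum>x\<in>X - Xf. scal M (l x v) (m x))" if "v \<in> vspace M" for v
    using sum.subset_diff[OF XfX F(1), of "\<lambda>x. scal M (l x v) (m x)"] F(5)[OF that] \<beta>0(2)[OF that]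
    unfolding \<mu>_def by (metis add_diff_cancel_right')
  obtain n where bij: "bij_betw \<mu> ((\<mu> ^^ n) ` vspace M) ((\<mu> ^^ n) ` vspace M)"
    using Fitting[OF \<mu> frame_spans[OF fr]] F(1) by blast
  define f where "f = \<mu> ^^ n"
  have f: "kG_map G M M f"
    unfolding f_def by (rule kG_map_funpow[OF \<mu>])
  note fD = lin_mapD[OF kG_mapD(1)[OF f]] kG_mapD(2)[OF f]
  have "v = trace_map G M \<beta>0 v + \<mu> v" for v
    by (simp add: \<mu>_def)
  then obtain \<beta> where \<beta>: "lin_map M M \<beta>" "\<forall>v\<in>vspace M. v = trace_map G M \<beta> v + f v"
    using id_decomposition_power[OF \<beta>0(1) \<mu>, of n] unfolding f_def by blast
  define L where "L = M\<lparr>vspace := f ` vspace M\<rparr>"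
  have LM: "kG_submodule G L M"
    unfolding L_def by (rule image_submodule[OF f])
  interpret L: kG_module G L
    by (rule submodule_kG_module[OF LM])
  have eqs: "scal L = scal M" "act L = act M" "vspace L = f ` vspace M"
    by (simp_all add: L_def)
  have fL: "f v \<in> vspace L" if "v \<in> vspace M" for v
    using that by (simp add: eqs)
  \<comment> \<open>D need not be stable under the group. Adding the translates of the f d makes T
    stable, as \<open>invariant_form_exists\<close> demands.\<close>
  define E where "E = (\<lambda>(g, d). act M g (f d)) ` (carrier G \<times> D)"
  define T where "T = vs.span E"
  have EL: "E \<subseteq> vspace L"
    using D fL L.act_closed by (auto simp: E_def eqs(2) subset_iff)
  have subL: "vs.subspace (vspace L)"
    by (rule submodule_subspace[OF LM])
  have TL: "T \<subseteq> vspace L"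
    unfolding T_def by (rule vs.span_minimal[OF EL subL])
  have subT: "vs.subspace T"
    unfolding T_def by (rule vs.subspace_span)
  have LsubM: "vspace L \<subseteq> vspace M"
    by (rule kG_submoduleD(1)[OF LM])
  have T_stable: "act M g t \<in> T" if g: "g \<in> carrier G" and t: "t \<in> T" for g t
  proof (rule lin_map_span[OF lin_map_act[OF g] _ subT])
    show "E \<subseteq> vspace M" "t \<in> vs.span E"
      using EL LsubM t by (auto simp: T_def)
    fix e assume "e \<in> E"
    then obtain h d where hd: "h \<in> carrier G" "d \<in> D" "e = act M h (f d)"
      by (auto simp: E_def)
    then have "act M g e = act M (g \<otimes> h) (f d)"
      using g D fD(1) by (simp add: act_mult subset_iff)
    then have "act M g e \<in> E"
      using hd g by (auto simp: E_def)
    then show "act M g e \<in> T"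
      unfolding T_def by (rule vs.span_base)
  qed
  have fspan: "f u \<in> T" if "u \<in> vs.span D" for u
  proof (rule lin_map_span[OF kG_mapD(1)[OF f] D subT _ that])
    fix d assume d: "d \<in> D"
    then have "f d = act M \<one> (f d)"
      using D fD(1) by (auto simp: act_one)
    then have "f d \<in> E"
      unfolding E_def using d by (intro image_eqI[of _ _ "(\<one>, d)"]) auto
    then show "f d \<in> T"
      unfolding T_def by (rule vs.span_base)
  qed
  have "T = vspace L"
  proof (rule ccontr)
    assume "T \<noteq> vspace L"
    then have "T \<subset> vspace L"
      using TL by blast
    moreover have "module.subspace (scal L) T"
      using subT by (simp add: eqs)
    ultimately obtain s where s: "s \<in> linear_forms L"
      "\<forall>g\<in>carrier G. \<forall>v\<in>vspace L. s (act L g v) = s v" "\<forall>v\<in>T. s v = 0" "\<exists>v\<in>vspace L. s v \<noteq> 0"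
      using L.invariant_form_exists[OF p, of T] T_stable by (auto simp: eqs(2))
    have s_m: "s (f (m x)) = 0" if x: "x \<in> X - Xf" for x
    proof -
      have xX: "x \<in> X"
        using x by blast
      let ?S = "{g\<in>carrier G. \<pi> g x = x}"
      have S: "subgroup ?S G"
        by (rule stabilizer_subgroup[OF F(2) xX])
      have "?S \<noteq> {\<one>}"
        using x by (auto simp: Xf_def)
      then obtain Q where Q: "subgroup Q G" "Q \<subseteq> ?S" "card Q = p"
        using prime_order_subgroup[OF p(1,2) _ S] by blast
      let ?H = "G\<lparr>carrier := Q\<rparr>"
      have QG: "Q \<subseteq> carrier G"
        by (rule subgroup.subset[OF Q(1)])
      \<comment> \<open>By the hypothesis on Q, m x lies in the span of D up to a norm. The first
        part is sent into T by f; on the norm the value of s is a multiple of p.\<close>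
      have "m x \<in> invariants ?H M"
        using Q(2) F(3)[OF xX] F(6)[OF _ xX] by (force simp: invariants_def)
      then obtain u w where uw: "u \<in> vs.span D" "w \<in> vspace M" "m x = u + norm_map ?H M w"
        using inv[OF Q(1,3)] by blast
      interpret H: kG_module ?H L
        by (rule L.restrict_kG_module[OF Q(1)])
      interpret HM: kG_module ?H M
        by (rule restrict_kG_module[OF Q(1)])
      have uM: "u \<in> vspace M"
        using vs.span_minimal[OF D subspace] uw(1) by blast
      have "f (m x) = f u + f (norm_map ?H M w)"
        unfolding uw(3) by (rule fD(2)[OF uM HM.norm_map_closed[OF uw(2)]])
      also have "f (norm_map ?H M w) = norm_map ?H L (f w)"
        using norm_map_image[OF f QG uw(2)] by (simp add: norm_map_def eqs)
      finally have "s (f (m x)) = s (f u) + s (norm_map ?H L (f w))"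
        using linear_formsD(1)[OF s(1) fL[OF uM] H.norm_map_closed[OF fL[OF uw(2)]]] by simp
      also have "s (f u) = 0"
        using s(3) fspan[OF uw(1)] by blast
      also have "s (norm_map ?H L (f w)) = of_nat (order ?H) * s (f w)"
      proof (rule H.linear_form_norm_map[OF s(1) _ fL[OF uw(2)]])
        show "s (act L g v) = s v" if "g \<in> carrier ?H" "v \<in> vspace L" for g v
          using s(2) that QG by auto
      qed
      also have "of_nat (order ?H) = (0 :: 'k)"
        using Q(3) of_nat_CHAR[where 'a = 'k] p(3) by (simp add: order_def)
      finally show ?thesis by simp
    qed
    have "s v = 0" if "v \<in> vspace L" for v
    proof -
      \<comment> \<open>Since \<mu> is bijective on L and commutes with its power f, every v in L is
        f (\<mu> u), a combination of the f (m x) over points with nontrivial stabilizer.\<close>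
      have "\<mu> ` vspace L = vspace L"
        using bij by (simp add: bij_betw_def eqs f_def)
      then have "v \<in> \<mu> ` f ` vspace M"
        using that by (simp add: eqs)
      then obtain u where u: "u \<in> vspace M" "v = \<mu> (f u)"
        by blast
      have "v = f (\<mu> u)"
        using u(2) by (simp add: f_def funpow_swap1)
      also have "\<dots> = f (\<Sum>x\<in>X - Xf. scal M (l x u) (m x))"
        by (simp only: \<mu>_sum[OF u(1)])
      also have "\<dots> = (\<Sum>x\<in>X - Xf. scal L (l x u) (f (m x)))"
        using F(3) by (subst lin_map_sum[OF kG_mapD(1)[OF f] vector_space_scal]) (auto simp: scal_closed fD eqs)
      finally have "s v = (\<Sum>x\<in>X - Xf. s (scal L (l x u) (f (m x))))"
        using F(3) fL by (simp, intro L.linear_form_sum[OF s(1)] L.scal_closed) auto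
      also have "\<dots> = 0"
        using F(3) fL s_m by (intro sum.neutral) (auto simp: linear_formsD(2)[OF s(1)])
      finally show ?thesis .
    qed
    then show False
      using s(4) by blast
  qed
  then show ?thesis
    using f \<beta> by (intro exI[of _ f] exI[of _ \<beta>]) (auto simp: T_def E_def eqs)
qed

lemma core_dim_upper_bound:
  assumes fin: "finite (carrier G)" and p: "prime p" "CHAR('k) = p"
    and fr: "frame G M X \<pi> m l"
    and no_proj: "\<And>Q. direct_summand G Q M \<Longrightarrow> projective G Q \<Longrightarrow> vspace Q = {0}"
    and frQ: "\<And>Q. subgroup Q G \<Longrightarrow> card Q = p \<Longrightarrow> frame (G\<lparr>carrier := Q\<rparr>) M (Y Q) (\<sigma> Q) (b Q) (k Q)"
  shows "kG_dim M \<le> card (carrier G) *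
    (\<Sum>Q | subgroup Q G \<and> card Q = p. card (fixed_points (G\<lparr>carrier := Q\<rparr>) (Y Q) (\<sigma> Q)))"
proof -
  define S where "S = {Q. subgroup Q G \<and> card Q = p}"
  define Fx where "Fx Q = fixed_points (G\<lparr>carrier := Q\<rparr>) (Y Q) (\<sigma> Q)" for Q
  have finFx: "finite (Fx Q)" if "Q \<in> S" for Q
    using frameD(1)[OF frQ] that by (auto simp: S_def Fx_def fixed_points_def)
  have finS: "finite S"
    by (rule finite_subset[of _ "Pow (carrier G)"]) (use fin in \<open>auto simp: S_def dest: subgroup.subset\<close>)
  \<comment> \<open>One set serves all subgroups of order p at once, because the Sylow subgroup may
    contain several and their fixed vectors generate only jointly.\<close>
  define D where "D = (\<Union>Q\<in>S. b Q ` Fx Q)"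
  have finD: "finite D"
    using finS finFx by (simp add: D_def)
  have DM: "D \<subseteq> vspace M"
    using frameD(3)[OF frQ] by (auto simp: D_def S_def Fx_def fixed_points_def)
  have card_D: "card D \<le> (\<Sum>Q\<in>S. card (Fx Q))"
  proof -
    have "card D \<le> (\<Sum>Q\<in>S. card (b Q ` Fx Q))"
      unfolding D_def by (rule card_UN_le[OF finS])
    also have "\<dots> \<le> (\<Sum>Q\<in>S. card (Fx Q))"
      by (intro sum_mono card_image_le finFx)
    finally show ?thesis .
  qed
  obtain P a r where P: "subgroup P G" "card P = p ^ a" "order G = p ^ a * r" "\<not> p dvd r"
    using sylow_exists[OF p(1) fin] by blast
  let ?P = "G\<lparr>carrier := P\<rparr>"
  have PG: "P \<subseteq> carrier G"
    by (rule subgroup.subset[OF P(1)])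
  interpret P: kG_module ?P M
    by (rule restrict_kG_module[OF P(1)])
  \<comment> \<open>The fixed part of the frame for Q provides u; the free part is a trace, and at
    an invariant vector a trace is a norm.\<close>
  have invQ: "\<exists>u\<in>vs.span D. \<exists>w\<in>vspace M. v = u + norm_map (?P\<lparr>carrier := Q\<rparr>) M w"
    if Q: "subgroup Q ?P" "card Q = p" and v: "v \<in> invariants (?P\<lparr>carrier := Q\<rparr>) M" for Q v
  proof -
    have QG: "subgroup Q G"
      by (rule incl_subgroup[OF P(1) Q(1)])
    let ?Q = "G\<lparr>carrier := Q\<rparr>"
    interpret Q: kG_module ?Q M
      by (rule restrict_kG_module[OF QG])
    have vM: "v \<in> vspace M"
      using v by (simp add: invariants_def)
    have "prime (order ?Q)"
      using Q(2) p(1) by (simp add: order_def)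
    then obtain \<beta> where \<beta>: "lin_map M M \<beta>" "v = (\<Sum>x\<in>Fx Q. scal M (k Q x v) (b Q x)) + trace_map ?Q M \<beta> v"
      using Q.prime_order_frame_split[OF frQ[OF QG Q(2)]] vM unfolding Fx_def by metis
    have "trace_map ?Q M \<beta> v = norm_map ?Q M (\<beta> v)"
      using v by (intro Q.trace_map_invariant) simp
    moreover have "(\<Sum>x\<in>Fx Q. scal M (k Q x v) (b Q x)) \<in> vs.span D"
      using QG Q(2) by (intro vs.span_sum vs.span_scale vs.span_base) (auto simp: D_def S_def)
    moreover have "\<beta> v \<in> vspace M"
      by (rule lin_mapD(1)[OF \<beta>(1) vM])
    ultimately show ?thesis
      using \<beta>(2) by auto
  qed
  have "order ?P = p ^ a"
    using P(2) by (simp add: order_def)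
  from P.p_group_trace_complement[OF p(1) this p(2) frame_restrict[OF fr PG] DM invQ]
  obtain f \<beta> where f: "kG_map ?P M M f" and \<beta>: "lin_map M M \<beta>"
    and id: "\<And>v. v \<in> vspace M \<Longrightarrow> v = trace_map ?P M \<beta> v + f v"
    and fspan: "\<And>v. v \<in> vspace M \<Longrightarrow> f v \<in> vs.span ((\<lambda>(g, d). act M g (f d)) ` (P \<times> D))"
    by (auto simp: image_subset_iff)
  note fD = lin_mapD[OF kG_mapD(1)[OF f]]
  obtain R where R: "R \<subseteq> carrier G" "bij_betw (\<lambda>(x, h). x \<otimes> h) (R \<times> P) (carrier G)"
    using left_transversal[OF P(1)] by blast
  have "card R * card P = order G"
    using bij_betw_same_card[OF R(2)] by (simp add: card_cartesian_product order_def)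
  then have cardR: "card R = r"
    using P(2,3) p(1) by (simp add: prime_gt_0_nat)
  define c where "c = (of_nat (card R) :: 'k)"
  have c: "c \<noteq> 0"
    using P(4) p(2) by (simp add: c_def cardR of_nat_eq_0_iff_char_dvd)
  define E where "E = (\<lambda>(g, d). act M g (f d)) ` (carrier G \<times> D)"
  have E: "act M g (f d) \<in> E" if "g \<in> carrier G" "d \<in> D" for g d
    using that by (auto simp: E_def)
  have fdM: "f d \<in> vspace M" if "d \<in> D" for d
    using that DM fD(1) by blast
  \<comment> \<open>Conjugate the decomposition for P by each coset representative x and sum over R.
    The traces over the cosets x P add up to the trace over G, the left side becomes c v, and the
    terms with f lie in the span of E.\<close>
  have key: "scal M c v - trace_map G M \<beta> v \<in> vs.span E" if v: "v \<in> vspace M" for v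
  proof -
    let ?y = "\<lambda>x. act M (inv x) v"
    have yM: "?y x \<in> vspace M" if "x \<in> R" for x
      using that R(1) v by (auto intro: act_closed)
    have "v = (\<Sum>h\<in>P. act M (x \<otimes> h) (\<beta> (act M (inv (x \<otimes> h)) v))) + act M x (f (?y x))" if x: "x \<in> R" for x
    proof -
      have xG: "x \<in> carrier G"
        using x R(1) by blast
      have b: "\<beta> (act M (inv h) (?y x)) \<in> vspace M" if "h \<in> P" for h
        using that PG by (intro lin_mapD(1)[OF \<beta>] act_closed[OF _ yM[OF x]]) auto
      have tr: "trace_map ?P M \<beta> (?y x) = (\<Sum>h\<in>P. act M h (\<beta> (act M (inv h) (?y x))))"
        unfolding trace_map_def using m_inv_consistent[OF P(1)] by (intro sum.cong) auto
      have "v = act M x (?y x)"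
        using act_inv(1)[OF xG v] by simp
      also have "\<dots> = act M x (trace_map ?P M \<beta> (?y x) + f (?y x))"
        using id[OF yM[OF x]] by simp
      also have "\<dots> = act M x (\<Sum>h\<in>P. act M h (\<beta> (act M (inv h) (?y x)))) + act M x (f (?y x))"
        unfolding tr using PG b yM[OF x]
        by (intro act_add xG sum_closed fD(1)) (auto intro: act_closed)
      also have "act M x (\<Sum>h\<in>P. act M h (\<beta> (act M (inv h) (?y x)))) =
          (\<Sum>h\<in>P. act M x (act M h (\<beta> (act M (inv h) (?y x)))))"
        using PG b by (intro act_sum xG) (auto intro: act_closed)
      also have "\<dots> = (\<Sum>h\<in>P. act M (x \<otimes> h) (\<beta> (act M (inv (x \<otimes> h)) v)))"
      proof (rule sum.cong)
        fix h assume h: "h \<in> P"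
        then have hG: "h \<in> carrier G"
          using PG by blast
        have "act M (inv (x \<otimes> h)) v = act M (inv h) (?y x)"
          using hG xG v by (simp add: inv_mult_group act_mult)
        then show "act M x (act M h (\<beta> (act M (inv h) (?y x)))) =
            act M (x \<otimes> h) (\<beta> (act M (inv (x \<otimes> h)) v))"
          using act_mult[OF xG hG b[OF h]] by simp
      qed simp
      finally show ?thesis .
    qed
    then have "(\<Sum>x\<in>R. v) = (\<Sum>x\<in>R. (\<Sum>h\<in>P. act M (x \<otimes> h) (\<beta> (act M (inv (x \<otimes> h)) v))) + act M x (f (?y x)))"
      by (intro sum.cong refl)
    also have "\<dots> = (\<Sum>x\<in>R. \<Sum>h\<in>P. act M (x \<otimes> h) (\<beta> (act M (inv (x \<otimes> h)) v))) + (\<Sum>x\<in>R. act M x (f (?y x)))"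
      by (rule sum.distrib)
    also have "(\<Sum>x\<in>R. \<Sum>h\<in>P. act M (x \<otimes> h) (\<beta> (act M (inv (x \<otimes> h)) v))) = trace_map G M \<beta> v"
      unfolding trace_map_def
      using sum.reindex_bij_betw[OF R(2), of "\<lambda>g. act M g (\<beta> (act M (inv g) v))"]
      by (simp add: sum.cartesian_product case_prod_unfold)
    finally have "scal M c v - trace_map G M \<beta> v = (\<Sum>x\<in>R. act M x (f (?y x)))"
      by (simp add: c_def vs.sum_constant_scale)
    also have "\<dots> \<in> vs.span E"
    proof (intro vs.span_sum)
      fix x assume x: "x \<in> R"
      then have xG: "x \<in> carrier G"
        using R(1) by blast
      show "act M x (f (?y x)) \<in> vs.span E"
      proof (rule lin_map_span[OF lin_map_act[OF xG] _ vs.subspace_span _ fspan[OF yM[OF x]]])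
        show "(\<lambda>(g, d). act M g (f d)) ` (P \<times> D) \<subseteq> vspace M"
          using PG fdM by (auto intro: act_closed)
        fix e assume "e \<in> (\<lambda>(g, d). act M g (f d)) ` (P \<times> D)"
        then obtain h d where hd: "h \<in> P" "d \<in> D" "e = act M h (f d)"
          by auto
        then have hG: "h \<in> carrier G"
          using PG by blast
        have "act M x e = act M (x \<otimes> h) (f d)"
          unfolding hd(3) by (rule act_mult[OF xG hG fdM[OF hd(2)], symmetric])
        then show "act M x e \<in> vs.span E"
          using E[of "x \<otimes> h" d] xG hG hd(2) by (auto intro: vs.span_base)
      qed
    qed
    finally show ?thesis .
  qed
  obtain N where N: "\<And>v. v \<in> vspace M \<Longrightarrow> (trace_map G M \<beta> ^^ N) v = 0"
    using trace_map_nilpotent[OF fin fr \<beta> no_proj] by blast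
  \<comment> \<open>Induction on the power of the trace that kills v: the trace of v lies in the
    span by hypothesis, then c v by \<open>key\<close>, then v because c is invertible.\<close>
  have "v \<in> vs.span E" if "v \<in> vspace M" "(trace_map G M \<beta> ^^ i) v = 0" for i v
    using that
  proof (induction i arbitrary: v)
    case 0
    then show ?case
      by (simp add: vs.span_zero)
  next
    case (Suc i)
    have "trace_map G M \<beta> v \<in> vs.span E"
      using Suc trace_map_closed[OF \<beta>] by (simp add: funpow_swap1)
    from vs.span_add[OF key[OF Suc.prems(1)] this] have "scal M c v \<in> vs.span E"
      by simp
    from vs.span_scale[OF this, of "inverse c"] show ?case
      using c by simp
  qed
  then have "vspace M \<subseteq> vs.span E"
    using N by blast
  moreover have finE: "finite E"
    using fin finD by (simp add: E_def)
  ultimately have "kG_dim M \<le> card E"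
    unfolding kG_dim_def by (rule vs.dim_le_card)
  also have "card E \<le> card (carrier G) * card D"
    unfolding E_def using card_image_le[of "carrier G \<times> D"] fin finD by (simp add: card_cartesian_product)
  also have "\<dots> \<le> card (carrier G) * (\<Sum>Q\<in>S. card (Fx Q))"
    using card_D by simp
  finally show ?thesis
    by (simp add: S_def Fx_def)
qed

end

section \<open>The limit\<close>

text \<open>The n-th root of the constant C tends to 1. The bounds start at n = 1 because for A = 0
  the power A^0 is 1, which the core of the 0-th tensor power need not reach.\<close>

lemma root_sandwich:
  assumes "\<And>n. n \<ge> 1 \<Longrightarrow> A ^ n \<le> c n" "\<And>n. n \<ge> 1 \<Longrightarrow> c n \<le> C * A ^ n" and C: "C > (0 :: nat)"
  shows "(\<lambda>n. root n (real (c n))) \<longlonglongrightarrow> real A"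
proof (rule tendsto_sandwich)
  show "(\<lambda>n. real A) \<longlonglongrightarrow> real A"
    by simp
  have "(\<lambda>n. root n (real C) * real A) \<longlonglongrightarrow> 1 * real A"
    using C by (intro tendsto_mult LIMSEQ_root_const tendsto_const) simp
  then show "(\<lambda>n. root n (real C) * real A) \<longlonglongrightarrow> real A"
    by simp
  have "real A \<le> root n (real (c n))" if n: "n \<ge> 1" for n
  proof -
    have "root n (real A ^ n) \<le> root n (real (c n))"
      using n assms(1)[OF n] by (intro real_root_le_mono) (auto simp flip: of_nat_power)
    then show ?thesis
      using n by (simp add: real_root_power_cancel)
  qed
  then show "\<forall>\<^sub>F n in sequentially. real A \<le> root n (real (c n))"
    by (rule eventually_sequentiallyI)
  have "root n (real (c n)) \<le> root n (real C) * real A" if n: "n \<ge> 1" for n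
  proof -
    have "real (c n) \<le> real (C * A ^ n)"
      using assms(2)[OF n] by (rule of_nat_mono)
    then have "root n (real (c n)) \<le> root n (real C * real A ^ n)"
      using n by (intro real_root_le_mono) auto
    then show ?thesis
      using n by (simp add: real_root_mult real_root_power_cancel)
  qed
  then show "\<forall>\<^sub>F n in sequentially. root n (real (c n)) \<le> root n (real C) * real A"
    by (rule eventually_sequentiallyI)
qed

theorem theorem6p4:
  fixes p :: nat
    and G :: "('g, 'b) monoid_scheme"
    and M :: "('g, 'k::field, 'v::ab_group_add) kG_module"
  assumes "prime p" and "CHAR('k) = p"
    and "group G" and "finite (carrier G)"
    and "kG_module G M" and "fin_dim M"
    and "trivial_source G M"
  shows "benson_symonds G M \<in> \<int>"
proof -
  interpret M: kG_module G M by fact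
  obtain X :: "nat set" and \<pi> m l where fr: "frame G M X \<pi> m l"
    using frame_trivial_source[OF assms(7)] by blast
  define S where "S = {Q. subgroup Q G \<and> card Q = p}"
  have finS: "finite S"
    by (rule finite_subset[of _ "Pow (carrier G)"])
       (use assms(4) in \<open>auto simp: S_def dest: subgroup.subset\<close>)
  have "\<exists>(Y :: (nat + nat \<times> 'g) set) \<sigma> b k. reduced_frame (G\<lparr>carrier := Q\<rparr>) M Y \<sigma> b k" if "Q \<in> S" for Q
  proof -
    have Q: "subgroup Q G" "card Q = p"
      using that by (auto simp: S_def)
    interpret Q: kG_module "G\<lparr>carrier := Q\<rparr>" M
      by (rule M.restrict_kG_module[OF Q(1)])
    show ?thesis
      using Q.reduced_frame_exists[OF frame_restrict[OF fr subgroup.subset[OF Q(1)]]] Q(2) assms(1)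
      by (simp add: order_def)
  qed
  \<comment> \<open>The frames are chosen for M itself, before the exponent n, so the numbers
    \<open>a Q\<close> do not depend on n.\<close>
  then obtain Y :: "'g set \<Rightarrow> (nat + nat \<times> 'g) set" and \<sigma> b k
    where red: "\<And>Q. Q \<in> S \<Longrightarrow> reduced_frame (G\<lparr>carrier := Q\<rparr>) M (Y Q) (\<sigma> Q) (b Q) (k Q)"
    by metis
  define a where "a Q = card (fixed_points (G\<lparr>carrier := Q\<rparr>) (Y Q) (\<sigma> Q))" for Q
  \<comment> \<open>The 0 covers the case that G has no subgroup of order p; then the upper bound
    makes every core zero.\<close>
  define A where "A = Max (insert 0 (a ` S))"
  have aA: "a Q \<le> A" if "Q \<in> S" for Q
    using that finS by (auto simp: A_def intro: Max_ge)
  have A: "A = 0 \<or> A \<in> a ` S"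
    using Max_in[of "insert 0 (a ` S)"] finS by (auto simp: A_def)
  have bounds: "(\<forall>Q\<in>S. a Q ^ n \<le> core_dim G M n) \<and>
      core_dim G M n \<le> card (carrier G) * (\<Sum>Q\<in>S. a Q ^ n)" for n
  proof -
    define N where "N = tensor_power M n"
    interpret N: kG_module G N
      unfolding N_def by (rule M.kG_module_tensor_power)
    have frN: "frame G N (words X n) (\<lambda>g. map (\<pi> g)) (\<lambda>xs. pure_tensor M (map m xs)) (\<lambda>xs t. t (map l xs))"
      unfolding N_def by (rule M.frame_tensor_power[OF fr])
    have redN: "reduced_frame (G\<lparr>carrier := Q\<rparr>) N (words (Y Q) n) (\<lambda>g. map (\<sigma> Q g))
        (\<lambda>xs. pure_tensor M (map (b Q) xs)) (\<lambda>xs t. t (map (k Q) xs))" if "Q \<in> S" for Q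
    proof -
      interpret Q: kG_module "G\<lparr>carrier := Q\<rparr>" M
        using that by (intro M.restrict_kG_module) (simp add: S_def)
      show ?thesis
        unfolding N_def by (rule Q.reduced_frame_tensor_power[OF red[OF that]])
    qed
    have card_fixed: "card (fixed_points (G\<lparr>carrier := Q\<rparr>) (words (Y Q) n) (\<lambda>g. map (\<sigma> Q g))) = a Q ^ n"
      if "Q \<in> S" for Q
    proof -
      have "finite (Y Q)"
        using red[OF that] frameD(1) unfolding reduced_frame_def by blast
      then have "finite (fixed_points (G\<lparr>carrier := Q\<rparr>) (Y Q) (\<sigma> Q))"
        by (simp add: fixed_points_def)
      then show ?thesis
        by (simp add: fixed_points_words card_words a_def)
    qed
    define K where "K = core G N"
    have "is_core G N K"
      unfolding K_def core_def by (rule someI_ex[OF N.core_exists[OF assms(4) frN]])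
    then obtain P where P: "direct_sum G N K P" "projective G P"
      and no_proj: "\<And>Q. direct_summand G Q K \<Longrightarrow> projective G Q \<Longrightarrow> vspace Q = {0}"
      by (auto simp: is_core_def)
    have "kG_submodule G K N"
      using P(1) by (simp add: direct_sum_def)
    then interpret K: kG_module G K
      by (rule N.submodule_kG_module)
    obtain e where e: "retract G K N (\<lambda>v. v) e"
      using retract_direct_sum[OF N.kG_module_axioms P(1)] by blast
    have cd: "core_dim G M n = kG_dim K"
      by (simp add: core_dim_def K_def N_def)
    have "a Q ^ n \<le> core_dim G M n" if "Q \<in> S" for Q
    proof -
      have "of_nat (card Q) = (0 :: 'k)" "subgroup Q G"
        using that assms(2) of_nat_CHAR[where 'a = 'k] by (auto simp: S_def)
      then show ?thesis
        using N.core_dim_lower_bound[OF assms(4) redN[OF that] _ _ P] by (simp add: cd card_fixed[OF that])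
    qed
    moreover have "core_dim G M n \<le> card (carrier G) * (\<Sum>Q\<in>S. a Q ^ n)"
    proof -
      \<comment> \<open>After projection to K the frame may cease to be reduced, but its index set,
        and with it the number \<open>a Q ^ n\<close> of fixed points, is unchanged.\<close>
      have frK: "frame (G\<lparr>carrier := Q\<rparr>) K (words (Y Q) n) (\<lambda>g. map (\<sigma> Q g))
          (\<lambda>xs. e (pure_tensor M (map (b Q) xs))) (\<lambda>xs t. t (map (k Q) xs))"
        if "subgroup Q G" "card Q = p" for Q
      proof -
        have "Q \<in> S"
          using that by (simp add: S_def)
        then show ?thesis
          using frame_retract[OF K.kG_module_axioms N.kG_module_axioms e subgroup.subset[OF that(1)]]
            redN[of Q] unfolding reduced_frame_def by blast
      qed
      have "kG_dim K \<le> card (carrier G) * (\<Sum>Q\<in>S. card (fixed_points (G\<lparr>carrier := Q\<rparr>) (words (Y Q) n) (\<lambda>g. map (\<sigma> Q g))))"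
        unfolding S_def
        by (rule K.core_dim_upper_bound[OF assms(4,1,2)
              frame_retract'[OF K.kG_module_axioms N.kG_module_axioms e frN] no_proj frK])
      then show ?thesis
        by (simp add: cd card_fixed)
    qed
    ultimately show ?thesis by blast
  qed
  have "(\<lambda>n. root n (real (core_dim G M n))) \<longlonglongrightarrow> real A"
  proof (rule root_sandwich)
    show "A ^ n \<le> core_dim G M n" if "n \<ge> 1" for n
      using A bounds that by (auto simp: power_0_left)
    \<comment> \<open>The summand 1 keeps the constant positive when S is empty.\<close>
    show "core_dim G M n \<le> (card (carrier G) * card S + 1) * A ^ n" for n
    proof -
      have "(\<Sum>Q\<in>S. a Q ^ n) \<le> (\<Sum>Q\<in>S. A ^ n)"
        using aA by (intro sum_mono power_mono) auto
      then have "(\<Sum>Q\<in>S. a Q ^ n) \<le> card S * A ^ n"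
        by simp
      then have "core_dim G M n \<le> card (carrier G) * (card S * A ^ n)"
        using bounds[of n] by (meson le_trans mult_le_mono2)
      then show ?thesis
        by (simp add: algebra_simps)
    qed
  qed simp
  then have "benson_symonds G M = real A"
    unfolding benson_symonds_def by (rule limI)
  then show ?thesis
    by simp
qed

end
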